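(* Let $N\ge 2$ and $k,k_1>0$. With the type-$B$ operators $T_i$, the Laplacian $\Delta_B=\sum_{i=1}^N T_i^2$ and the polynomials $h_{n,\varepsilon}$ ($n=0,1,2,\dots$, $\varepsilon\in\{0,1\}$) on $\mathbf{R}^N$ defined in the context, the family $\{h_{n,\varepsilon}: n\ge 0,\ \varepsilon\in\{0,1\}\}$ is a basis of the vector space of all polynomials $h$ on $\mathbf{R}^N$ satisfying $\Delta_B h=0$ and $T_i h=0$ for all $i$ with $2<i\le N$.
   Context: Pochhammer symbol: $(a)_0=1$, $(a)_j=a(a+1)\cdots(a+j-1)$. Reflections on $\mathbf{R}^N$: $x\sigma_i$ is $x$ with $x_i$ replaced by $-x_i$; $x\sigma_{ij}$ is $x$ with the entries $x_i,x_j$ interchanged; $x\tau_{ij}$ is $x$ with the $i$-th entry replaced by $-x_j$ and the $j$-th entry replaced by $-x_i$. They act on functions by $(wf)(x)=f(xw)$. For $1\le i\le N$, $$T_i=\frac{\partial}{\partial x_i}+k_1\frac{1-\sigma_i}{x_i}+k\sum_{j\ne i}\left\{\frac{1-\sigma_{ij}}{x_i-x_j}+\frac{1-\tau_{ij}}{x_i+x_j}\right\},\qquad \Delta_B=\sum_{i=1}^N T_i^2 .$$ Generating functions: $$F_0(x;s,t)=\frac{1-st(x_1^2+x_2^2)+t^2x_1^2x_2^2}{(1-2stx_1^2+t^2x_1^4)(1-2stx_2^2+t^2x_2^4)}\prod_{i=1}^N(1-2stx_i^2+t^2x_i^4)^{-k},$$ $$F_1(x;s,t)=\frac{t(x_1^2-x_2^2)}{(1-2stx_1^2+t^2x_1^4)(1-2stx_2^2+t^2x_2^4)}\prod_{i=1}^N(1-2stx_i^2+t^2x_i^4)^{-k}.$$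 The polynomials $\phi_{n,j},\psi_{n,j}$ ($0\le j\le n$) in $x$ are defined by the power series expansions $$\sum_{n=0}^\infty\sum_{j=0}^n\phi_{n,j}(x)s^jt^n=F_0+F_1,\qquad \sum_{n=0}^\infty\sum_{j=0}^n\psi_{n,j}(x)s^jt^n=x_1(F_0+sF_1)-x_1F_1 .$$ The polynomials $h_{n,\varepsilon}$: for $n=0,1,2,\dots$, $$h_{4n,0}=\sum_{j=0}^{n}\frac{(2(N-1)k+k_1+\frac12+2n)_j(\frac12)_j}{((N-1)k+k_1+\frac12+n)_j(Nk+n+1)_j}\phi_{2n,2j},$$ $$h_{4n+2,0}=\sum_{j=0}^{n}\frac{(2(N-1)k+k_1+\frac32+2n)_j(\frac12)_j}{((N-1)k+k_1+\frac32+n)_j(Nk+n+2)_j}\phi_{2n+1,2j},$$ $$h_{4n+1,1}=x_1x_2\sum_{j=0}^{n}\frac{(2(N-1)k+k_1+\frac32+2n)_j(\frac12)_j}{((N-1)k+k_1+\frac32+n)_j(Nk+n+1)_j}\phi_{2n,2j},$$ $$h_{4n+3,1}=x_1x_2\sum_{j=0}^{n}\frac{(2(N-1)k+k_1+\frac52+2n)_j(\frac12)_j}{((N-1)k+k_1+\frac52+n)_j(Nk+n+2)_j}\phi_{2n+1,2j},$$ $$h_{4n+1,0}=\sum_{j=0}^{n}\frac{(2(N-1)k+k_1+\frac32+2n)_j(\frac12)_j}{((N-1)k+k_1+\frac32+n)_j(Nk+n+1)_j}\psi_{2n,2j}+\sum_{j=1}^{n}\frac{(2(N-1)k+k_1+\frac32+2n)_{j-1}(\frac12)_j}{((N-1)k+k_1+\frac32+n)_{j-1}(Nk+n+1)_j}\psi_{2n,2j-1},$$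 $$h_{4n+3,0}=\sum_{j=0}^{n}\frac{(2(N-1)k+k_1+\frac52+2n)_j(\frac12)_j}{((N-1)k+k_1+\frac32+n)_j(Nk+n+2)_j}\psi_{2n+1,2j}+\sum_{j=1}^{n+1}\frac{(2(N-1)k+k_1+\frac52+2n)_{j-1}(\frac12)_j}{((N-1)k+k_1+\frac32+n)_j(Nk+n+2)_{j-1}}\psi_{2n+1,2j-1},$$ and $h_{4n,1}:=\sigma_{12}h_{4n+1,0}$, $h_{4n+2,1}:=\sigma_{12}h_{4n+3,0}$.
   Formalization: In the formula for h_{4n+3,1} the denominator factor ((N-1)k+k_1+3/2+n)_j is replaced by ((N-1)k+k_1+5/2+n)_j; with 3/2 as printed, h_{7,1} is not annihilated by Δ_B and the claim fails. *)

theory Defs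
  imports "HOL-Analysis.Analysis" "HOL-Library.Function_Algebras"
begin

text \<open>
  Points of N-dimensional space are vectors of type \<open>real ^ 'n\<close> with \<open>N = CARD('n)\<close>.  The
  coordinates written \<open>x\<^sub>1\<close> and \<open>x\<^sub>2\<close> on paper are \<open>x $ i1\<close> and \<open>x $ i2\<close> for two distinct
  indices \<open>i1\<close>, \<open>i2\<close>; the condition \<open>2 < i \<le> N\<close> becomes \<open>i \<notin> {i1, i2}\<close>.  Polynomials are
  identified with polynomial functions (\<^const>\<open>real_polynomial_function\<close>).
\<close>

subsection \<open>The real vector space of functions\<close>

definition fun_scale :: "real \<Rightarrow> ('a \<Rightarrow> real) \<Rightarrow> 'a \<Rightarrow> real" where
  "fun_scale c f = (\<lambda>x. c * f x)"

global_interpretation fun_space: vector_space "fun_scale :: real \<Rightarrow> ('a \<Rightarrow> real) \<Rightarrow> 'a \<Rightarrow> real"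
  by unfold_locales (auto simp: fun_scale_def fun_eq_iff algebra_simps)

subsection \<open>Reflections and Dunkl operators of type B\<close>

definition refl_sign :: "'n \<Rightarrow> real ^ 'n \<Rightarrow> real ^ 'n" where
  "refl_sign i x = (\<chi> m. if m = i then - x $ i else x $ m)"

definition refl_swap :: "'n \<Rightarrow> 'n \<Rightarrow> real ^ 'n \<Rightarrow> real ^ 'n" where
  "refl_swap i j x = (\<chi> m. if m = i then x $ j else if m = j then x $ i else x $ m)"

definition refl_negswap :: "'n \<Rightarrow> 'n \<Rightarrow> real ^ 'n \<Rightarrow> real ^ 'n" where
  "refl_negswap i j x = (\<chi> m. if m = i then - x $ j else if m = j then - x $ i else x $ m)"

definition partial :: "'n \<Rightarrow> (real ^ 'n \<Rightarrow> real) \<Rightarrow> real ^ 'n \<Rightarrow> real" where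
  "partial i f x = deriv (\<lambda>h. f (x + h *\<^sub>R axis i 1)) 0"

text \<open>
  Exact division of polynomials.  The difference quotients in the Dunkl operators are polynomials;
  dividing pointwise instead would give wrong values on the hyperplanes where the linear form
  vanishes, because \<open>y / 0 = 0\<close>.
\<close>

definition poly_quot :: "(real ^ 'n \<Rightarrow> real) \<Rightarrow> (real ^ 'n \<Rightarrow> real) \<Rightarrow> real ^ 'n \<Rightarrow> real" where
  "poly_quot f l = (THE q. real_polynomial_function q \<and> (\<forall>x. l x * q x = f x))"

definition dunkl :: "real \<Rightarrow> real \<Rightarrow> 'n::finite \<Rightarrow> (real ^ 'n \<Rightarrow> real) \<Rightarrow> real ^ 'n \<Rightarrow> real" where
  "dunkl k k1 i f = (\<lambda>x.
     partial i f x
     + k1 * poly_quot (\<lambda>y. f y - f (refl_sign i y)) (\<lambda>y. y $ i) x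
     + k * (\<Sum>j\<in>UNIV - {i}.
         poly_quot (\<lambda>y. f y - f (refl_swap i j y)) (\<lambda>y. y $ i - y $ j) x
         + poly_quot (\<lambda>y. f y - f (refl_negswap i j y)) (\<lambda>y. y $ i + y $ j) x))"

definition laplace_B :: "real \<Rightarrow> real \<Rightarrow> (real ^ 'n::finite \<Rightarrow> real) \<Rightarrow> real ^ 'n \<Rightarrow> real" where
  "laplace_B k k1 f = (\<lambda>x. \<Sum>i\<in>UNIV. dunkl k k1 i (dunkl k k1 i f) x)"

subsection \<open>Generating functions\<close>

definition gen_quad :: "real \<Rightarrow> real \<Rightarrow> real \<Rightarrow> real" where
  "gen_quad s t u = 1 - 2 * s * t * u\<^sup>2 + t\<^sup>2 * u ^ 4"

definition gen_F0 :: "real \<Rightarrow> 'n::finite \<Rightarrow> 'n \<Rightarrow> real ^ 'n \<Rightarrow> real \<Rightarrow> real \<Rightarrow> real" where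
  "gen_F0 k i1 i2 x s t =
     (1 - s * t * ((x $ i1)\<^sup>2 + (x $ i2)\<^sup>2) + t\<^sup>2 * (x $ i1)\<^sup>2 * (x $ i2)\<^sup>2)
     / (gen_quad s t (x $ i1) * gen_quad s t (x $ i2))
     * (\<Prod>i\<in>UNIV. gen_quad s t (x $ i) powr (- k))"

definition gen_F1 :: "real \<Rightarrow> 'n::finite \<Rightarrow> 'n \<Rightarrow> real ^ 'n \<Rightarrow> real \<Rightarrow> real \<Rightarrow> real" where
  "gen_F1 k i1 i2 x s t =
     (t * ((x $ i1)\<^sup>2 - (x $ i2)\<^sup>2))
     / (gen_quad s t (x $ i1) * gen_quad s t (x $ i2))
     * (\<Prod>i\<in>UNIV. gen_quad s t (x $ i) powr (- k))"

text \<open>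
  \<open>gen_expansion F c\<close>: for every \<open>s\<close>, the series \<open>\<Sum>n. \<Sum>j\<le>n. c n j * s ^ j * t ^ n\<close> converges to
  \<open>F s t\<close> for \<open>t\<close> near 0.  This determines \<open>c n j\<close> for \<open>j \<le> n\<close>; the remaining entries, which do
  not occur in the series, are normalised to 0 so that the array \<open>c\<close> is unique.
\<close>

definition gen_expansion :: "(real \<Rightarrow> real \<Rightarrow> real) \<Rightarrow> (nat \<Rightarrow> nat \<Rightarrow> real) \<Rightarrow> bool" where
  "gen_expansion F c \<longleftrightarrow>
     (\<forall>n j. n < j \<longrightarrow> c n j = 0) \<and>
     (\<forall>s. \<forall>\<^sub>F t in nhds 0. (\<lambda>n. (\<Sum>j\<le>n. c n j * s ^ j) * t ^ n) sums F s t)"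

definition gen_coeff :: "(real \<Rightarrow> real \<Rightarrow> real) \<Rightarrow> nat \<Rightarrow> nat \<Rightarrow> real" where
  "gen_coeff F = (THE c. gen_expansion F c)"

definition phi :: "real \<Rightarrow> 'n::finite \<Rightarrow> 'n \<Rightarrow> nat \<Rightarrow> nat \<Rightarrow> real ^ 'n \<Rightarrow> real" where
  "phi k i1 i2 n j x =
     gen_coeff (\<lambda>s t. gen_F0 k i1 i2 x s t + gen_F1 k i1 i2 x s t) n j"

definition psi :: "real \<Rightarrow> 'n::finite \<Rightarrow> 'n \<Rightarrow> nat \<Rightarrow> nat \<Rightarrow> real ^ 'n \<Rightarrow> real" where
  "psi k i1 i2 n j x =
     gen_coeff (\<lambda>s t. x $ i1 * (gen_F0 k i1 i2 x s t + s * gen_F1 k i1 i2 x s t)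
                      - x $ i1 * gen_F1 k i1 i2 x s t) n j"

subsection \<open>The planar harmonic polynomials\<close>

text \<open>
  The suffix records the second index of \<open>h\<close> and the residue of the first index modulo 4; the
  argument \<open>n\<close> is the quotient of the first index by 4.
\<close>

definition h0_0 :: "real \<Rightarrow> real \<Rightarrow> 'n::finite \<Rightarrow> 'n \<Rightarrow> nat \<Rightarrow> real ^ 'n \<Rightarrow> real" where
  "h0_0 k k1 i1 i2 n x = (let N = real CARD('n) in
     \<Sum>j\<le>n. (pochhammer (2 * (N - 1) * k + k1 + 1/2 + 2 * real n) j * pochhammer (1/2) j)
       / (pochhammer ((N - 1) * k + k1 + 1/2 + real n) j * pochhammer (N * k + real n + 1) j)
       * phi k i1 i2 (2 * n) (2 * j) x)"

definition h0_2 :: "real \<Rightarrow> real \<Rightarrow> 'n::finite \<Rightarrow> 'n \<Rightarrow> nat \<Rightarrow> real ^ 'n \<Rightarrow> real" where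
  "h0_2 k k1 i1 i2 n x = (let N = real CARD('n) in
     \<Sum>j\<le>n. (pochhammer (2 * (N - 1) * k + k1 + 3/2 + 2 * real n) j * pochhammer (1/2) j)
       / (pochhammer ((N - 1) * k + k1 + 3/2 + real n) j * pochhammer (N * k + real n + 2) j)
       * phi k i1 i2 (2 * n + 1) (2 * j) x)"

definition h1_1 :: "real \<Rightarrow> real \<Rightarrow> 'n::finite \<Rightarrow> 'n \<Rightarrow> nat \<Rightarrow> real ^ 'n \<Rightarrow> real" where
  "h1_1 k k1 i1 i2 n x = (let N = real CARD('n) in
     x $ i1 * x $ i2 *
     (\<Sum>j\<le>n. (pochhammer (2 * (N - 1) * k + k1 + 3/2 + 2 * real n) j * pochhammer (1/2) j)
       / (pochhammer ((N - 1) * k + k1 + 3/2 + real n) j * pochhammer (N * k + real n + 1) j)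
       * phi k i1 i2 (2 * n) (2 * j) x))"

text \<open>
  The printed formula for \<open>h\<close> with indices \<open>4n+3, 1\<close> has \<open>3/2\<close> in the denominator Pochhammer
  symbol.  This is a misprint for \<open>5/2\<close>: with \<open>3/2\<close> the polynomial is not annihilated by the
  Laplacian (already for indices \<open>7, 1\<close>), while \<open>5/2\<close> results from replacing \<open>k1\<close> by \<open>k1 + 1\<close>
  in the coefficients of \<open>h0_2\<close>, just as \<open>h1_1\<close> results from \<open>h0_0\<close>.
\<close>

definition h1_3 :: "real \<Rightarrow> real \<Rightarrow> 'n::finite \<Rightarrow> 'n \<Rightarrow> nat \<Rightarrow> real ^ 'n \<Rightarrow> real" where
  "h1_3 k k1 i1 i2 n x = (let N = real CARD('n) in
     x $ i1 * x $ i2 *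
     (\<Sum>j\<le>n. (pochhammer (2 * (N - 1) * k + k1 + 5/2 + 2 * real n) j * pochhammer (1/2) j)
       / (pochhammer ((N - 1) * k + k1 + 5/2 + real n) j * pochhammer (N * k + real n + 2) j)
       * phi k i1 i2 (2 * n + 1) (2 * j) x))"

definition h0_1 :: "real \<Rightarrow> real \<Rightarrow> 'n::finite \<Rightarrow> 'n \<Rightarrow> nat \<Rightarrow> real ^ 'n \<Rightarrow> real" where
  "h0_1 k k1 i1 i2 n x = (let N = real CARD('n) in
     (\<Sum>j\<le>n. (pochhammer (2 * (N - 1) * k + k1 + 3/2 + 2 * real n) j * pochhammer (1/2) j)
       / (pochhammer ((N - 1) * k + k1 + 3/2 + real n) j * pochhammer (N * k + real n + 1) j)
       * psi k i1 i2 (2 * n) (2 * j) x)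
     + (\<Sum>j=1..n.
         (pochhammer (2 * (N - 1) * k + k1 + 3/2 + 2 * real n) (j - 1) * pochhammer (1/2) j)
       / (pochhammer ((N - 1) * k + k1 + 3/2 + real n) (j - 1) * pochhammer (N * k + real n + 1) j)
       * psi k i1 i2 (2 * n) (2 * j - 1) x))"

definition h0_3 :: "real \<Rightarrow> real \<Rightarrow> 'n::finite \<Rightarrow> 'n \<Rightarrow> nat \<Rightarrow> real ^ 'n \<Rightarrow> real" where
  "h0_3 k k1 i1 i2 n x = (let N = real CARD('n) in
     (\<Sum>j\<le>n. (pochhammer (2 * (N - 1) * k + k1 + 5/2 + 2 * real n) j * pochhammer (1/2) j)
       / (pochhammer ((N - 1) * k + k1 + 3/2 + real n) j * pochhammer (N * k + real n + 2) j)
       * psi k i1 i2 (2 * n + 1) (2 * j) x)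
     + (\<Sum>j=1..n+1.
         (pochhammer (2 * (N - 1) * k + k1 + 5/2 + 2 * real n) (j - 1) * pochhammer (1/2) j)
       / (pochhammer ((N - 1) * k + k1 + 3/2 + real n) j * pochhammer (N * k + real n + 2) (j - 1))
       * psi k i1 i2 (2 * n + 1) (2 * j - 1) x))"

definition h_planar ::
  "real \<Rightarrow> real \<Rightarrow> 'n::finite \<Rightarrow> 'n \<Rightarrow> nat \<Rightarrow> nat \<Rightarrow> real ^ 'n \<Rightarrow> real" where
  "h_planar k k1 i1 i2 m e = (let n = m div 4; r = m mod 4 in
     if e = 0 then
       (if r = 0 then h0_0 k k1 i1 i2 n
        else if r = 1 then h0_1 k k1 i1 i2 n
        else if r = 2 then h0_2 k k1 i1 i2 n
        else h0_3 k k1 i1 i2 n)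
     else
       (if r = 0 then (\<lambda>x. h0_1 k k1 i1 i2 n (refl_swap i1 i2 x))
        else if r = 1 then h1_1 k k1 i1 i2 n
        else if r = 2 then (\<lambda>x. h0_3 k k1 i1 i2 n (refl_swap i1 i2 x))
        else h1_3 k k1 i1 i2 n))"

definition planar_harmonics ::
  "real \<Rightarrow> real \<Rightarrow> 'n::finite \<Rightarrow> 'n \<Rightarrow> (real ^ 'n \<Rightarrow> real) set" where
  "planar_harmonics k k1 i1 i2 =
     {f. real_polynomial_function f \<and>
         laplace_B k k1 f = (\<lambda>x. 0) \<and>
         (\<forall>i. i \<notin> {i1, i2} \<longrightarrow> dunkl k k1 i f = (\<lambda>x. 0))}"

end

theory Submission
  imports Defs "HOL-Complex_Analysis.Laurent_Convergence"
begin

text \<open>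
  Write \<open>T\<^sub>1, T\<^sub>2\<close> for the operators of the two distinguished coordinates.

  \<^emph>\<open>Two dimensions per degree suffice.\<close>  The operators commute (\<open>dunkl_commute\<close>), and for positive
  parameters only constants are killed by all of them (\<open>dunkl_kernel_constant\<close>).  On planar harmonics
  \<open>T\<^sub>2\<^sup>2 = - T\<^sub>1\<^sup>2\<close> and the other operators vanish, so a product of \<open>n\<close> operators is up to sign
  \<open>T\<^sub>1\<^sup>n\<close>, \<open>T\<^sub>1\<^sup>n\<^sup>-\<^sup>1 T\<^sub>2\<close> or zero.  A planar harmonic of degree \<open>n\<close> is therefore determined modulo
  lower degree by two constants, the values of \<open>T\<^sub>1\<^sup>n\<close> and \<open>T\<^sub>1\<^sup>n\<^sup>-\<^sup>1 T\<^sub>2\<close> on it (\<open>PH_descend\<close>).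

  \<^emph>\<open>The polynomials h form a triangular system for these constants.\<close>  The operator \<open>T\<^sub>1\<close> maps
  \<open>h\<^sub>n\<^sub>+\<^sub>1\<^sub>,\<^sub>0\<close> to a non-zero multiple of \<open>h\<^sub>n\<^sub>,\<^sub>0\<close>, and \<open>h\<^sub>n\<^sub>,\<^sub>1\<close> is the image of \<open>h\<^sub>n\<^sub>+\<^sub>1\<^sub>,\<^sub>0\<close> under the
  exchange of the two coordinates if \<open>n\<close> is even, and a non-zero multiple of \<open>T\<^sub>2 h\<^sub>n\<^sub>+\<^sub>2\<^sub>,\<^sub>0\<close> if \<open>n\<close> is odd.
  Going down to \<open>h\<^sub>0\<^sub>,\<^sub>0 = 1\<close>, the constant of \<open>T\<^sub>1\<^sup>n\<close> on \<open>h\<^sub>n\<^sub>,\<^sub>0\<close> and that of \<open>T\<^sub>1\<^sup>n T\<^sub>2\<close> on \<open>h\<^sub>n\<^sub>,\<^sub>1\<close>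
  are non-zero, while \<open>T\<^sub>1\<^sup>n\<^sup>+\<^sup>1 h\<^sub>n\<^sub>,\<^sub>1 = 0\<close>; \<open>basis_criterion\<close> concludes.  The ladder also yields
  harmonicity: for even \<open>n\<close>, \<open>T\<^sub>1\<^sup>2 h\<^sub>n\<^sub>,\<^sub>0\<close> is a multiple of \<open>h\<^sub>n\<^sub>-\<^sub>2\<^sub>,\<^sub>0\<close>, which has the opposite symmetry
  under the exchange, and this turns \<open>T\<^sub>1\<^sup>2\<close> into \<open>- T\<^sub>2\<^sup>2\<close>.

  \<^emph>\<open>The ladder.\<close>  The coefficients of \<open>s\<^sup>jt\<^sup>n\<close> in \<open>F\<^sub>0\<close> and \<open>F\<^sub>1\<close> are functions of the squares of the
  coordinates.  On such functions \<open>T\<^sub>1\<close> becomes an operation on the generating series, and identities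
  of rational functions express the result through \<open>t d/dt\<close> and \<open>d/ds\<close> of \<open>F\<^sub>0\<close> and \<open>F\<^sub>1\<close>
  (locale \<open>rational_identities\<close>).  This gives the formulas \<open>dunkl_a\<close>, \<open>dunkl_b\<close>,
  \<open>dunkl_x1_a\<close>, \<open>dunkl_x1_b\<close> for the coefficients; summed against the Pochhammer quotients in the
  definition of \<open>h\<close>, all unwanted terms telescope (the lemmas \<open>chain_i_j\<close>).
\<close>

section \<open>Polynomial functions\<close>

lemma poly_coord: "real_polynomial_function (\<lambda>x::real^'n. x $ l)"
  by (intro real_polynomial_function.intros(1) bounded_linear_vec_nth)

lemma poly_cmult: "real_polynomial_function f \<Longrightarrow> real_polynomial_function (\<lambda>x. c * f x)"
  by (intro real_polynomial_function.intros(4) real_polynomial_function.intros(2))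

lemma poly_zero: "real_polynomial_function (\<lambda>x. 0)"
  by (rule real_polynomial_function.intros(2))

lemma poly_fun_sum:
  "(\<And>i. i \<in> I \<Longrightarrow> real_polynomial_function (f i)) \<Longrightarrow> real_polynomial_function (\<lambda>x. \<Sum>i\<in>I. f i x)"
  by (induction I rule: infinite_finite_induct) (auto intro: real_polynomial_function.intros(2))

lemma linear_vec_expand:
  fixes h :: "real^'n \<Rightarrow> real"
  assumes "linear h"
  shows "h x = (\<Sum>l\<in>UNIV. h (axis l 1) * x $ l)"
proof -
  have "x = (\<Sum>l\<in>UNIV. x $ l *\<^sub>R axis l 1)"
    by (simp add: vec_eq_iff axis_def if_distrib cong: if_cong)
  then have "h x = h (\<Sum>l\<in>UNIV. x $ l *\<^sub>R axis l 1)" by simp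
  also have "\<dots> = (\<Sum>l\<in>UNIV. h (axis l 1) * x $ l)"
    by (simp add: linear_sum[OF assms] linear_cmul[OF assms] mult.commute)
  finally show ?thesis .
qed

text \<open>
  The induction multiplies by coordinates only, because the commutator of a Dunkl operator with a
  coordinate is explicit (\<open>dunkl_coord\<close>).
\<close>

lemma poly_induct [consumes 1, case_names zero one add scale coord]:
  fixes f :: "real^'n \<Rightarrow> real"
  assumes f: "real_polynomial_function f"
    and zero: "P (\<lambda>x. 0)"
    and one: "P (\<lambda>x. 1)"
    and add: "\<And>f g. real_polynomial_function f \<Longrightarrow> real_polynomial_function g \<Longrightarrow>
                P f \<Longrightarrow> P g \<Longrightarrow> P (\<lambda>x. f x + g x)"
    and scale: "\<And>c f. real_polynomial_function f \<Longrightarrow> P f \<Longrightarrow> P (\<lambda>x. c * f x)"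
    and coord: "\<And>l f. real_polynomial_function f \<Longrightarrow> P f \<Longrightarrow> P (\<lambda>x. x $ l * f x)"
  shows "P f"
proof -
  have "\<forall>g. real_polynomial_function g \<and> P g \<longrightarrow> P (\<lambda>x. f x * g x)"
    using f
  proof (induction f rule: real_polynomial_function.induct)
    case (linear h)
    then have h: "h x = (\<Sum>l\<in>UNIV. h (axis l 1) * x $ l)" for x
      by (intro linear_vec_expand bounded_linear.linear)
    show ?case
    proof (intro allI impI)
      fix g :: "real^'n \<Rightarrow> real" assume g: "real_polynomial_function g \<and> P g"
      have "real_polynomial_function (\<lambda>x. \<Sum>l\<in>L. h (axis l 1) * (x $ l * g x)) \<and>
            P (\<lambda>x. \<Sum>l\<in>L. h (axis l 1) * (x $ l * g x))" for L
      proof (induction L rule: infinite_finite_induct)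
        case (insert l L)
        then show ?case
          using g by (auto intro!: add scale coord real_polynomial_function.intros(3) poly_cmult
              real_polynomial_function.intros(4) poly_coord)
      qed (auto intro: zero poly_zero)
      from this[of UNIV] show "P (\<lambda>x. h x * g x)"
        by (subst h) (simp add: sum_distrib_right mult.assoc)
    qed
  next
    case (const c)
    then show ?case by (auto intro: scale)
  next
    case (add f g)
    have "P (\<lambda>x. (f x + g x) * u x)" if "real_polynomial_function u" "P u" for u
    proof -
      have "P (\<lambda>x. f x * u x + g x * u x)"
        using add that by (intro assms(4) real_polynomial_function.intros(4)) auto
      then show ?thesis by (simp add: algebra_simps)
    qed
    then show ?case by blast
  next
    case (mult f g)
    have "P (\<lambda>x. (f x * g x) * u x)" if "real_polynomial_function u" "P u" for u
    proof -
      have "P (\<lambda>x. f x * (g x * u x))"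
        using mult that by (auto intro: real_polynomial_function.intros(4))
      then show ?thesis by (simp add: algebra_simps)
    qed
    then show ?case by blast
  qed
  then have "P (\<lambda>x. f x * 1)"
    using one real_polynomial_function.intros(2) by blast
  then show ?thesis by simp
qed

section \<open>Difference quotients along reflections\<close>

lemma poly_eq_off_hyperplane:
  fixes q :: "real^'n \<Rightarrow> real"
  assumes q: "real_polynomial_function q" and l: "linear l" "l v \<noteq> 0"
    and eq: "\<And>x. l x \<noteq> 0 \<Longrightarrow> q x = 0"
  shows "q x = 0"
proof (cases "l x = 0")
  case True
  have "((\<lambda>h. q (x + h *\<^sub>R v)) \<longlongrightarrow> q (x + 0 *\<^sub>R v)) (at (0::real))"
  proof (rule isCont_tendsto_compose[of _ q])
    show "isCont q (x + 0 *\<^sub>R v)"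
      using q continuous_on_polymonial_function[of q UNIV] 
      by (auto simp: real_polynomial_function_eq continuous_on_eq_continuous_at)
  qed (intro tendsto_intros)
  moreover have "((\<lambda>h. q (x + h *\<^sub>R v)) \<longlongrightarrow> 0) (at (0::real))"
  proof (rule Lim_transform_eventually[of "\<lambda>_. 0"])
    have "q (x + h *\<^sub>R v) = 0" if "h \<noteq> 0" for h
      using that True l by (intro eq) (simp add: linear_add linear_cmul)
    then show "\<forall>\<^sub>F h in at 0. 0 = q (x + h *\<^sub>R v)"
      by (auto simp: eventually_at intro: zero_less_one)
  qed auto
  ultimately show ?thesis
    using LIM_unique by fastforce
qed (use eq in auto)

lemma poly_quot_eqI:
  fixes q :: "real^'n \<Rightarrow> real"
  assumes l: "linear l" "l v \<noteq> 0" and q: "real_polynomial_function q"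
    and eq: "\<And>x. l x * q x = f x"
  shows "poly_quot f l = q"
  unfolding poly_quot_def
proof (rule the_equality)
  fix p assume p: "real_polynomial_function p \<and> (\<forall>x. l x * p x = f x)"
  show "p = q"
  proof
    fix x
    have "p x - q x = 0"
    proof (rule poly_eq_off_hyperplane[OF _ l])
      show "real_polynomial_function (\<lambda>x. p x - q x)" using p q by auto
      fix y assume "l y \<noteq> 0"
      then show "p y - q y = 0" using p eq[of y] by (metis mult_cancel_left right_minus_eq)
    qed
    then show "p x = q x" by simp
  qed
qed (use assms in auto)

text \<open>
  The map \<open>r\<close> moves every point along the fixed direction \<open>c\<close>, by the amount \<open>l x\<close>.  This makes
  \<open>f - f \<circ> r\<close> divisible by \<open>l\<close>: it holds for coordinates, and the product rule for differences
  propagates it.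
\<close>

locale reflection_quotient =
  fixes r :: "real^'n \<Rightarrow> real^'n" and l :: "real^'n \<Rightarrow> real" and v :: "real^'n"
    and c :: "'n \<Rightarrow> real"
  assumes lin: "linear l" and nz: "l v \<noteq> 0"
    and c: "\<And>x m. x $ m - r x $ m = c m * l x"
begin

definition dq :: "(real^'n \<Rightarrow> real) \<Rightarrow> real^'n \<Rightarrow> real" where
  "dq f = poly_quot (\<lambda>y. f y - f (r y)) l"

lemmas dq_eqI = poly_quot_eqI[OF lin nz, of _ "\<lambda>y. f y - f (r y)" for f, folded dq_def]

lemma poly_refl: "real_polynomial_function f \<Longrightarrow> real_polynomial_function (\<lambda>x. f (r x))"
proof (induction f rule: poly_induct)
  case (coord m f)
  have *: "r x $ m = x $ m - c m * l x" for x using c[of x m] by simp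
  show ?case unfolding *
    by (intro real_polynomial_function.intros(4) real_polynomial_function_diff coord poly_coord
        real_polynomial_function.intros(2) real_polynomial_function.intros(1)
        linear_conv_bounded_linear[THEN iffD1] lin)
qed (auto intro: real_polynomial_function.intros(2) real_polynomial_function.intros(3) poly_cmult)

lemma dq_exists:
  assumes "real_polynomial_function f"
  shows "\<exists>q. real_polynomial_function q \<and> (\<forall>x. l x * q x = f x - f (r x))"
  using assms
proof (induction f rule: poly_induct)
  case zero
  then show ?case by (auto intro!: exI[of _ "\<lambda>x. 0"] poly_zero)
next
  case one
  then show ?case by (auto intro!: exI[of _ "\<lambda>x. 0"] poly_zero)
next
  case (add f g)
  then obtain p q where "real_polynomial_function p" "\<forall>x. l x * p x = f x - f (r x)"
    "real_polynomial_function q" "\<forall>x. l x * q x = g x - g (r x)" by blast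
  then show ?case
    by (intro exI[of _ "\<lambda>x. p x + q x"]) (auto simp: algebra_simps)
next
  case (scale a f)
  then obtain p where "real_polynomial_function p" "\<forall>x. l x * p x = f x - f (r x)" by blast
  then show ?case
    by (intro exI[of _ "\<lambda>x. a * p x"]) (simp add: poly_cmult right_diff_distrib[symmetric] mult.left_commute)
next
  case (coord m f)
  then obtain p where p: "real_polynomial_function p" "\<And>x. l x * p x = f x - f (r x)" by blast
  have "l x * (x $ m * p x + c m * f (r x)) = x $ m * f x - r x $ m * f (r x)" for x
  proof -
    have "l x * (x $ m * p x + c m * f (r x)) = x $ m * (l x * p x) + (c m * l x) * f (r x)"
      by (simp only: distrib_left mult_ac)
    then show ?thesis by (simp add: p(2) c[symmetric] algebra_simps)
  qed
  moreover have "real_polynomial_function (\<lambda>x. x $ m * p x + c m * f (r x))"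
    by (rule real_polynomial_function.intros(3)[OF real_polynomial_function.intros(4)[OF poly_coord]
          poly_cmult[OF poly_refl]]) (use p coord in auto)
  ultimately show ?case by blast
qed

lemma
  assumes "real_polynomial_function f"
  shows dq_poly: "real_polynomial_function (dq f)"
    and dq_eq: "l x * dq f x = f x - f (r x)"
  using dq_exists[OF assms] dq_eqI by auto

lemma dq_add: "real_polynomial_function f \<Longrightarrow> real_polynomial_function g \<Longrightarrow>
    dq (\<lambda>x. f x + g x) = (\<lambda>x. dq f x + dq g x)"
  by (rule dq_eqI) (auto simp: dq_poly dq_eq distrib_left)

lemma dq_scale: "real_polynomial_function f \<Longrightarrow> dq (\<lambda>x. a * f x) = (\<lambda>x. a * dq f x)"
  by (rule dq_eqI) (simp_all add: dq_poly poly_cmult right_diff_distrib[symmetric] mult.left_commute dq_eq)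

lemma dq_const: "dq (\<lambda>x. a) = (\<lambda>x. 0)"
  by (rule dq_eqI) (auto simp: poly_zero)

lemma dq_coord:
  assumes "real_polynomial_function f"
  shows "dq (\<lambda>x. x $ m * f x) = (\<lambda>x. x $ m * dq f x + c m * f (r x))"
proof (rule dq_eqI)
  show "real_polynomial_function (\<lambda>x. x $ m * dq f x + c m * f (r x))"
    by (rule real_polynomial_function.intros(3)[OF real_polynomial_function.intros(4)[OF poly_coord]
          poly_cmult[OF poly_refl]]) (use dq_poly assms in auto)
  show "l x * (x $ m * dq f x + c m * f (r x)) = x $ m * f x - r x $ m * f (r x)" for x
  proof -
    have "l x * (x $ m * dq f x + c m * f (r x)) = x $ m * (l x * dq f x) + (c m * l x) * f (r x)"
      by (simp only: distrib_left mult_ac)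
    then show ?thesis by (simp add: dq_eq[OF assms] c[symmetric] algebra_simps)
  qed
qed

end

section \<open>Elementary calculus of the Dunkl operators\<close>

lemma rq_sign:
  "reflection_quotient (refl_sign i) (\<lambda>x. x $ i) (axis i 1) (\<lambda>m. if m = i then 2 else 0)"
  by unfold_locales (auto simp: refl_sign_def axis_def)

lemma rq_swap:
  assumes "i \<noteq> j"
  shows "reflection_quotient (refl_swap i j) (\<lambda>x. x $ i - x $ j) (axis i 1)
           (\<lambda>m. if m = i then 1 else if m = j then - 1 else 0)"
  using assms by unfold_locales (auto simp: refl_swap_def axis_def algebra_simps)

lemma rq_negswap:
  assumes "i \<noteq> j"
  shows "reflection_quotient (refl_negswap i j) (\<lambda>x. x $ i + x $ j) (axis i 1)
           (\<lambda>m. if m = i then 1 else if m = j then 1 else 0)"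
  using assms by unfold_locales (auto simp: refl_negswap_def axis_def algebra_simps)

definition "dq_sign i = reflection_quotient.dq (refl_sign i) (\<lambda>x::real^'n. x $ i)"
definition "dq_swap i j = reflection_quotient.dq (refl_swap i j) (\<lambda>x::real^'n. x $ i - x $ j)"
definition "dq_negswap i j = reflection_quotient.dq (refl_negswap i j) (\<lambda>x::real^'n. x $ i + x $ j)"

lemmas dq_poly =
  reflection_quotient.dq_poly[OF rq_sign, folded dq_sign_def]
  reflection_quotient.dq_poly[OF rq_swap, folded dq_swap_def]
  reflection_quotient.dq_poly[OF rq_negswap, folded dq_negswap_def]

lemmas dq_eqI =
  reflection_quotient.dq_eqI[OF rq_sign, folded dq_sign_def]
  reflection_quotient.dq_eqI[OF rq_swap, folded dq_swap_def]
  reflection_quotient.dq_eqI[OF rq_negswap, folded dq_negswap_def]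

lemmas dq_add =
  reflection_quotient.dq_add[OF rq_sign, folded dq_sign_def]
  reflection_quotient.dq_add[OF rq_swap, folded dq_swap_def]
  reflection_quotient.dq_add[OF rq_negswap, folded dq_negswap_def]

lemmas dq_scale =
  reflection_quotient.dq_scale[OF rq_sign, folded dq_sign_def]
  reflection_quotient.dq_scale[OF rq_swap, folded dq_swap_def]
  reflection_quotient.dq_scale[OF rq_negswap, folded dq_negswap_def]

lemmas dq_const =
  reflection_quotient.dq_const[OF rq_sign, folded dq_sign_def]
  reflection_quotient.dq_const[OF rq_swap, folded dq_swap_def]
  reflection_quotient.dq_const[OF rq_negswap, folded dq_negswap_def]

lemmas dq_coord =
  reflection_quotient.dq_coord[OF rq_sign, folded dq_sign_def]
  reflection_quotient.dq_coord[OF rq_swap, folded dq_swap_def]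
  reflection_quotient.dq_coord[OF rq_negswap, folded dq_negswap_def]

lemma dunkl_altdef:
  "dunkl k k1 i f x = partial i f x + k1 * dq_sign i f x
     + k * (\<Sum>j\<in>UNIV - {i}. dq_swap i j f x + dq_negswap i j f x)"
proof -
  have "dq_sign i f = poly_quot (\<lambda>y. f y - f (refl_sign i y)) (\<lambda>y. y $ i)"
    unfolding dq_sign_def by (rule reflection_quotient.dq_def[OF rq_sign])
  moreover have "(\<Sum>j\<in>UNIV - {i}. dq_swap i j f x + dq_negswap i j f x) =
    (\<Sum>j\<in>UNIV - {i}. poly_quot (\<lambda>y. f y - f (refl_swap i j y)) (\<lambda>y. y $ i - y $ j) x
         + poly_quot (\<lambda>y. f y - f (refl_negswap i j y)) (\<lambda>y. y $ i + y $ j) x)"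
    unfolding dq_swap_def dq_negswap_def
    by (rule sum.cong)
      (simp_all add: reflection_quotient.dq_def[OF rq_swap] reflection_quotient.dq_def[OF rq_negswap])
  ultimately show ?thesis by (simp add: dunkl_def)
qed

lemma poly_line_deriv:
  fixes f :: "real^'n \<Rightarrow> real"
  assumes "real_polynomial_function f"
  shows "((\<lambda>h. f (x + h *\<^sub>R axis i 1)) has_real_derivative partial i f x) (at 0)"
proof -
  have "real_polynomial_function (f \<circ> (\<lambda>h::real. x + h *\<^sub>R axis i 1))"
    using assms
    by (intro real_polynomial_function_compose polynomial_function_add polynomial_function_const
        polynomial_function_bounded_linear bounded_linear_scaleR_left)
  then obtain p' where "\<And>h. ((f \<circ> (\<lambda>h. x + h *\<^sub>R axis i 1)) has_real_derivative p' h) (at h)"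
    using has_real_derivative_polynomial_function by blast
  then have "((\<lambda>h. f (x + h *\<^sub>R axis i 1)) has_real_derivative p' 0) (at 0)"
    by (simp add: o_def)
  then show ?thesis
    unfolding partial_def using DERIV_imp_deriv by fastforce
qed

lemma partial_eqI:
  "((\<lambda>h. f (x + h *\<^sub>R axis i 1)) has_real_derivative d) (at 0) \<Longrightarrow> partial i f x = d"
  unfolding partial_def by (rule DERIV_imp_deriv)

lemma partial_const: "partial i (\<lambda>x. a) = (\<lambda>x. 0)"
  by (rule ext, rule partial_eqI) auto

lemma partial_add:
  fixes f g :: "real^'n \<Rightarrow> real"
  shows "real_polynomial_function f \<Longrightarrow> real_polynomial_function g \<Longrightarrow>
    partial i (\<lambda>x. f x + g x) = (\<lambda>x. partial i f x + partial i g x)"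
  by (rule ext, rule partial_eqI) (intro DERIV_add poly_line_deriv)

lemma partial_scale:
  fixes f :: "real^'n \<Rightarrow> real"
  shows "real_polynomial_function f \<Longrightarrow> partial i (\<lambda>x. a * f x) = (\<lambda>x. a * partial i f x)"
  by (rule ext, rule partial_eqI) (intro DERIV_cmult poly_line_deriv)

lemma partial_coord:
  fixes f :: "real^'n \<Rightarrow> real"
  assumes "real_polynomial_function f"
  shows "partial i (\<lambda>x. x $ l * f x) = (\<lambda>x. x $ l * partial i f x + (if l = i then f x else 0))"
proof (rule ext, rule partial_eqI)
  fix x :: "real^'n"
  have "((\<lambda>h. (x + h *\<^sub>R axis i 1) $ l) has_real_derivative (if l = i then 1 else 0)) (at 0)"
    by (auto simp: axis_def intro!: derivative_eq_intros)
  note DERIV_mult[OF this poly_line_deriv[OF assms, of x i]]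
  then have "((\<lambda>h. (x + h *\<^sub>R axis i 1) $ l * f (x + h *\<^sub>R axis i 1)) has_real_derivative
      (if l = i then 1 else 0) * f x + partial i f x * x $ l) (at 0)"
    by simp
  moreover have "(if l = i then 1 else 0) * f x + partial i f x * x $ l
      = x $ l * partial i f x + (if l = i then f x else 0)" by simp
  ultimately
  show "((\<lambda>h. (x + h *\<^sub>R axis i 1) $ l * f (x + h *\<^sub>R axis i 1)) has_real_derivative
      x $ l * partial i f x + (if l = i then f x else 0)) (at 0)"
    by (simp only:)
qed

lemma partial_poly:
  fixes f :: "real^'n \<Rightarrow> real"
  shows "real_polynomial_function f \<Longrightarrow> real_polynomial_function (partial i f)"
proof (induction f rule: poly_induct)
  case (coord l f)
  have "real_polynomial_function (\<lambda>x. if l = i then f x else 0)"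
    using coord by (cases "l = i") (auto intro: poly_zero)
  with coord show ?case
    by (auto simp: partial_coord intro!: real_polynomial_function.intros(3,4) poly_coord)
qed (auto simp: partial_const partial_add partial_scale intro: poly_zero poly_cmult)

context
  fixes k k1 :: real
begin

lemma dunkl_poly:
  fixes i :: "'n::finite"
  assumes "real_polynomial_function f"
  shows "real_polynomial_function (dunkl k k1 i f)"
proof -
  have "dunkl k k1 i f = (\<lambda>x. partial i f x + k1 * dq_sign i f x
     + k * (\<Sum>j\<in>UNIV - {i}. dq_swap i j f x + dq_negswap i j f x))"
    by (rule ext) (rule dunkl_altdef)
  moreover have "real_polynomial_function \<dots>"
    by (intro real_polynomial_function.intros(3) poly_cmult poly_fun_sum partial_poly assms
        dq_poly) auto
  ultimately show ?thesis by simp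
qed

lemma dunkl_add:
  fixes i :: "'n::finite"
  assumes "real_polynomial_function f" "real_polynomial_function g"
  shows "dunkl k k1 i (\<lambda>x. f x + g x) = (\<lambda>x. dunkl k k1 i f x + dunkl k k1 i g x)"
  unfolding dunkl_altdef fun_eq_iff using assms
  by (simp add: partial_add dq_add sum.distrib distrib_left)

lemma dunkl_scale:
  fixes i :: "'n::finite"
  assumes "real_polynomial_function f"
  shows "dunkl k k1 i (\<lambda>x. a * f x) = (\<lambda>x. a * dunkl k k1 i f x)"
  unfolding dunkl_altdef fun_eq_iff using assms
  by (simp add: partial_scale dq_scale sum_distrib_left algebra_simps sum.distrib)

lemma dunkl_const: "dunkl k k1 (i::'n::finite) (\<lambda>x. a) = (\<lambda>x. 0)"
  unfolding dunkl_altdef fun_eq_iff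
  by (simp add: partial_const dq_const)

lemma dunkl_sum:
  fixes i :: "'n::finite"
  assumes "\<And>m. m \<in> M \<Longrightarrow> real_polynomial_function (f m)"
  shows "dunkl k k1 i (\<lambda>x. \<Sum>m\<in>M. f m x) = (\<lambda>x. \<Sum>m\<in>M. dunkl k k1 i (f m) x)"
  using assms
  by (induction M rule: infinite_finite_induct) (simp_all add: dunkl_const dunkl_add poly_fun_sum)

definition coord_comm :: "'n::finite \<Rightarrow> 'n \<Rightarrow> (real^'n \<Rightarrow> real) \<Rightarrow> real^'n \<Rightarrow> real" where
  "coord_comm i l f x = (if i = l
     then f x + 2 * k1 * f (refl_sign i x)
       + k * (\<Sum>m\<in>UNIV - {i}. f (refl_swap i m x) + f (refl_negswap i m x))
     else - k * (f (refl_swap i l x) - f (refl_negswap i l x)))"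

lemma dunkl_coord:
  fixes i :: "'n::finite"
  assumes f: "real_polynomial_function f"
  shows "dunkl k k1 i (\<lambda>x. x $ l * f x) = (\<lambda>x. x $ l * dunkl k k1 i f x + coord_comm i l f x)"
proof
  fix x :: "real^'n"
  define R where "R j = (if l = i then f (refl_swap i j x) + f (refl_negswap i j x)
      else if l = j then f (refl_negswap i j x) - f (refl_swap i j x) else 0)" for j
  have "(\<Sum>j\<in>UNIV - {i}. dq_swap i j (\<lambda>x. x $ l * f x) x + dq_negswap i j (\<lambda>x. x $ l * f x) x)
      = (\<Sum>j\<in>UNIV - {i}. x $ l * (dq_swap i j f x + dq_negswap i j f x) + R j)"
    by (rule sum.cong) (auto simp: R_def dq_coord f distrib_left)
  also have "\<dots> = x $ l * (\<Sum>j\<in>UNIV - {i}. dq_swap i j f x + dq_negswap i j f x)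
      + (\<Sum>j\<in>UNIV - {i}. R j)"
    unfolding sum_distrib_left by (rule sum.distrib)
  finally have A: "(\<Sum>j\<in>UNIV - {i}. dq_swap i j (\<lambda>x. x $ l * f x) x + dq_negswap i j (\<lambda>x. x $ l * f x) x)
      = x $ l * (\<Sum>j\<in>UNIV - {i}. dq_swap i j f x + dq_negswap i j f x) + (\<Sum>j\<in>UNIV - {i}. R j)" .
  have B: "k * (\<Sum>j\<in>UNIV - {i}. R j) + (if l = i then f x + 2 * k1 * f (refl_sign i x) else 0)
      = coord_comm i l f x"
  proof (cases "l = i")
    case False
    then have "(\<Sum>j\<in>UNIV - {i}. R j) = (\<Sum>j\<in>{l}. R j)"
      by (intro sum.mono_neutral_right) (auto simp: R_def)
    then show ?thesis using False by (simp add: R_def coord_comm_def algebra_simps)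
  qed (simp add: R_def coord_comm_def)
  show "dunkl k k1 i (\<lambda>x. x $ l * f x) x = x $ l * dunkl k k1 i f x + coord_comm i l f x"
    unfolding dunkl_altdef A B[symmetric]
      partial_coord[OF f] dq_coord(1)[OF f]
    by (auto simp: algebra_simps)
qed

end

section \<open>Equivariance and commutativity\<close>

definition signed_perm :: "('n \<Rightarrow> real) \<Rightarrow> ('n \<Rightarrow> 'n) \<Rightarrow> real^'n \<Rightarrow> real^'n" where
  "signed_perm e p x = (\<chi> m. e m * x $ p m)"

lemma refl_sign_eq_signed_perm:
  "refl_sign i = signed_perm (\<lambda>m. if m = i then -1 else 1) (\<lambda>m. m)"
  by (auto simp: fun_eq_iff vec_eq_iff refl_sign_def signed_perm_def)

lemma refl_swap_eq_signed_perm: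
  "refl_swap i j = signed_perm (\<lambda>m. 1) (\<lambda>m. if m = i then j else if m = j then i else m)"
  by (auto simp: fun_eq_iff vec_eq_iff refl_swap_def signed_perm_def)

lemma refl_negswap_eq_signed_perm:
  "refl_negswap i j = signed_perm (\<lambda>m. if m = i \<or> m = j then -1 else 1)
     (\<lambda>m. if m = i then j else if m = j then i else m)"
  by (auto simp: fun_eq_iff vec_eq_iff refl_negswap_def signed_perm_def)

lemma poly_signed_perm:
  "real_polynomial_function f \<Longrightarrow> real_polynomial_function (\<lambda>x. f (signed_perm e p x))"
proof (induction f rule: poly_induct)
  case (coord l f)
  then show ?case
    by (auto simp: signed_perm_def
        intro!: real_polynomial_function.intros(4) poly_cmult poly_coord)
qed (auto intro: real_polynomial_function.intros(2,3) poly_cmult)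

lemmas poly_reflect =
  poly_signed_perm[where e = "\<lambda>m. if m = i then -1 else 1" and p = "\<lambda>m. m" for i,
    folded refl_sign_eq_signed_perm]
  poly_signed_perm[where e = "\<lambda>m. 1" and p = "\<lambda>m. if m = i then j else if m = j then i else m" for i j,
    folded refl_swap_eq_signed_perm]
  poly_signed_perm[where e = "\<lambda>m. if m = i \<or> m = j then -1 else 1"
      and p = "\<lambda>m. if m = i then j else if m = j then i else m" for i j,
    folded refl_negswap_eq_signed_perm]

lemma signed_perm_conj:
  fixes p :: "'n::finite \<Rightarrow> 'n"
  assumes p: "inj p" and e: "\<And>m. e m = 1 \<or> e m = -1"
  shows "refl_sign i (signed_perm e p x) = signed_perm e p (refl_sign (p i) x)"
    and "refl_swap i l (signed_perm e p x) = signed_perm e p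
           (if e i = e l then refl_swap (p i) (p l) x else refl_negswap (p i) (p l) x)"
    and "refl_negswap i l (signed_perm e p x) = signed_perm e p
           (if e i = e l then refl_negswap (p i) (p l) x else refl_swap (p i) (p l) x)"
  using e[of i] e[of l] inj_eq[OF p]
  by (auto simp: vec_eq_iff refl_sign_def refl_swap_def refl_negswap_def signed_perm_def)

lemma coord_comm_signed_perm:
  fixes p :: "'n::finite \<Rightarrow> 'n"
  assumes p: "bij p" and e: "\<And>m. e m = 1 \<or> e m = -1"
  shows "coord_comm k k1 (p i) (p l) (\<lambda>x. f (signed_perm e p x)) x
       = e i * e l * coord_comm k k1 i l f (signed_perm e p x)"
proof (cases "i = l")
  case True
  note conj = signed_perm_conj[OF bij_is_inj[OF p] e]
  have "(\<Sum>m\<in>UNIV - {p i}. f (signed_perm e p (refl_swap (p i) m x)) + f (signed_perm e p (refl_negswap (p i) m x)))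
      = (\<Sum>m\<in>UNIV - {i}. f (signed_perm e p (refl_swap (p i) (p m) x)) + f (signed_perm e p (refl_negswap (p i) (p m) x)))"
  proof (rule sum.reindex_bij_betw[symmetric, of p])
    show "bij_betw p (UNIV - {i}) (UNIV - {p i})"
      using p by (auto simp: bij_betw_def inj_on_def bij_def)
  qed
  also have "\<dots> = (\<Sum>m\<in>UNIV - {i}. f (refl_swap i m (signed_perm e p x)) + f (refl_negswap i m (signed_perm e p x)))"
    by (rule sum.cong) (auto simp: conj)
  finally show ?thesis
    using True e[of l] by (auto simp: coord_comm_def conj)
next
  case False
  note conj = signed_perm_conj[OF bij_is_inj[OF p] e]
  show ?thesis
    using False e[of i] e[of l] bij_is_inj[OF p]
    by (auto simp: coord_comm_def conj inj_eq algebra_simps)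
qed

lemma dunkl_signed_perm:
  fixes p :: "'n::finite \<Rightarrow> 'n"
  assumes f: "real_polynomial_function f"
    and p: "bij p" and e: "\<And>m. e m = 1 \<or> e m = -1"
  shows "dunkl k k1 (p i) (\<lambda>x. f (signed_perm e p x)) = (\<lambda>x. e i * dunkl k k1 i f (signed_perm e p x))"
  using f
proof (induction f rule: poly_induct)
  case (coord l f)
  have ee: "e m * e m = 1" for m using e[of m] by auto
  have "dunkl k k1 (p i) (\<lambda>x. signed_perm e p x $ l * f (signed_perm e p x))
      = dunkl k k1 (p i) (\<lambda>x. e l * (x $ p l * f (signed_perm e p x)))"
    by (simp add: signed_perm_def mult.assoc)
  also have "\<dots> = (\<lambda>x. e l * (x $ p l * (e i * dunkl k k1 i f (signed_perm e p x))
        + e i * e l * coord_comm k k1 i l f (signed_perm e p x)))"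
    using coord
    by (simp add: dunkl_scale dunkl_coord poly_signed_perm real_polynomial_function.intros(4) poly_coord
        coord_comm_signed_perm[OF p e, of k k1 i l f])
  also have "\<dots> = (\<lambda>x. e i * (signed_perm e p x $ l * dunkl k k1 i f (signed_perm e p x)
        + (e l * e l) * coord_comm k k1 i l f (signed_perm e p x)))"
    by (simp add: signed_perm_def algebra_simps)
  finally show ?case
    using coord by (simp add: ee dunkl_coord)
qed (simp_all add: dunkl_const dunkl_add dunkl_scale poly_signed_perm distrib_left mult.left_commute)

lemma bij_swap_fun: "bij (\<lambda>m. if m = i then j else if m = j then i else m)"
  by (rule involuntory_imp_bij) auto

lemma dunkl_refl_sign:
  fixes i :: "'n::finite"
  assumes "real_polynomial_function f"
  shows "dunkl k k1 j (\<lambda>x. f (refl_sign i x))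
    = (\<lambda>x. (if j = i then -1 else 1) * dunkl k k1 j f (refl_sign i x))"
  unfolding refl_sign_eq_signed_perm
  using dunkl_signed_perm[OF assms bij_id[unfolded id_def], of "\<lambda>m. if m = i then -1 else 1" k k1 j]
  by simp

lemma dunkl_refl_swap:
  fixes i :: "'n::finite"
  assumes f: "real_polynomial_function f"
  shows "dunkl k k1 i (\<lambda>x. f (refl_swap i j x)) = (\<lambda>x. dunkl k k1 j f (refl_swap i j x))"
    and "dunkl k k1 j (\<lambda>x. f (refl_swap i j x)) = (\<lambda>x. dunkl k k1 i f (refl_swap i j x))"
    and "l \<noteq> i \<Longrightarrow> l \<noteq> j \<Longrightarrow>
      dunkl k k1 l (\<lambda>x. f (refl_swap i j x)) = (\<lambda>x. dunkl k k1 l f (refl_swap i j x))"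
  unfolding refl_swap_eq_signed_perm
  using dunkl_signed_perm[OF f bij_swap_fun[of i j], of "\<lambda>_. 1" k k1 i]
    dunkl_signed_perm[OF f bij_swap_fun[of i j], of "\<lambda>_. 1" k k1 j]
    dunkl_signed_perm[OF f bij_swap_fun[of i j], of "\<lambda>_. 1" k k1 l]
  by (cases "i = j"; simp)+

lemma dunkl_refl_negswap:
  fixes i :: "'n::finite"
  assumes f: "real_polynomial_function f"
  shows "dunkl k k1 i (\<lambda>x. f (refl_negswap i j x)) = (\<lambda>x. - dunkl k k1 j f (refl_negswap i j x))"
    and "dunkl k k1 j (\<lambda>x. f (refl_negswap i j x)) = (\<lambda>x. - dunkl k k1 i f (refl_negswap i j x))"
    and "l \<noteq> i \<Longrightarrow> l \<noteq> j \<Longrightarrow>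
      dunkl k k1 l (\<lambda>x. f (refl_negswap i j x)) = (\<lambda>x. dunkl k k1 l f (refl_negswap i j x))"
  unfolding refl_negswap_eq_signed_perm
  using dunkl_signed_perm[OF f bij_swap_fun[of i j], of "\<lambda>m. if m = i \<or> m = j then -1 else 1" k k1 i]
    dunkl_signed_perm[OF f bij_swap_fun[of i j], of "\<lambda>m. if m = i \<or> m = j then -1 else 1" k k1 j]
    dunkl_signed_perm[OF f bij_swap_fun[of i j], of "\<lambda>m. if m = i \<or> m = j then -1 else 1" k k1 l]
  by (cases "i = j"; simp)+

lemma refl_swap_sym: "refl_swap i j = refl_swap j i"
  by (auto simp: fun_eq_iff vec_eq_iff refl_swap_def)

lemma refl_negswap_sym: "refl_negswap i j = refl_negswap j i"
  by (auto simp: fun_eq_iff vec_eq_iff refl_negswap_def)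

lemma coord_comm_poly:
  fixes i :: "'n::finite"
  assumes f: "real_polynomial_function f"
  shows "real_polynomial_function (coord_comm k k1 i l f)"
proof (cases "i = l")
  case True
  have "coord_comm k k1 i l f = (\<lambda>x. (f x + 2 * k1 * f (refl_sign i x))
       + k * (\<Sum>m\<in>UNIV - {i}. f (refl_swap i m x) + f (refl_negswap i m x)))"
    using True by (simp add: coord_comm_def fun_eq_iff)
  moreover have "real_polynomial_function \<dots>"
    by (rule real_polynomial_function.intros(3)[OF real_polynomial_function.intros(3)[OF f poly_cmult]
          poly_cmult[OF poly_fun_sum[OF real_polynomial_function.intros(3)]]])
      (rule poly_reflect[OF f])+
  ultimately show ?thesis by simp
next
  case False
  have "coord_comm k k1 i l f = (\<lambda>x. - k * (f (refl_swap i l x) - f (refl_negswap i l x)))"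
    using False by (simp add: coord_comm_def fun_eq_iff)
  moreover have "real_polynomial_function \<dots>"
    by (rule poly_cmult[OF real_polynomial_function_diff]) (rule poly_reflect[OF f])+
  ultimately show ?thesis by simp
qed

lemma dunkl_diff:
  fixes i :: "'n::finite"
  assumes "real_polynomial_function f" "real_polynomial_function g"
  shows "dunkl k k1 i (\<lambda>x. f x - g x) = (\<lambda>x. dunkl k k1 i f x - dunkl k k1 i g x)"
proof -
  have "dunkl k k1 i (\<lambda>x. f x + (-1) * g x) = (\<lambda>x. dunkl k k1 i f x + (-1) * dunkl k k1 i g x)"
    by (subst dunkl_add) (simp_all only: assms poly_cmult dunkl_scale)
  then show ?thesis by simp
qed

lemma dunkl_minus:
  fixes i :: "'n::finite"
  assumes "real_polynomial_function f"
  shows "dunkl k k1 i (\<lambda>x. - f x) = (\<lambda>x. - dunkl k k1 i f x)"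
  using dunkl_scale[OF assms, of k k1 i "-1"] by simp

lemma coord_comm_off:
  "i \<noteq> l \<Longrightarrow> coord_comm k k1 i l f = (\<lambda>x. - k * (f (refl_swap i l x) - f (refl_negswap i l x)))"
  by (simp add: coord_comm_def fun_eq_iff)

lemma dunkl_coord_comm_off:
  fixes i :: "'n::finite"
  assumes f: "real_polynomial_function f" and "i \<noteq> l" "j \<noteq> l" "i \<noteq> j"
  shows "dunkl k k1 j (coord_comm k k1 i l f) = coord_comm k k1 i l (dunkl k k1 j f)"
  using assms
  by (simp add: coord_comm_off dunkl_scale dunkl_diff poly_reflect
      real_polynomial_function_diff dunkl_refl_swap(3) dunkl_refl_negswap(3) dunkl_minus poly_cmult)

text \<open>
  Equivariance turns an operator applied to a reflected function into a reflected value of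
  \<open>T\<^sub>i f\<close> or \<open>T\<^sub>j f\<close>; the reflected values then match on both sides.
\<close>

lemma double_commutator_diag:
  fixes i :: "'n::finite"
  assumes f: "real_polynomial_function f" and ij: "i \<noteq> j"
  shows "coord_comm k k1 i i (dunkl k k1 j f) x + dunkl k k1 i (coord_comm k k1 j i f) x
       = coord_comm k k1 j i (dunkl k k1 i f) x + dunkl k k1 j (coord_comm k k1 i i f) x"
proof -
  let ?T = "dunkl k k1"
  let ?U = "UNIV - {i} - {j}"
  have U: "(\<Sum>m\<in>UNIV - {i}. g m) = g j + (\<Sum>m\<in>?U. g m)" for g :: "'n \<Rightarrow> real"
    using ij by (intro sum.remove) auto
  have cc: "coord_comm k k1 i i f = (\<lambda>x. (f x + 2 * k1 * f (refl_sign i x))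
       + k * (\<Sum>m\<in>UNIV - {i}. f (refl_swap i m x) + f (refl_negswap i m x)))"
    by (simp add: coord_comm_def fun_eq_iff)
  note P = f poly_reflect[OF f] real_polynomial_function.intros(3) poly_cmult poly_fun_sum
  have P1: "real_polynomial_function (\<lambda>x. f x + 2 * k1 * f (refl_sign i x))"
    using P by blast
  have P2: "real_polynomial_function (\<lambda>x. \<Sum>m\<in>UNIV - {i}. f (refl_swap i m x) + f (refl_negswap i m x))"
    by (intro poly_fun_sum real_polynomial_function.intros(3) poly_reflect f)
  have "?T j (coord_comm k k1 i i f) x = ?T j f x + 2 * k1 * ?T j f (refl_sign i x)
       + k * (\<Sum>m\<in>UNIV - {i}. ?T j (\<lambda>x. f (refl_swap i m x)) x + ?T j (\<lambda>x. f (refl_negswap i m x)) x)"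
  proof -
    have "?T j (\<lambda>x. f x + 2 * k1 * f (refl_sign i x)) x = ?T j f x + 2 * k1 * ?T j f (refl_sign i x)"
      using ij by (simp add: dunkl_add[OF f poly_cmult[OF poly_reflect(1)[OF f]]]
          dunkl_scale[OF poly_reflect(1)[OF f]] dunkl_refl_sign[OF f])
    moreover have "?T j (\<lambda>x. \<Sum>m\<in>UNIV - {i}. f (refl_swap i m x) + f (refl_negswap i m x)) x
        = (\<Sum>m\<in>UNIV - {i}. ?T j (\<lambda>x. f (refl_swap i m x)) x + ?T j (\<lambda>x. f (refl_negswap i m x)) x)"
      by (simp add: dunkl_sum dunkl_add P)
    ultimately show ?thesis
      unfolding cc by (simp add: dunkl_add[OF P1 poly_cmult[OF P2]] dunkl_scale[OF P2])
  qed
  also have "(\<Sum>m\<in>UNIV - {i}. ?T j (\<lambda>x. f (refl_swap i m x)) x + ?T j (\<lambda>x. f (refl_negswap i m x)) x)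
     = ?T i f (refl_swap i j x) - ?T i f (refl_negswap i j x)
       + (\<Sum>m\<in>?U. ?T j f (refl_swap i m x) + ?T j f (refl_negswap i m x))"
  proof -
    have "(\<Sum>m\<in>?U. ?T j (\<lambda>x. f (refl_swap i m x)) x + ?T j (\<lambda>x. f (refl_negswap i m x)) x)
        = (\<Sum>m\<in>?U. ?T j f (refl_swap i m x) + ?T j f (refl_negswap i m x))"
      using ij by (intro sum.cong) (auto simp: dunkl_refl_swap(3)[OF f] dunkl_refl_negswap(3)[OF f])
    then show ?thesis
      by (simp add: U dunkl_refl_swap(2)[OF f] dunkl_refl_negswap(2)[OF f])
  qed
  finally have A: "?T j (coord_comm k k1 i i f) x = ?T j f x + 2 * k1 * ?T j f (refl_sign i x)
     + k * (?T i f (refl_swap i j x) - ?T i f (refl_negswap i j x)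
       + (\<Sum>m\<in>?U. ?T j f (refl_swap i m x) + ?T j f (refl_negswap i m x)))" .
  have B: "coord_comm k k1 i i (?T j f) x = ?T j f x + 2 * k1 * ?T j f (refl_sign i x)
     + k * (?T j f (refl_swap i j x) + ?T j f (refl_negswap i j x)
       + (\<Sum>m\<in>?U. ?T j f (refl_swap i m x) + ?T j f (refl_negswap i m x)))"
    by (simp add: coord_comm_def U)
  have C: "?T i (coord_comm k k1 j i f) x = - k * (?T j f (refl_swap i j x) + ?T j f (refl_negswap i j x))"
    using ij unfolding refl_swap_sym[of i j] refl_negswap_sym[of i j]
    by (simp add: coord_comm_off dunkl_scale dunkl_diff P real_polynomial_function_diff
        dunkl_refl_swap(2)[OF f] dunkl_refl_negswap(2)[OF f] dunkl_minus)
  have D: "coord_comm k k1 j i (?T i f) x = - k * (?T i f (refl_swap i j x) - ?T i f (refl_negswap i j x))"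
    using ij unfolding refl_swap_sym[of i j] refl_negswap_sym[of i j]
    by (simp add: coord_comm_off)
  show ?thesis unfolding A B C D by (simp add: algebra_simps)
qed

lemma double_commutator:
  fixes i :: "'n::finite"
  assumes f: "real_polynomial_function f"
  shows "coord_comm k k1 i l (dunkl k k1 j f) x + dunkl k k1 i (coord_comm k k1 j l f) x
       = coord_comm k k1 j l (dunkl k k1 i f) x + dunkl k k1 j (coord_comm k k1 i l f) x"
proof -
  consider "i = j" | "i \<noteq> j" "l = i" | "i \<noteq> j" "l = j" | "i \<noteq> j" "i \<noteq> l" "j \<noteq> l" by blast
  then show ?thesis
  proof cases
    case 2
    then show ?thesis using double_commutator_diag[OF f, of i j] by simp
  next
    case 3
    then show ?thesis using double_commutator_diag[OF f, of j i] by simp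
  next
    case 4
    then show ?thesis
      using dunkl_coord_comm_off[OF f, of i l j] dunkl_coord_comm_off[OF f, of j l i] by simp
  qed simp
qed

text \<open>
  By \<open>double_commutator\<close> and the Jacobi identity, \<open>[T\<^sub>i, T\<^sub>j]\<close> commutes with all multiplications; it
  kills \<open>1\<close>, hence every polynomial.
\<close>

theorem dunkl_commute:
  fixes i :: "'n::finite"
  assumes "real_polynomial_function f"
  shows "dunkl k k1 i (dunkl k k1 j f) = dunkl k k1 j (dunkl k k1 i f)"
  using assms
proof (induction f rule: poly_induct)
  case (coord l f)
  have "dunkl k k1 i (dunkl k k1 j (\<lambda>x. x $ l * f x)) = (\<lambda>x. x $ l * dunkl k k1 i (dunkl k k1 j f) x
      + (coord_comm k k1 i l (dunkl k k1 j f) x + dunkl k k1 i (coord_comm k k1 j l f) x))" for i j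
    using coord(1)
    by (simp add: dunkl_coord dunkl_add dunkl_poly coord_comm_poly real_polynomial_function.intros(4)
        poly_coord add.assoc)
  then show ?case by (simp add: coord(2) double_commutator[OF coord(1)])
qed (simp_all add: dunkl_const dunkl_add dunkl_scale dunkl_poly)

section \<open>Polynomials killed by all Dunkl operators\<close>

definition euler :: "(real^'n::finite \<Rightarrow> real) \<Rightarrow> real^'n \<Rightarrow> real" where
  "euler f x = (\<Sum>i\<in>UNIV. x $ i * partial i f x)"

definition refl_deficit :: "real \<Rightarrow> real \<Rightarrow> (real^'n::finite \<Rightarrow> real) \<Rightarrow> real^'n \<Rightarrow> real" where
  "refl_deficit k k1 f x = k1 * (\<Sum>i\<in>UNIV. f x - f (refl_sign i x))
     + k / 2 * (\<Sum>i\<in>UNIV. \<Sum>j\<in>UNIV - {i}. (f x - f (refl_swap i j x)) + (f x - f (refl_negswap i j x)))"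

text \<open>
  Exchanging \<open>i\<close> and \<open>j\<close> changes the sign of the first quotient and preserves the second, so that
  each sum is the linear form times the quotient.
\<close>

lemma dq_transposed:
  fixes i :: "'n::finite"
  assumes f: "real_polynomial_function f" and ij: "i \<noteq> j"
  shows "x $ i * dq_swap i j f x + x $ j * dq_swap j i f x = f x - f (refl_swap i j x)"
    and "x $ i * dq_negswap i j f x + x $ j * dq_negswap j i f x = f x - f (refl_negswap i j x)"
proof -
  have "dq_swap j i f = (\<lambda>x. - dq_swap i j f x)"
    using reflection_quotient.dq_eq[OF rq_swap[OF ij] f, folded dq_swap_def] ij
    by (intro dq_eqI) (auto simp: refl_swap_sym[of j i] algebra_simps dq_poly f)
  then show "x $ i * dq_swap i j f x + x $ j * dq_swap j i f x = f x - f (refl_swap i j x)"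
    using reflection_quotient.dq_eq[OF rq_swap[OF ij] f, folded dq_swap_def]
    by (simp add: algebra_simps)
  have "dq_negswap j i f = dq_negswap i j f"
    using reflection_quotient.dq_eq[OF rq_negswap[OF ij] f, folded dq_negswap_def] ij
    by (intro dq_eqI) (auto simp: refl_negswap_sym[of j i] add.commute dq_poly f)
  then show "x $ i * dq_negswap i j f x + x $ j * dq_negswap j i f x = f x - f (refl_negswap i j x)"
    using reflection_quotient.dq_eq[OF rq_negswap[OF ij] f, folded dq_negswap_def]
    by (simp add: algebra_simps)
qed

lemma euler_dunkl:
  fixes f :: "real^'n::finite \<Rightarrow> real"
  assumes f: "real_polynomial_function f"
  shows "(\<Sum>i\<in>UNIV. x $ i * dunkl k k1 i f x) = euler f x + refl_deficit k k1 f x"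
proof -
  define q where "q i j = dq_swap i j f x + dq_negswap i j f x" for i j
  define d where "d i j = (f x - f (refl_swap i j x)) + (f x - f (refl_negswap i j x))" for i j
  let ?S = "\<Sum>i\<in>UNIV. \<Sum>j\<in>UNIV - {i}. x $ i * q i j"
  have sw: "(\<Sum>i\<in>UNIV. \<Sum>j\<in>UNIV - {i}. g i j) = (\<Sum>i\<in>UNIV. \<Sum>j\<in>UNIV - {i}. g j i)"
    for g :: "'n \<Rightarrow> 'n \<Rightarrow> real"
  proof -
    have "UNIV - {i} = {j \<in> UNIV. j \<noteq> i}" for i :: 'n by auto
    then have *: "(\<Sum>i\<in>UNIV. \<Sum>j\<in>UNIV - {i}. g i j) = (\<Sum>i\<in>UNIV. \<Sum>j\<in>UNIV. if j \<noteq> i then g i j else 0)"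
      for g :: "'n \<Rightarrow> 'n \<Rightarrow> real" by (simp add: sum.inter_filter[symmetric])
    have "(\<Sum>i\<in>UNIV. \<Sum>j\<in>UNIV. if j \<noteq> i then g i j else 0) = (\<Sum>i\<in>UNIV. \<Sum>j\<in>UNIV. if j \<noteq> i then g j i else 0)"
      by (subst sum.swap) (simp add: eq_commute)
    then show ?thesis unfolding *[of g] *[of "\<lambda>i j. g j i"] .
  qed
  have "2 * ?S = ?S + (\<Sum>i\<in>UNIV. \<Sum>j\<in>UNIV - {i}. x $ j * q j i)"
    using sw[of "\<lambda>i j. x $ i * q i j"] by simp
  also have "\<dots> = (\<Sum>i\<in>UNIV. \<Sum>j\<in>UNIV - {i}. d i j)"
    unfolding sum.distrib[symmetric]
  proof (intro sum.cong refl)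
    fix i j :: 'n assume "j \<in> UNIV - {i}"
    then have "i \<noteq> j" by auto
    from dq_transposed[OF f this, of x] show "x $ i * q i j + x $ j * q j i = d i j"
      by (simp add: q_def d_def algebra_simps)
  qed
  finally have S: "?S = (\<Sum>i\<in>UNIV. \<Sum>j\<in>UNIV - {i}. d i j) / 2" by simp
  have s: "x $ i * dq_sign i f x = f x - f (refl_sign i x)" for i
    using reflection_quotient.dq_eq[OF rq_sign f, folded dq_sign_def] .
  have "x $ i * dunkl k k1 i f x
      = x $ i * partial i f x + k1 * (f x - f (refl_sign i x)) + k * (\<Sum>j\<in>UNIV - {i}. x $ i * q i j)" for i
    unfolding dunkl_altdef s[symmetric] sum_distrib_left[symmetric]
    by (simp add: q_def algebra_simps)
  then have "(\<Sum>i\<in>UNIV. x $ i * dunkl k k1 i f x)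
     = euler f x + k1 * (\<Sum>i\<in>UNIV. f x - f (refl_sign i x)) + k * ?S"
    by (simp add: sum.distrib euler_def sum_distrib_left)
  then show ?thesis unfolding S by (simp add: refl_deficit_def d_def)
qed

lemma norm_signed_perm:
  fixes p :: "'n::finite \<Rightarrow> 'n"
  assumes p: "bij p" and e: "\<And>m. e m = 1 \<or> e m = -1"
  shows "norm (signed_perm e p x) = norm x"
proof -
  have "(e m * y)\<^sup>2 = y\<^sup>2" for m and y :: real using e[of m] by auto
  then have "(\<Sum>m\<in>UNIV. (signed_perm e p x $ m)\<^sup>2) = (\<Sum>m\<in>UNIV. (x $ p m)\<^sup>2)"
    by (simp add: signed_perm_def)
  also have "\<dots> = (\<Sum>m\<in>UNIV. (x $ m)\<^sup>2)"
    using p by (rule sum.reindex_bij_betw)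
  finally show ?thesis by (simp add: norm_vec_def L2_set_def)
qed

lemma norm_refl:
  "norm (refl_sign i x) = norm x" "norm (refl_swap i j x) = norm x" "norm (refl_negswap i j x) = norm x"
  for x :: "real^'n::finite"
  unfolding refl_sign_eq_signed_perm refl_swap_eq_signed_perm refl_negswap_eq_signed_perm
  by (rule norm_signed_perm, simp_all add: bij_swap_fun bij_id[unfolded id_def])+

text \<open>
  A maximum principle: on a ball, which the reflections preserve, the deficit is non-negative at
  a maximum of \<open>f\<close>.
\<close>

lemma eigen_deficit_le_0:
  fixes f :: "real^'n::finite \<Rightarrow> real"
  assumes f: "real_polynomial_function f" and k: "k > 0" "k1 > 0" and c: "c > 0"
    and eq: "\<And>x. c * f x + refl_deficit k k1 f x = 0"
  shows "f x \<le> 0"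
proof -
  have "continuous_on (cball 0 (norm x)) f"
    using f continuous_on_polymonial_function by (auto simp: real_polynomial_function_eq)
  moreover have "cball 0 (norm x) \<noteq> {}" by (simp add: not_less)
  ultimately obtain y where y: "y \<in> cball 0 (norm x)" "\<And>z. z \<in> cball 0 (norm x) \<Longrightarrow> f z \<le> f y"
    using continuous_attains_sup[OF compact_cball] by metis
  have le: "f z \<le> f y" if "norm z = norm y" for z
    using y that by auto
  have "refl_deficit k k1 f y \<ge> 0"
    unfolding refl_deficit_def using k
    by (intro add_nonneg_nonneg mult_nonneg_nonneg sum_nonneg) (auto simp: le norm_refl)
  with eq[of y] have "c * f y \<le> 0" by linarith
  with c have "f y \<le> 0" by (simp add: mult_le_0_iff)
  with y(2)[of x] show ?thesis by simp
qed

lemma eigen_deficit_eq_0: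
  fixes f :: "real^'n::finite \<Rightarrow> real"
  assumes f: "real_polynomial_function f" and k: "k > 0" "k1 > 0" and c: "c > 0"
    and eq: "\<And>x. c * f x + refl_deficit k k1 f x = 0"
  shows "f x = 0"
proof -
  have "refl_deficit k k1 (\<lambda>x. - f x) x = - refl_deficit k k1 f x" for x
    by (simp add: refl_deficit_def sum_subtractf sum.distrib sum_negf algebra_simps)
  then have "c * (- f x) + refl_deficit k k1 (\<lambda>x. - f x) x = 0" for x
    using eq[of x] by simp
  from eigen_deficit_le_0[OF real_polynomial_function_minus[OF f] k c this, of x]
    eigen_deficit_le_0[OF f k c eq, of x]
  show ?thesis by simp
qed

lemma homogeneous_decomposition:
  fixes f :: "real^'n::finite \<Rightarrow> real"
  assumes "real_polynomial_function f"
  shows "\<exists>F d. (\<forall>m. real_polynomial_function (F m)) \<and> (\<forall>m r x. F m (r *\<^sub>R x) = r ^ m * F m x)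
     \<and> (\<forall>m x. euler (F m) x = real m * F m x) \<and> (\<forall>m>d. F m = (\<lambda>x. 0)) \<and> f = (\<lambda>x. \<Sum>m\<le>d. F m x)"
  using assms
proof (induction f rule: poly_induct)
  case zero
  show ?case
    by (rule exI[of _ "\<lambda>m x. 0"]) (auto simp: poly_zero euler_def partial_const)
next
  case one
  show ?case
    by (rule exI[of _ "\<lambda>m. if m = 0 then (\<lambda>x. 1) else (\<lambda>x. 0)"], rule exI[of _ 0])
      (auto simp: poly_zero euler_def partial_const intro: real_polynomial_function.intros(2))
next
  case (add f g)
  from add(3) obtain F d where F: "\<And>m. real_polynomial_function (F m)"
    "\<And>m r x. F m (r *\<^sub>R x) = r ^ m * F m x" "\<And>m x. euler (F m) x = real m * F m x"
    "\<And>m. m > d \<Longrightarrow> F m = (\<lambda>x. 0)" "f = (\<lambda>x. \<Sum>m\<le>d. F m x)" by blast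
  from add(4) obtain G e where G: "\<And>m. real_polynomial_function (G m)"
    "\<And>m r x. G m (r *\<^sub>R x) = r ^ m * G m x" "\<And>m x. euler (G m) x = real m * G m x"
    "\<And>m. m > e \<Longrightarrow> G m = (\<lambda>x. 0)" "g = (\<lambda>x. \<Sum>m\<le>e. G m x)" by blast
  have "f x = (\<Sum>m\<le>max d e. F m x)" for x
    unfolding F(5) by (rule sum.mono_neutral_left) (auto simp: F(4) not_le)
  moreover have "g x = (\<Sum>m\<le>max d e. G m x)" for x
    unfolding G(5) by (rule sum.mono_neutral_left) (auto simp: G(4) not_le)
  ultimately have "(\<lambda>x. f x + g x) = (\<lambda>x. \<Sum>m\<le>max d e. F m x + G m x)"
    by (simp add: sum.distrib)
  moreover have "euler (\<lambda>x. F m x + G m x) x = real m * (F m x + G m x)" for m x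
    using F(3)[of m x] G(3)[of m x]
    by (simp add: euler_def partial_add F(1) G(1) distrib_left sum.distrib)
  ultimately show ?case
    by (intro exI[of _ "\<lambda>m x. F m x + G m x"] exI[of _ "max d e"])
      (auto simp: F(1,2,4) G(1,2,4) distrib_left)
next
  case (scale c f)
  then obtain F d where F: "\<And>m. real_polynomial_function (F m)"
    "\<And>m r x. F m (r *\<^sub>R x) = r ^ m * F m x" "\<And>m x. euler (F m) x = real m * F m x"
    "\<And>m. m > d \<Longrightarrow> F m = (\<lambda>x. 0)" "f = (\<lambda>x. \<Sum>m\<le>d. F m x)" by blast
  have "euler (\<lambda>x. c * F m x) x = real m * (c * F m x)" for m x
    using F(3)[of m x]
    by (simp add: euler_def partial_scale F(1) mult.left_commute sum_distrib_left[symmetric])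
  then show ?case
    by (intro exI[of _ "\<lambda>m x. c * F m x"] exI[of _ d])
      (auto simp: F(1,2,4) poly_cmult sum_distrib_left F(5))
next
  case (coord l f)
  then obtain F d where F: "\<And>m. real_polynomial_function (F m)"
    "\<And>m r x. F m (r *\<^sub>R x) = r ^ m * F m x" "\<And>m x. euler (F m) x = real m * F m x"
    "\<And>m. m > d \<Longrightarrow> F m = (\<lambda>x. 0)" "f = (\<lambda>x. \<Sum>m\<le>d. F m x)" by blast
  define H where "H m = (case m of 0 \<Rightarrow> (\<lambda>x. 0) | Suc m \<Rightarrow> (\<lambda>x. x $ l * F m x))" for m
  have "euler (H m) x = real m * H m x" for m x
  proof (cases m)
    case (Suc m')
    have "euler (H m) x = (\<Sum>i\<in>UNIV. x $ l * (x $ i * partial i (F m') x) + (if l = i then x $ i * F m' x else 0))"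
      unfolding euler_def Suc H_def by (simp add: partial_coord F(1) distrib_left mult.left_commute if_distrib cong: if_cong)
    also have "\<dots> = x $ l * euler (F m') x + x $ l * F m' x"
      by (simp add: sum.distrib euler_def sum_distrib_left)
    finally show ?thesis by (simp add: F(3) Suc H_def algebra_simps)
  qed (simp add: H_def euler_def partial_const)
  moreover have "real_polynomial_function (H m)" for m
    by (cases m) (auto simp: H_def poly_zero intro!: real_polynomial_function.intros(4) poly_coord F(1))
  moreover have "H m (r *\<^sub>R x) = r ^ m * H m x" for m r x
    by (cases m) (auto simp: H_def F(2))
  moreover have "H m = (\<lambda>x. 0)" if "m > Suc d" for m
    using that by (cases m) (auto simp: H_def F(4))
  moreover have "(\<lambda>x. x $ l * f x) = (\<lambda>x. \<Sum>m\<le>Suc d. H m x)"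
    by (simp add: F(5) sum.atMost_Suc_shift H_def sum_distrib_left del: sum.atMost_Suc)
  ultimately show ?case by blast
qed

lemma refl_scaleR:
  "refl_sign i (r *\<^sub>R x) = r *\<^sub>R refl_sign i x" "refl_swap i j (r *\<^sub>R x) = r *\<^sub>R refl_swap i j x"
  "refl_negswap i j (r *\<^sub>R x) = r *\<^sub>R refl_negswap i j x" for x :: "real^'n::finite"
  by (auto simp: vec_eq_iff refl_sign_def refl_swap_def refl_negswap_def)

text \<open>
  Since \<open>\<Sum>x\<^sub>i T\<^sub>i\<close> is the Euler operator plus the deficit, each homogeneous component of positive
  degree satisfies the hypothesis of the maximum principle.
\<close>

theorem dunkl_kernel_constant:
  fixes f :: "real^'n::finite \<Rightarrow> real"
  assumes f: "real_polynomial_function f" and k: "k > 0" "k1 > 0"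
    and T: "\<And>i. dunkl k k1 i f = (\<lambda>x. 0)"
  shows "f = (\<lambda>x. f 0)"
proof -
  obtain F d where F: "\<And>m. real_polynomial_function (F m)"
    "\<And>m r x. F m (r *\<^sub>R x) = r ^ m * F m x" "\<And>m x. euler (F m) x = real m * F m x"
    "\<And>m. m > d \<Longrightarrow> F m = (\<lambda>x. 0)" "f = (\<lambda>x. \<Sum>m\<le>d. F m x)"
    using homogeneous_decomposition[OF f] by blast
  let ?L = "refl_deficit k k1"
  have LF: "?L (F m) (r *\<^sub>R x) = r ^ m * ?L (F m) x" for m r x
    by (simp only: refl_deficit_def refl_scaleR F(2) right_diff_distrib[symmetric]
        sum_distrib_left[symmetric] distrib_left[symmetric] mult.left_commute)
      (simp only: distrib_left mult.left_commute)
  have L: "?L f x = (\<Sum>m\<le>d. ?L (F m) x)" for x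
    unfolding F(5) refl_deficit_def sum_subtractf[symmetric] sum.distrib[symmetric] sum_distrib_left
    by (simp add: sum.swap[of _ "{..d}"] sum_distrib_left sum_subtractf sum.distrib)
  have E: "euler f x = (\<Sum>m\<le>d. real m * F m x)" for x
  proof -
    have "partial i (\<lambda>x. \<Sum>m\<in>M. F m x) = (\<lambda>x. \<Sum>m\<in>M. partial i (F m) x)" for i M
      by (induction M rule: infinite_finite_induct) (auto simp: partial_const partial_add poly_fun_sum F(1))
    then show ?thesis
      unfolding F(5) by (simp add: euler_def sum_distrib_left sum.swap[of _ "{..d}"] flip: F(3))
  qed
  have zero: "real m * F m x + ?L (F m) x = 0" if "m \<le> d" for m x
  proof -
    have "(\<Sum>m\<le>d. (real m * F m x + ?L (F m) x) * r ^ m) = 0" for r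
      using euler_dunkl[OF f, of "r *\<^sub>R x" k k1]
      by (simp add: T E L LF F(2) algebra_simps sum.distrib)
    then show ?thesis
      using polyfun_eq_0[of "\<lambda>m. real m * F m x + ?L (F m) x" d] that by blast
  qed
  have "F m = (\<lambda>x. 0)" if "m > 0" for m
  proof (cases "m \<le> d")
    case True
    then show ?thesis
      using eigen_deficit_eq_0[OF F(1) k, of "real m" m] zero that by (intro ext) auto
  qed (use F(4) in auto)
  then have "f x = F 0 x" for x
    unfolding F(5) by (subst sum.remove[of _ 0]) auto
  moreover have "F 0 x = F 0 (0 *\<^sub>R x)" for x by (simp only: F(2)) simp
  ultimately show ?thesis by (metis scaleR_zero_left)
qed

section \<open>A degree filtration and the upper bound on dimensions\<close>

text \<open>
  For positive parameters these are the polynomials of degree less than \<open>n\<close>.  The description through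
  vanishing products of operators needs no notion of degree.
\<close>

primrec dunkl_filt :: "real \<Rightarrow> real \<Rightarrow> nat \<Rightarrow> (real^'n::finite \<Rightarrow> real) set" where
  "dunkl_filt k k1 0 = {\<lambda>x. 0}"
| "dunkl_filt k k1 (Suc n) = {f. real_polynomial_function f \<and> (\<forall>i. dunkl k k1 i f \<in> dunkl_filt k k1 n)}"

lemma dunkl_filt_poly: "f \<in> dunkl_filt k k1 n \<Longrightarrow> real_polynomial_function f"
  by (cases n) (auto simp: poly_zero)

lemma dunkl_filt_zero: "(\<lambda>x. 0) \<in> dunkl_filt k k1 n"
  by (induction n) (auto simp: poly_zero dunkl_const)

lemma dunkl_filt_add:
  "f \<in> dunkl_filt k k1 n \<Longrightarrow> g \<in> dunkl_filt k k1 n \<Longrightarrow> (\<lambda>x. f x + g x) \<in> dunkl_filt k k1 n"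
  by (induction n arbitrary: f g) (auto simp: dunkl_add intro: real_polynomial_function.intros(3))

lemma dunkl_filt_scale:
  "f \<in> dunkl_filt k k1 n \<Longrightarrow> (\<lambda>x. c * f x) \<in> dunkl_filt k k1 n"
  by (induction n arbitrary: f) (auto simp: dunkl_scale poly_cmult)

lemma dunkl_filt_sum:
  "(\<And>m. m \<in> M \<Longrightarrow> f m \<in> dunkl_filt k k1 n) \<Longrightarrow> (\<lambda>x. \<Sum>m\<in>M. f m x) \<in> dunkl_filt k k1 n"
  by (induction M rule: infinite_finite_induct) (auto simp: dunkl_filt_zero dunkl_filt_add)

lemma dunkl_filt_Suc: "f \<in> dunkl_filt k k1 n \<Longrightarrow> f \<in> dunkl_filt k k1 (Suc n)"
proof (induction n arbitrary: f)
  case (Suc n)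
  have "dunkl k k1 i f \<in> dunkl_filt k k1 (Suc n)" for i
    by (rule Suc.IH) (use Suc.prems in simp)
  then show ?case
    unfolding dunkl_filt.simps(2)[of k k1 "Suc n"] using dunkl_filt_poly[OF Suc.prems] by blast
qed (auto simp: poly_zero dunkl_const)

lemma dunkl_filt_mono: "m \<le> n \<Longrightarrow> f \<in> dunkl_filt k k1 m \<Longrightarrow> f \<in> dunkl_filt k k1 n"
  by (induction rule: dec_induct) (auto intro: dunkl_filt_Suc simp del: dunkl_filt.simps(2))

lemma dunkl_filt_signed_perm:
  fixes p :: "'n::finite \<Rightarrow> 'n"
  assumes p: "bij p" and e: "\<And>m. e m = 1 \<or> e m = -1"
  shows "f \<in> dunkl_filt k k1 n \<Longrightarrow> (\<lambda>x. f (signed_perm e p x)) \<in> dunkl_filt k k1 n"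
proof (induction n arbitrary: f)
  case (Suc n)
  have f: "real_polynomial_function f" using Suc(2) by simp
  have "dunkl k k1 i (\<lambda>x. f (signed_perm e p x)) \<in> dunkl_filt k k1 n" for i
  proof -
    obtain j where j: "i = p j" using p by (metis bij_pointE)
    show ?thesis
      unfolding j dunkl_signed_perm[OF f p e]
      using Suc by (intro dunkl_filt_scale) auto
  qed
  then show ?case using f by (simp add: poly_signed_perm)
qed simp

lemma dunkl_filt_refl:
  fixes i :: "'n::finite"
  assumes "f \<in> dunkl_filt k k1 n"
  shows "(\<lambda>x. f (refl_sign i x)) \<in> dunkl_filt k k1 n" "(\<lambda>x. f (refl_swap i j x)) \<in> dunkl_filt k k1 n"
    "(\<lambda>x. f (refl_negswap i j x)) \<in> dunkl_filt k k1 n"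
  unfolding refl_sign_eq_signed_perm refl_swap_eq_signed_perm refl_negswap_eq_signed_perm
  using assms by - (rule dunkl_filt_signed_perm, simp_all add: bij_swap_fun bij_id[unfolded id_def])+

lemma dunkl_filt_coord_comm:
  assumes f: "f \<in> dunkl_filt k k1 n"
  shows "coord_comm k k1 i l f \<in> dunkl_filt k k1 n"
proof (cases "i = l")
  case True
  have "coord_comm k k1 i l f = (\<lambda>x. (f x + 2 * k1 * f (refl_sign i x))
       + k * (\<Sum>m\<in>UNIV - {i}. f (refl_swap i m x) + f (refl_negswap i m x)))"
    using True by (simp add: coord_comm_def fun_eq_iff)
  also have "\<dots> \<in> dunkl_filt k k1 n"
    by (rule dunkl_filt_add[OF dunkl_filt_add[OF f dunkl_filt_scale]
          dunkl_filt_scale[OF dunkl_filt_sum[OF dunkl_filt_add]]])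
      (rule dunkl_filt_refl[OF f])+
  finally show ?thesis .
next
  case False
  have "coord_comm k k1 i l f = (\<lambda>x. - k * f (refl_swap i l x) + k * f (refl_negswap i l x))"
    using False by (simp add: coord_comm_def fun_eq_iff algebra_simps)
  also have "\<dots> \<in> dunkl_filt k k1 n"
    by (rule dunkl_filt_add[OF dunkl_filt_scale dunkl_filt_scale]) (rule dunkl_filt_refl[OF f])+
  finally show ?thesis .
qed

lemma dunkl_filt_coord:
  "f \<in> dunkl_filt k k1 n \<Longrightarrow> (\<lambda>x. x $ l * f x) \<in> dunkl_filt k k1 (Suc n)"
proof (induction n arbitrary: f)
  case 0
  then show ?case by (simp add: poly_zero dunkl_const)
next
  case (Suc n)
  then have f: "real_polynomial_function f" by simp
  have "dunkl k k1 i (\<lambda>x. x $ l * f x) \<in> dunkl_filt k k1 (Suc n)" for i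
    unfolding dunkl_coord[OF f]
    using Suc by (intro dunkl_filt_add dunkl_filt_coord_comm) auto
  then show ?case
    unfolding dunkl_filt.simps(2)[of k k1 "Suc n"] using f
    by (auto intro: real_polynomial_function.intros(4) poly_coord)
qed

lemma dunkl_filt_exhausts: "real_polynomial_function f \<Longrightarrow> \<exists>n. f \<in> dunkl_filt k k1 n"
proof (induction f rule: poly_induct)
  case (add f g)
  then obtain m n where mn: "f \<in> dunkl_filt k k1 m" "g \<in> dunkl_filt k k1 n" by blast
  have "f \<in> dunkl_filt k k1 (max m n)" "g \<in> dunkl_filt k k1 (max m n)"
    by (rule dunkl_filt_mono[OF _ mn(1)], simp, rule dunkl_filt_mono[OF _ mn(2)], simp)
  then show ?case by (blast intro: dunkl_filt_add)
next
  case one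
  have "(\<lambda>x. 1) \<in> dunkl_filt k k1 1"
    by (simp add: dunkl_const real_polynomial_function.intros(2))
  then show ?case by blast
qed (blast intro: dunkl_filt_zero dunkl_filt_scale dunkl_filt_coord)+

lemma dunkl_filt_1_const:
  fixes f :: "real^'n::finite \<Rightarrow> real"
  assumes "k > 0" "k1 > 0" "f \<in> dunkl_filt k k1 (Suc 0)"
  shows "f = (\<lambda>x. f 0)"
  using assms by (intro dunkl_kernel_constant[of f k k1]) auto

lemma funpow_dunkl_poly: "real_polynomial_function f \<Longrightarrow> real_polynomial_function ((dunkl k k1 i ^^ n) f)"
  by (induction n) (auto simp: dunkl_poly)

lemma funpow_dunkl_add:
  "real_polynomial_function f \<Longrightarrow> real_polynomial_function g \<Longrightarrow>
   (dunkl k k1 i ^^ n) (\<lambda>x. f x + g x) = (\<lambda>x. (dunkl k k1 i ^^ n) f x + (dunkl k k1 i ^^ n) g x)"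
  by (induction n) (auto simp: dunkl_add funpow_dunkl_poly)

lemma funpow_dunkl_scale:
  "real_polynomial_function f \<Longrightarrow>
   (dunkl k k1 i ^^ n) (\<lambda>x. c * f x) = (\<lambda>x. c * (dunkl k k1 i ^^ n) f x)"
  by (induction n) (auto simp: dunkl_scale funpow_dunkl_poly)

lemma funpow_dunkl_zero: "(dunkl k k1 i ^^ n) (\<lambda>x. 0) = (\<lambda>x. 0)"
  by (induction n) (auto simp: dunkl_const)

lemma funpow_dunkl_sum:
  "(\<And>m. m \<in> M \<Longrightarrow> real_polynomial_function (f m)) \<Longrightarrow>
   (dunkl k k1 i ^^ n) (\<lambda>x. \<Sum>m\<in>M. f m x) = (\<lambda>x. \<Sum>m\<in>M. (dunkl k k1 i ^^ n) (f m) x)"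
  by (induction M rule: infinite_finite_induct) (auto simp: funpow_dunkl_zero funpow_dunkl_add poly_fun_sum)

lemma funpow_dunkl_filt: "f \<in> dunkl_filt k k1 (m + n) \<Longrightarrow> (dunkl k k1 i ^^ n) f \<in> dunkl_filt k k1 m"
proof (induction n arbitrary: m)
  case (Suc n)
  have "(dunkl k k1 i ^^ n) f \<in> dunkl_filt k k1 (Suc m)"
    by (rule Suc.IH) (use Suc.prems in \<open>simp only: add_Suc_right add_Suc\<close>)
  then show ?case by simp
qed simp

lemma funpow_dunkl_commute:
  "real_polynomial_function f \<Longrightarrow>
    (dunkl k k1 i ^^ n) (dunkl k k1 j f) = dunkl k k1 j ((dunkl k k1 i ^^ n) f)"
  by (induction n) (auto simp: dunkl_commute[of _ k k1 i j] funpow_dunkl_poly)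

locale planar =
  fixes k k1 :: real and i1 i2 :: "'n::finite"
  assumes i12: "i1 \<noteq> i2" and k_pos: "k > 0" and k1_pos: "k1 > 0"
begin

abbreviation "T \<equiv> dunkl k k1"
abbreviation "PH \<equiv> planar_harmonics k k1 i1 i2"

lemma PH_alt:
  "f \<in> PH \<longleftrightarrow> real_polynomial_function f \<and> T i2 (T i2 f) = (\<lambda>x. - T i1 (T i1 f) x)
     \<and> (\<forall>i. i \<notin> {i1, i2} \<longrightarrow> T i f = (\<lambda>x. 0))"
proof -
  have "laplace_B k k1 f = (\<lambda>x. T i1 (T i1 f) x + T i2 (T i2 f) x)"
    if "\<forall>i. i \<notin> {i1, i2} \<longrightarrow> T i f = (\<lambda>x. 0)"
  proof
    fix x
    have "laplace_B k k1 f x = (\<Sum>i\<in>{i1, i2}. T i (T i f) x)"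
      unfolding laplace_B_def using that
      by (intro sum.mono_neutral_right) (auto simp: dunkl_const)
    then show "laplace_B k k1 f x = T i1 (T i1 f) x + T i2 (T i2 f) x"
      using i12 by simp
  qed
  then show ?thesis
    unfolding planar_harmonics_def
    by (auto simp: fun_eq_iff add_eq_0_iff add_eq_0_iff2 simp del: insert_iff) 
qed

lemma PH_poly: "f \<in> PH \<Longrightarrow> real_polynomial_function f"
  by (simp add: planar_harmonics_def)

lemma PH_dunkl: assumes "f \<in> PH" shows "T i f \<in> PH"
proof -
  have f: "real_polynomial_function f" using assms by (rule PH_poly)
  have "T i2 (T i2 (T i f)) = T i (T i2 (T i2 f))"
    using dunkl_commute dunkl_poly f by metis
  also have "\<dots> = (\<lambda>x. - T i (T i1 (T i1 f)) x)"
    using assms by (simp add: PH_alt dunkl_minus dunkl_poly)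
  also have "T i (T i1 (T i1 f)) = T i1 (T i1 (T i f))"
    using dunkl_commute dunkl_poly f by metis
  moreover have "T j (T i f) = (\<lambda>x. 0)" if "j \<notin> {i1, i2}" for j
    using assms that dunkl_commute[OF f, of k k1 j i] by (simp add: PH_alt dunkl_const)
  ultimately show ?thesis
    using f by (simp add: PH_alt dunkl_poly)
qed

lemma PH_add: "f \<in> PH \<Longrightarrow> g \<in> PH \<Longrightarrow> (\<lambda>x. f x + g x) \<in> PH"
  unfolding PH_alt by (auto simp: dunkl_add dunkl_poly intro: real_polynomial_function.intros(3))

lemma PH_scale: "f \<in> PH \<Longrightarrow> (\<lambda>x. c * f x) \<in> PH"
  unfolding PH_alt by (auto simp: dunkl_scale dunkl_poly poly_cmult)

lemma PH_zero: "(\<lambda>x. 0) \<in> PH"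
  unfolding PH_alt by (auto simp: dunkl_const poly_zero)

lemma PH_diff: "f \<in> PH \<Longrightarrow> g \<in> PH \<Longrightarrow> (\<lambda>x. f x - c * g x) \<in> PH"
  using PH_add[OF _ PH_scale[of g "-c"], of f] by simp

lemma PH_subspace: "fun_space.subspace PH"
  by (auto simp: fun_space.subspace_def fun_scale_def plus_fun_def zero_fun_def PH_add PH_scale PH_zero)

text \<open>
  On planar harmonics any product of \<open>n\<close> operators equals, up to sign, \<open>T\<^sub>1\<^sup>n\<close>, \<open>T\<^sub>1\<^sup>n\<^sup>-\<^sup>1 T\<^sub>2\<close> or zero.
  Two scalar conditions therefore push a planar harmonic one step down the filtration.
\<close>

lemma PH_descend:
  "f \<in> PH \<Longrightarrow> f \<in> dunkl_filt k k1 (Suc (Suc m)) \<Longrightarrow> (T i1 ^^ Suc m) f = (\<lambda>x. 0) \<Longrightarrow>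
   (T i1 ^^ m) (T i2 f) = (\<lambda>x. 0) \<Longrightarrow> f \<in> dunkl_filt k k1 (Suc m)"
proof (induction m arbitrary: f)
  case 0
  then have "T i f = (\<lambda>x. 0)" for i
    by (cases "i \<in> {i1, i2}") (auto simp: PH_alt)
  with 0 show ?case by (simp add: PH_poly)
next
  case (Suc m)
  have f: "real_polynomial_function f" using Suc(2) by (rule PH_poly)
  have F: "T i f \<in> dunkl_filt k k1 (Suc (Suc m))" for i
    using Suc(3) unfolding dunkl_filt.simps(2)[of k k1 "Suc (Suc m)"] by blast
  have "T i1 f \<in> dunkl_filt k k1 (Suc m)"
  proof (rule Suc.IH[OF PH_dunkl[OF Suc(2)] F])
    show "(T i1 ^^ Suc m) (T i1 f) = (\<lambda>x. 0)"
      using Suc(4) by (simp only: funpow_Suc_right o_apply)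
    show "(T i1 ^^ m) (T i2 (T i1 f)) = (\<lambda>x. 0)"
      using Suc(5) unfolding dunkl_commute[OF f, of k k1 i2 i1] by (simp only: funpow_Suc_right o_apply)
  qed
  moreover have "T i2 f \<in> dunkl_filt k k1 (Suc m)"
  proof (rule Suc.IH[OF PH_dunkl[OF Suc(2)] F])
    show "(T i1 ^^ Suc m) (T i2 f) = (\<lambda>x. 0)" by (rule Suc(5))
    have "T i2 (T i2 f) = (\<lambda>x. (-1) * T i1 (T i1 f) x)"
      using Suc(2) by (simp add: PH_alt)
    then have "(T i1 ^^ m) (T i2 (T i2 f)) = (\<lambda>x. (-1) * (T i1 ^^ m) (T i1 (T i1 f)) x)"
      by (simp only: funpow_dunkl_scale[OF dunkl_poly[OF dunkl_poly[OF f]]])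
    moreover have "(T i1 ^^ m) (T i1 (T i1 f)) = (\<lambda>x. 0)"
      using Suc(4) by (simp only: funpow_Suc_right o_apply)
    ultimately show "(T i1 ^^ m) (T i2 (T i2 f)) = (\<lambda>x. 0)" by simp
  qed
  moreover have "T i f \<in> dunkl_filt k k1 (Suc m)" if "i \<notin> {i1, i2}" for i
    using Suc(2) that dunkl_filt_zero[of k k1 "Suc m"] by (simp add: PH_alt)
  ultimately have "T i f \<in> dunkl_filt k k1 (Suc m)" for i by (cases "i \<in> {i1, i2}") auto
  then show ?case unfolding dunkl_filt.simps(2)[of k k1 "Suc m"] using f by blast
qed

text \<open>
  Polynomials lie in some step of the filtration; from there \<open>PH_descend\<close> is iterated.
\<close>

lemma PH_filt:
  assumes f: "f \<in> PH" and 1: "(T i1 ^^ Suc n) f = (\<lambda>x. 0)" and 2: "(T i1 ^^ n) (T i2 f) = (\<lambda>x. 0)"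
  shows "f \<in> dunkl_filt k k1 (Suc n)"
proof -
  obtain N where N: "f \<in> dunkl_filt k k1 N"
    using dunkl_filt_exhausts[OF PH_poly[OF f]] by blast
  have "f \<in> dunkl_filt k k1 (Suc n)" if "f \<in> dunkl_filt k k1 (Suc n + d)" for d
    using that
  proof (induction d)
    case (Suc d)
    have "f \<in> dunkl_filt k k1 (Suc (n + d))"
    proof (rule PH_descend[OF f])
      show "f \<in> dunkl_filt k k1 (Suc (Suc (n + d)))" using Suc(2) by (simp del: dunkl_filt.simps)
      show "(T i1 ^^ Suc (n + d)) f = (\<lambda>x. 0)"
        using 1 funpow_dunkl_zero by (metis add.commute add_Suc_right funpow_add o_apply)
      show "(T i1 ^^ (n + d)) (T i2 f) = (\<lambda>x. 0)"
        using 2 funpow_dunkl_zero by (metis add.commute funpow_add o_apply)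
    qed
    then show ?case using Suc(1) by (simp del: dunkl_filt.simps)
  qed (simp del: dunkl_filt.simps)
  moreover have "f \<in> dunkl_filt k k1 (Suc n + N)"
    using N by (rule dunkl_filt_mono[rotated]) simp
  ultimately show ?thesis by blast
qed

end

section \<open>Triangular systems of functionals\<close>

text \<open>
  In a vanishing linear combination the functional of the largest index with a non-zero coefficient
  sees that coefficient alone.
\<close>

lemma triangular_basis:
  fixes v :: "nat \<Rightarrow> 'a \<Rightarrow> real" and L :: "nat \<Rightarrow> ('a \<Rightarrow> real) \<Rightarrow> real"
  assumes lin: "\<And>r c M. finite M \<Longrightarrow> L r (\<lambda>x. \<Sum>q\<in>M. c q * v q x) = (\<Sum>q\<in>M. c q * L r (v q))"
    and diag: "\<And>r. L r (v r) \<noteq> 0" and lower: "\<And>q r. q < r \<Longrightarrow> L r (v q) = 0"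
  shows "inj v" "fun_space.independent (range v)"
proof -
  show inj: "inj v"
  proof (rule injI)
    fix q r assume "v q = v r"
    then show "q = r" using diag[of q] diag[of r] lower[of q r] lower[of r q]
      by (metis linorder_neqE_nat)
  qed
  show "fun_space.independent (range v)"
    unfolding fun_space.independent_explicit_finite_subsets
  proof (intro allI impI ballI)
    fix S u w
    assume S: "S \<subseteq> range v" "finite S" and eq: "(\<Sum>w\<in>S. fun_scale (u w) w) = 0" and w: "w \<in> S"
    define M where "M = v -` S"
    have M: "finite M" "v ` M = S"
      using S inj by (auto simp: M_def finite_vimageI)
    have rel: "(\<lambda>x. \<Sum>q\<in>M. u (v q) * v q x) = (\<lambda>x. 0)"
    proof
      fix x
      have "0 = (\<Sum>w\<in>v ` M. fun_scale (u w) w) x" using eq M by simp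
      also have "\<dots> = (\<Sum>q\<in>M. fun_scale (u (v q)) (v q)) x"
        using inj by (subst sum.reindex) (auto intro: inj_on_subset)
      also have "\<dots> = (\<Sum>q\<in>M. u (v q) * v q x)"
        by (induction M rule: infinite_finite_induct) (auto simp: fun_scale_def)
      finally show "(\<Sum>q\<in>M. u (v q) * v q x) = 0" by simp
    qed
    have L0: "L r (\<lambda>x. 0) = 0" for r using lin[of "{}" r] by simp
    show "u w = 0"
    proof (rule ccontr)
      assume "u w \<noteq> 0"
      define P where "P = {q \<in> M. u (v q) \<noteq> 0}"
      have P: "finite P" "P \<noteq> {}" using M w \<open>u w \<noteq> 0\<close> by (auto simp: P_def)
      define r where "r = Max P"
      have r: "r \<in> P" "\<And>q. q \<in> P \<Longrightarrow> q \<le> r" using P by (auto simp: r_def)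
      have "0 = (\<Sum>q\<in>M. u (v q) * L r (v q))"
        using lin[OF M(1), of r "\<lambda>q. u (v q)"] by (simp add: rel L0)
      also have "\<dots> = (\<Sum>q\<in>{r}. u (v q) * L r (v q))"
      proof (rule sum.mono_neutral_right)
        show "\<forall>q\<in>M - {r}. u (v q) * L r (v q) = 0"
        proof
          fix q assume "q \<in> M - {r}"
          then show "u (v q) * L r (v q) = 0"
            using r(2)[of q] lower[of q r] by (cases "u (v q) = 0") (auto simp: P_def)
        qed
      qed (use M r in \<open>auto simp: P_def\<close>)
      finally show False using r(1) diag[of r] by (simp add: P_def)
    qed
  qed
qed

context planar
begin

text \<open>
  In the order \<open>h0 0, h1 0, h0 1, h1 1, \<dots>\<close> the functionals \<open>T\<^sub>1\<^sup>n\<close> and \<open>T\<^sub>1\<^sup>n T\<^sub>2\<close> at the origin are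
  triangular.  For the spanning property, subtracting multiples of \<open>h0 (Suc m)\<close> and \<open>h1 m\<close> makes
  both constants of a planar harmonic vanish, and \<open>PH_descend\<close> lowers its degree.
\<close>

theorem basis_criterion:
  fixes h0 h1 :: "nat \<Rightarrow> real^'n \<Rightarrow> real"
  assumes PH0: "\<And>n. h0 n \<in> PH" and PH1: "\<And>n. h1 n \<in> PH"
    and c: "\<And>n. (T i1 ^^ n) (h0 n) = (\<lambda>x. c n)" "\<And>n. c n \<noteq> 0"
    and F0: "\<And>n. h0 n \<in> dunkl_filt k k1 (Suc n)"
    and d: "\<And>n. (T i1 ^^ n) (T i2 (h1 n)) = (\<lambda>x. d n)" "\<And>n. d n \<noteq> 0"
    and F1: "\<And>n. h1 n \<in> dunkl_filt k k1 (Suc (Suc n))"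
    and h1: "\<And>n. (T i1 ^^ Suc n) (h1 n) = (\<lambda>x. 0)"
  defines "v \<equiv> \<lambda>r. if even r then h0 (r div 2) else h1 (r div 2)"
  shows "inj v" "fun_space.independent (range v)" "fun_space.span (range v) = PH"
proof -
  define L where "L r f = (if even r then (T i1 ^^ (r div 2)) f (0 :: real^'n)
      else (T i1 ^^ (r div 2)) (T i2 f) 0)" for r f
  have vPH: "v r \<in> PH" for r using PH0 PH1 by (simp add: v_def)
  have vpoly: "real_polynomial_function (v r)" for r using vPH by (rule PH_poly)
  have lin: "L r (\<lambda>x. \<Sum>q\<in>M. a q * v q x) = (\<Sum>q\<in>M. a q * L r (v q))" for r M and a :: "nat \<Rightarrow> real"
    by (simp add: L_def funpow_dunkl_sum dunkl_sum dunkl_scale funpow_dunkl_scale vpoly dunkl_poly poly_cmult)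
  have diag: "L r (v r) \<noteq> 0" for r
    by (simp add: L_def v_def c d)
  have kill: "(T i1 ^^ n) f = (\<lambda>x. 0)" "(T i1 ^^ n) (T i2 f) = (\<lambda>x. 0)" if "f \<in> dunkl_filt k k1 n" for f n
  proof -
    show "(T i1 ^^ n) f = (\<lambda>x. 0)" using funpow_dunkl_filt[of f k k1 0 n i1] that by simp
    have "f \<in> dunkl_filt k k1 (0 + Suc n)" using that dunkl_filt_Suc by auto
    then have "T i2 f \<in> dunkl_filt k k1 (0 + n)" by simp
    then show "(T i1 ^^ n) (T i2 f) = (\<lambda>x. 0)" using funpow_dunkl_filt[of "T i2 f" k k1 0 n i1] by simp
  qed
  have vfilt: "v q \<in> dunkl_filt k k1 (Suc (Suc q div 2))" for q
    using F0 F1 by (auto simp: v_def elim!: evenE oddE simp del: dunkl_filt.simps(2))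
  have lower: "L r (v q) = 0" if "q < r" for q r
  proof (cases "even r \<and> Suc q = r")
    case True
    then obtain n where n: "r = 2 * n" by auto
    with True that have "n > 0" "odd q" "q div 2 = n - 1" by presburger+
    then show ?thesis using h1[of "n - 1"] n by (simp add: L_def v_def del: funpow.simps)
  next
    case False
    show ?thesis
    proof (cases "even r")
      case True
      with False that have "Suc (Suc q div 2) \<le> r div 2" by presburger
      then have "v q \<in> dunkl_filt k k1 (r div 2)" using vfilt dunkl_filt_mono by blast
      then show ?thesis using kill(1) True by (simp add: L_def)
    next
      case odd: False
      with that have "Suc (Suc q div 2) \<le> Suc (r div 2)" by presburger
      then have "v q \<in> dunkl_filt k k1 (Suc (r div 2))" using vfilt dunkl_filt_mono by blast
      then have "T i2 (v q) \<in> dunkl_filt k k1 (0 + r div 2)" by simp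
      then show ?thesis using odd funpow_dunkl_filt[of "T i2 (v q)" k k1 0 "r div 2" i1] by (simp add: L_def)
    qed
  qed
  show "inj v" "fun_space.independent (range v)"
    using triangular_basis[of L v] lin diag lower by blast+
  have span: "f \<in> fun_space.span (range v)" if "f \<in> PH" "f \<in> dunkl_filt k k1 n" for f n
    using that
  proof (induction n arbitrary: f)
    case 0
    then have "f = 0" by (simp add: zero_fun_def)
    then show ?case using fun_space.span_zero by metis
  next
    case (Suc n)
    have h0s: "h0 m \<in> fun_space.span (range v)" for m
      by (intro fun_space.span_base image_eqI[of _ _ "2 * m"]) (auto simp: v_def)
    have h1s: "h1 m \<in> fun_space.span (range v)" for m
      by (intro fun_space.span_base image_eqI[of _ _ "Suc (2 * m)"]) (auto simp: v_def)
    show ?case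
    proof (cases n)
      case 0
      have "f = (\<lambda>x. f 0)" using dunkl_filt_1_const[OF k_pos k1_pos] Suc(3) 0 by blast
      also have "\<dots> = fun_scale (f 0 / c 0) (h0 0)"
        using c[of 0] by (simp add: fun_scale_def)
      finally show ?thesis using fun_space.span_scale[OF h0s] by metis
    next
      case (Suc m)
      note n = Suc
      define a where "a = (T i1 ^^ Suc m) f 0"
      \<comment> \<open>\<open>h0 (Suc m)\<close> comes first: \<open>h1 m\<close> does not contribute to \<open>T\<^sub>1\<^sup>m\<^sup>+\<^sup>1\<close>, so the first constant stays zero.\<close>
      define g where "g = (\<lambda>x. f x - a / c (Suc m) * h0 (Suc m) x)"
      define b where "b = (T i1 ^^ m) (T i2 g) 0"
      define u where "u = (\<lambda>x. g x - b / d m * h1 m x)"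
      have const: "(T i1 ^^ Suc m) p = (\<lambda>x. (T i1 ^^ Suc m) p 0)"
        "(T i1 ^^ m) (T i2 p) = (\<lambda>x. (T i1 ^^ m) (T i2 p) 0)"
        if "p \<in> dunkl_filt k k1 (Suc (Suc m))" for p
      proof -
        have "(T i1 ^^ Suc m) p \<in> dunkl_filt k k1 (Suc 0)"
          using that funpow_dunkl_filt[of p k k1 "Suc 0" "Suc m"] by simp
        then show "(T i1 ^^ Suc m) p = (\<lambda>x. (T i1 ^^ Suc m) p 0)"
          by (rule dunkl_filt_1_const[OF k_pos k1_pos])
        have "T i2 p \<in> dunkl_filt k k1 (Suc 0 + m)"
          using that unfolding dunkl_filt.simps(2)[of k k1 "Suc m"] by simp
        from funpow_dunkl_filt[OF this] show "(T i1 ^^ m) (T i2 p) = (\<lambda>x. (T i1 ^^ m) (T i2 p) 0)"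
          by (rule dunkl_filt_1_const[OF k_pos k1_pos])
      qed
      have sub: "(\<lambda>x. p x - s * q x) \<in> dunkl_filt k k1 N" if "p \<in> dunkl_filt k k1 N" "q \<in> dunkl_filt k k1 N"
        for p q :: "real^'n \<Rightarrow> real" and s N
        using dunkl_filt_add[OF that(1) dunkl_filt_scale[OF that(2), of "-s"]] by simp
      have lin2: "(T i1 ^^ N) (\<lambda>x. p x - s * q x) = (\<lambda>x. (T i1 ^^ N) p x - s * (T i1 ^^ N) q x)"
        if "real_polynomial_function p" "real_polynomial_function q" for p q s N
        using funpow_dunkl_add[OF that(1) poly_cmult[OF that(2), of "-s"], of N k k1 i1]
          funpow_dunkl_scale[OF that(2), of N k k1 i1 "-s"] by simp
      have lin3: "T i2 (\<lambda>x. p x - s * q x) = (\<lambda>x. T i2 p x - s * T i2 q x)"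
        if "real_polynomial_function p" "real_polynomial_function q" for p q s
        using that by (simp add: dunkl_diff dunkl_scale poly_cmult)
      have f: "f \<in> dunkl_filt k k1 (Suc (Suc m))" using Suc.prems(2) n by (simp del: dunkl_filt.simps)
      have g: "g \<in> PH" "g \<in> dunkl_filt k k1 (Suc (Suc m))"
        unfolding g_def by (rule PH_diff[OF Suc.prems(1) PH0], rule sub[OF f F0])
      have u: "u \<in> PH" "u \<in> dunkl_filt k k1 (Suc (Suc m))"
        unfolding u_def by (rule PH_diff[OF g(1) PH1], rule sub[OF g(2) F1])
      have fa: "(T i1 ^^ Suc m) f = (\<lambda>x. a)"
        unfolding a_def by (rule const(1)[OF f])
      have gb: "(T i1 ^^ m) (T i2 g) = (\<lambda>x. b)"
        unfolding b_def by (rule const(2)[OF g(2)])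
      have gz: "(T i1 ^^ Suc m) g = (\<lambda>x. 0)"
        unfolding g_def lin2[OF PH_poly[OF Suc.prems(1)] PH_poly[OF PH0]] c(1) fa
        using c(2) by simp
      have "(T i1 ^^ Suc m) u = (\<lambda>x. 0)"
        unfolding u_def lin2[OF PH_poly[OF g(1)] PH_poly[OF PH1]] gz h1 by simp
      moreover have "(T i1 ^^ m) (T i2 u) = (\<lambda>x. 0)"
        unfolding u_def lin3[OF PH_poly[OF g(1)] PH_poly[OF PH1]]
          lin2[OF dunkl_poly[OF PH_poly[OF g(1)]] dunkl_poly[OF PH_poly[OF PH1]]] d(1) gb
        using d(2) by simp
      ultimately have "u \<in> fun_space.span (range v)"
        using PH_descend[OF u] Suc.IH[OF u(1)] n by (simp del: dunkl_filt.simps funpow.simps)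
      moreover have "f = u + fun_scale (a / c (Suc m)) (h0 (Suc m)) + fun_scale (b / d m) (h1 m)"
        by (auto simp: u_def g_def fun_scale_def)
      ultimately show ?thesis
        using fun_space.span_add fun_space.span_scale h0s h1s by metis
    qed
  qed
  show "fun_space.span (range v) = PH"
  proof
    show "fun_space.span (range v) \<subseteq> PH"
      using vPH by (intro fun_space.span_minimal PH_subspace) auto
    show "PH \<subseteq> fun_space.span (range v)"
      using span dunkl_filt_exhausts[OF PH_poly] by blast
  qed
qed

end

section \<open>Power series in t with polynomial coefficients in s\<close>

notation fps_nth (infixl "$$" 75)

text \<open>
  Coefficients in \<open>s\<close> are polynomials, so that \<open>d/ds\<close> acts coefficientwise and \<open>s\<close> can be
  specialised to any real number.
\<close>

type_synonym sts = "real poly fps"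

abbreviation sconst :: "real \<Rightarrow> sts" where "sconst r \<equiv> fps_const [:r:]"
abbreviation svar :: sts where "svar \<equiv> fps_const [:0, 1:]"
abbreviation tvar :: sts where "tvar \<equiv> fps_X"

lemma sconst_hom:
  "sconst (a + b) = sconst a + sconst b" "sconst (a - b) = sconst a - sconst b"
  "sconst (a * b) = sconst a * sconst b" "sconst 0 = 0" "sconst 1 = 1" "sconst (- a) = - sconst a"
  "sconst (numeral w) = numeral w" "sconst (real n) = of_nat n" "sconst (a ^ n) = sconst a ^ n"
proof -
  show "sconst (a ^ n) = sconst a ^ n"
  proof -
    have "[:a:] ^ n = [:a ^ n:]" by (induction n) (simp_all add: one_pCons)
    then show ?thesis by (simp only: fps_const_power)
  qed
qed (simp_all add: numeral_fps_const numeral_poly fps_of_nat[symmetric] of_nat_poly one_pCons[symmetric])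

text \<open>
  The binomial series \<open>(1 - t)\<^sup>-\<^sup>a\<close>, with constant polynomials as coefficients.
\<close>

definition rising :: "real \<Rightarrow> sts" where
  "rising a = Abs_fps (\<lambda>r. [:pochhammer a r / fact r:])"

lemma rising_0: "rising 0 = 1"
  by (rule fps_ext) (auto simp: rising_def pochhammer_0_left one_pCons)

lemma rising_step: "(1 - fps_X) * rising (a + 1) = rising a"
proof (rule fps_ext)
  fix n
  show "((1 - fps_X) * rising (a + 1)) $$ n = rising a $$ n"
  proof (cases n)
    case (Suc m)
    have "pochhammer (a + 1) (Suc m) / fact (Suc m) - pochhammer (a + 1) m / fact m
        = pochhammer (a + 1) m * ((a + 1 + real m) - real (Suc m)) / fact (Suc m)"
    proof -
      have *: "A * c / (S * F) - A / F = A * (c - S) / (S * F)" if "S \<noteq> 0" "F \<noteq> 0" for A c S F :: real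
        using that by (simp add: field_simps)
      show ?thesis
        using *[of "real (Suc m)" "fact m"] by (simp add: pochhammer_Suc del: of_nat_Suc)
    qed
    also have "\<dots> = pochhammer a (Suc m) / fact (Suc m)"
      by (simp add: pochhammer_rec mult.commute)
    finally show ?thesis using Suc by (simp add: rising_def left_diff_distrib)
  qed (simp add: rising_def left_diff_distrib)
qed

lemma rising_deriv: "fps_deriv (rising a) = sconst a * rising (a + 1)"
proof (rule fps_ext)
  fix n
  have "real (Suc n) * (pochhammer a (Suc n) / fact (Suc n)) = a * (pochhammer (a + 1) n / fact n)"
    by (simp add: pochhammer_rec field_simps del: of_nat_Suc)
  then show "fps_deriv (rising a) $$ n = (sconst a * rising (a + 1)) $$ n"
    by (simp add: rising_def of_nat_poly del: of_nat_Suc)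
qed

subsection \<open>The derivation with respect to s\<close>

definition dS :: "sts \<Rightarrow> sts" where "dS A = Abs_fps (\<lambda>n. pderiv (A $$ n))"

lemma dS_nth [simp]: "dS A $$ n = pderiv (A $$ n)"
  by (simp add: dS_def)

lemma pderiv_sum: "pderiv (sum f M) = (\<Sum>m\<in>M. pderiv (f m))"
  by (induction M rule: infinite_finite_induct) (auto simp: pderiv_add)

lemma dS_add: "dS (A + B) = dS A + dS B" and dS_diff: "dS (A - B) = dS A - dS B"
  by (auto intro!: fps_ext simp: pderiv_add pderiv_diff)

lemma dS_mult: "dS (A * B) = dS A * B + A * dS B"
  by (rule fps_ext, simp add: fps_mult_nth pderiv_sum pderiv_mult sum.distrib[symmetric], rule sum.cong)
    (simp_all add: algebra_simps)

lemma dS_const: "dS (sconst a) = 0" and dS_X: "dS fps_X = 0" and dS_svar: "dS svar = 1"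
  and dS_1: "dS 1 = 0"
proof -
  show "dS fps_X = 0" "dS 1 = 0" by (auto intro!: fps_ext simp: fps_X_def)
qed (auto intro!: fps_ext simp: pderiv_pCons fps_const_def)

lemma dS_numeral: "dS (numeral w) = 0"
  by (rule fps_ext) (simp add: numeral_fps_const numeral_poly pderiv_pCons)

lemma dS_power: "dS (A ^ n) = of_nat n * A ^ (n - 1) * dS A"
proof (induction n)
  case (Suc n)
  then show ?case by (cases n) (simp_all add: dS_mult algebra_simps)
qed (simp add: dS_1)

lemma dS_compose:
  assumes a: "\<And>n. pderiv (a $$ n) = 0" and b: "b $$ 0 = 0"
  shows "dS (a oo b) = (fps_deriv a oo b) * dS b"
proof (rule fps_ext)
  fix n
  have high: "(b ^ i) $$ m = 0" if "m < i" for i m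
    using startsby_zero_power_prefix[OF b] that by blast
  have "dS (a oo b) $$ n = (\<Sum>i\<in>{0..Suc n}. a $$ i * dS (b ^ i) $$ n)"
    using high[of n "Suc n"] by (simp add: fps_compose_nth pderiv_sum pderiv_mult a)
  also have "\<dots> = (\<Sum>i\<in>{0..Suc n}. of_nat i * a $$ i * (b ^ (i - 1) * dS b) $$ n)"
    by (rule sum.cong) (simp_all add: dS_power mult.assoc fps_of_nat[symmetric] del: dS_nth)
  also have "\<dots> = (\<Sum>i\<in>{0..n}. of_nat (Suc i) * a $$ Suc i * (b ^ i * dS b) $$ n)"
    by (subst sum.atLeast0_atMost_Suc_shift) (simp del: of_nat_Suc)
  also have "\<dots> = (\<Sum>i\<in>{0..n}. \<Sum>m\<in>{0..n}. fps_deriv a $$ i * (b ^ i) $$ m * dS b $$ (n - m))"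
    by (simp add: fps_mult_nth sum_distrib_left mult.assoc del: of_nat_Suc dS_nth)
  also have "\<dots> = (\<Sum>m\<in>{0..n}. (\<Sum>i\<in>{0..n}. fps_deriv a $$ i * (b ^ i) $$ m) * dS b $$ (n - m))"
    by (subst sum.swap) (simp add: sum_distrib_right del: dS_nth)
  also have "\<dots> = (\<Sum>m\<in>{0..n}. (fps_deriv a oo b) $$ m * dS b $$ (n - m))"
  proof (rule sum.cong[OF refl])
    fix m assume "m \<in> {0..n}"
    then have "(\<Sum>i\<in>{0..n}. fps_deriv a $$ i * (b ^ i) $$ m) = (fps_deriv a oo b) $$ m"
      unfolding fps_compose_nth by (intro sum.mono_neutral_right) (auto simp: high)
    then show "(\<Sum>i\<in>{0..n}. fps_deriv a $$ i * (b ^ i) $$ m) * dS b $$ (n - m)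
       = (fps_deriv a oo b) $$ m * dS b $$ (n - m)" by simp
  qed
  finally show "dS (a oo b) $$ n = ((fps_deriv a oo b) * dS b) $$ n"
    by (simp add: fps_mult_nth)
qed

subsection \<open>Powers of the quadratic\<close>

text \<open>
  The derivation \<open>t d/dt\<close>, which multiplies the coefficient of \<open>t\<^sup>n\<close> by \<open>n\<close>.
\<close>

definition tau :: "sts \<Rightarrow> sts" where "tau A = tvar * fps_deriv A"

lemma tau_nth [simp]: "tau A $$ n = of_nat n * A $$ n"
  by (cases n) (simp_all add: tau_def)

lemma tau_add: "tau (A + B) = tau A + tau B" and tau_mult: "tau (A * B) = tau A * B + A * tau B"
  and tau_const: "tau (sconst a) = 0" and tau_X: "tau tvar = tvar" and tau_diff: "tau (A - B) = tau A - tau B"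
  and tau_svar: "tau svar = 0" and tau_1: "tau 1 = 0"
  by (simp_all add: tau_def algebra_simps)

definition unit_quad :: sts where "unit_quad = 2 * svar * tvar - tvar\<^sup>2"

lemma unit_quad_0: "unit_quad $$ 0 = 0"
  by (simp add: unit_quad_def power2_eq_square)

text \<open>
  The power \<open>(1 - 2 s t + t\<^sup>2)\<^sup>-\<^sup>a\<close>.
\<close>

definition unit_pow :: "real \<Rightarrow> sts" where "unit_pow a = rising a oo unit_quad"

lemma unit_pow_step: "(1 - unit_quad) * unit_pow (a + 1) = unit_pow a"
  unfolding unit_pow_def rising_step[of a, symmetric] fps_compose_mult_distrib[OF unit_quad_0]
  by (simp add: fps_compose_sub_distrib unit_quad_0 fps_X_fps_compose_startby0)

lemma unit_pow_deriv: "fps_deriv (unit_pow a) = sconst a * unit_pow (a + 1) * (2 * svar - 2 * tvar)"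
  unfolding unit_pow_def fps_compose_deriv[OF unit_quad_0] rising_deriv
    fps_compose_mult_distrib[OF unit_quad_0] fps_const_compose
  by (simp add: unit_quad_def power2_eq_square)

lemma unit_pow_dS: "dS (unit_pow a) = sconst a * unit_pow (a + 1) * (2 * tvar)"
proof -
  have "dS unit_quad = 2 * tvar"
    by (simp add: unit_quad_def dS_diff dS_mult dS_X dS_svar dS_numeral power2_eq_square)
  moreover have "dS (unit_pow a) = (fps_deriv (rising a) oo unit_quad) * dS unit_quad"
    unfolding unit_pow_def
    by (rule dS_compose) (simp_all add: rising_def pderiv_pCons unit_quad_0)
  ultimately show ?thesis
    by (simp add: rising_deriv fps_compose_mult_distrib[OF unit_quad_0] unit_pow_def)
qed

text \<open>Substituting \<open>y t\<close> for \<open>t\<close>.\<close>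

definition dilate :: "real \<Rightarrow> sts \<Rightarrow> sts" where
  "dilate y A = A oo (fps_const [:y:] * fps_X)"

lemma dilate_nth: "dilate y A $$ n = smult (y ^ n) (A $$ n)"
proof -
  have "[:y:] ^ n = [:y ^ n:]" by (induction n) (simp_all add: one_pCons)
  then show ?thesis by (simp add: dilate_def fps_compose_linear)
qed

lemma dilate_hom: "dilate y (A * B) = dilate y A * dilate y B" "dilate y (A + B) = dilate y A + dilate y B"
  "dilate y (A - B) = dilate y A - dilate y B" "dilate y 1 = 1" "dilate y (fps_const p) = fps_const p"
  "dilate y tvar = sconst y * tvar"
  by (simp_all add: dilate_def fps_compose_mult_distrib fps_compose_add_distrib fps_compose_sub_distrib
      fps_X_fps_compose_startby0)

lemma tau_dilate: "tau (dilate y A) = dilate y (tau A)"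
  by (rule fps_ext) (simp add: dilate_nth)

lemma dS_dilate: "dS (dilate y A) = dilate y (dS A)"
  by (rule fps_ext) (simp add: dilate_nth pderiv_smult)

text \<open>
  \<open>qpow a y\<close> is \<open>(quad y)\<^sup>-\<^sup>a\<close>; in particular \<open>qpow 1 y\<close> is the inverse of \<open>quad y\<close>.
\<close>

definition quad :: "real \<Rightarrow> sts" where
  "quad y = 1 - 2 * svar * tvar * sconst y + tvar\<^sup>2 * (sconst y)\<^sup>2"

definition qpow :: "real \<Rightarrow> real \<Rightarrow> sts" where "qpow a y = dilate y (unit_pow a)"

lemma dilate_numeral: "dilate y (numeral w) = numeral w"
  unfolding numeral_fps_const by (rule dilate_hom)

lemma qpow_step: "quad y * qpow (a + 1) y = qpow a y"
proof -
  have "quad y = dilate y (1 - unit_quad)"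
    by (simp add: quad_def unit_quad_def dilate_hom dilate_numeral power2_eq_square algebra_simps)
  then show ?thesis by (simp add: qpow_def dilate_hom(1)[symmetric] unit_pow_step)
qed

lemma qpow_0: "qpow 0 y = 1"
  by (simp add: qpow_def unit_pow_def rising_0 dilate_hom)

lemma qpow_1: "quad y * qpow 1 y = 1"
  using qpow_step[of y 0] by (simp add: qpow_0)

lemma qpow_Suc: "qpow (a + 1) y = qpow 1 y * qpow a y"
proof -
  have "qpow (a + 1) y = (quad y * qpow 1 y) * qpow (a + 1) y" by (simp add: qpow_1)
  also have "\<dots> = qpow 1 y * (quad y * qpow (a + 1) y)" by (simp add: mult_ac)
  finally show ?thesis by (simp add: qpow_step)
qed

text \<open>
  The derivative of \<open>qpow a y\<close> with respect to \<open>y\<close>.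
\<close>

definition qpow_dy :: "real \<Rightarrow> real \<Rightarrow> sts" where
  "qpow_dy a y = tvar * dilate y (fps_deriv (unit_pow a))"

lemma qpow_dy_eq:
  "qpow_dy a y = sconst a * (2 * svar * tvar - 2 * tvar\<^sup>2 * sconst y) * qpow 1 y * qpow a y"
  unfolding qpow_dy_def unit_pow_deriv dilate_hom dilate_numeral qpow_def[symmetric] qpow_Suc
  by (simp add: power2_eq_square algebra_simps del: fps_const_mult)

lemma tau_qpow: "tau (qpow a y) = sconst y * qpow_dy a y"
  unfolding qpow_def tau_dilate unfolding tau_def dilate_hom qpow_dy_def by (simp add: mult_ac)

lemma dS_qpow: "dS (qpow a y) = sconst a * (2 * tvar * sconst y) * qpow 1 y * qpow a y"
  unfolding qpow_def dS_dilate unit_pow_dS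
  unfolding dilate_hom dilate_numeral qpow_def[symmetric] qpow_Suc by (simp add: mult_ac del: fps_const_mult)

lemma qpow_nth: "qpow a y $$ n = smult (y ^ n) (unit_pow a $$ n)"
  by (simp add: qpow_def dilate_nth)

subsection \<open>Coefficientwise differentiation in a real parameter\<close>

definition has_coeff_deriv :: "(real \<Rightarrow> sts) \<Rightarrow> sts \<Rightarrow> real \<Rightarrow> bool" where
  "has_coeff_deriv F F' h \<longleftrightarrow>
     (\<forall>n j. ((\<lambda>h. coeff (F h $$ n) j) has_real_derivative coeff (F' $$ n) j) (at h))"

lemma coeff_mult_nth:
  "coeff ((A * B) $$ n) j = (\<Sum>m=0..n. \<Sum>i\<le>j. coeff (A $$ m) i * coeff (B $$ (n - m)) (j - i))"
  by (simp add: fps_mult_nth coeff_sum coeff_mult)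

lemma has_coeff_deriv_const: "has_coeff_deriv (\<lambda>h. A) 0 h"
  by (simp add: has_coeff_deriv_def)

lemma has_coeff_deriv_add:
  "has_coeff_deriv F F' h \<Longrightarrow> has_coeff_deriv G G' h \<Longrightarrow> has_coeff_deriv (\<lambda>h. F h + G h) (F' + G') h"
  by (auto simp: has_coeff_deriv_def intro!: DERIV_add)

lemma has_coeff_deriv_mult:
  assumes "has_coeff_deriv F F' h" "has_coeff_deriv G G' h"
  shows "has_coeff_deriv (\<lambda>h. F h * G h) (F' * G h + F h * G') h"
  unfolding has_coeff_deriv_def
proof (intro allI)
  fix n j
  have "((\<lambda>h. coeff ((F h * G h) $$ n) j) has_real_derivative
     (\<Sum>m=0..n. \<Sum>i\<le>j. coeff (F' $$ m) i * coeff (G h $$ (n - m)) (j - i)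
        + coeff (G' $$ (n - m)) (j - i) * coeff (F h $$ m) i)) (at h)"
    unfolding coeff_mult_nth using assms
    by (intro DERIV_sum DERIV_mult) (auto simp: has_coeff_deriv_def)
  also have "(\<Sum>m=0..n. \<Sum>i\<le>j. coeff (F' $$ m) i * coeff (G h $$ (n - m)) (j - i)
        + coeff (G' $$ (n - m)) (j - i) * coeff (F h $$ m) i) = coeff ((F' * G h + F h * G') $$ n) j"
    unfolding fps_add_nth coeff_add coeff_mult_nth sum.distrib[symmetric]
    by (intro sum.cong refl) (simp add: mult.commute)
  finally show "((\<lambda>h. coeff ((F h * G h) $$ n) j) has_real_derivative
     coeff ((F' * G h + F h * G') $$ n) j) (at h)" .
qed

lemma has_coeff_deriv_sconst:
  assumes "(f has_real_derivative f') (at h)"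
  shows "has_coeff_deriv (\<lambda>h. sconst (f h)) (sconst f') h"
  unfolding has_coeff_deriv_def
proof (intro allI)
  fix n j
  show "((\<lambda>h. coeff (sconst (f h) $$ n) j) has_real_derivative coeff (sconst f' $$ n) j) (at h)"
    using assms by (cases n; cases j) auto
qed

lemma has_coeff_deriv_qpow:
  assumes "(f has_real_derivative f') (at h)"
  shows "has_coeff_deriv (\<lambda>h. qpow a (f h)) (sconst f' * qpow_dy a (f h)) h"
  unfolding has_coeff_deriv_def
proof (intro allI)
  fix n j
  have "((\<lambda>h. f h ^ n * coeff (unit_pow a $$ n) j) has_real_derivative
      real n * (f' * f h ^ (n - 1)) * coeff (unit_pow a $$ n) j) (at h)"
    using DERIV_cmult_right[OF DERIV_power[OF assms, of n], of "coeff (unit_pow a $$ n) j"] by simp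
  moreover have "coeff ((sconst f' * qpow_dy a (f h)) $$ n) j
      = real n * (f' * f h ^ (n - 1)) * coeff (unit_pow a $$ n) j"
    by (cases n) (simp_all add: qpow_dy_def dilate_nth of_nat_poly del: of_nat_Suc)
  ultimately show "((\<lambda>h. coeff (qpow a (f h) $$ n) j) has_real_derivative
      coeff ((sconst f' * qpow_dy a (f h)) $$ n) j) (at h)"
    unfolding qpow_nth coeff_smult by (simp only:)
qed

subsection \<open>Families with polynomial coefficients\<close>

definition poly_family :: "(real^'n \<Rightarrow> sts) \<Rightarrow> bool" where
  "poly_family F \<longleftrightarrow> (\<forall>n j. real_polynomial_function (\<lambda>x. coeff (F x $$ n) j))"

lemma poly_family_const: "poly_family (\<lambda>x. A)"
  by (simp add: poly_family_def real_polynomial_function.intros(2))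

lemma poly_family_add: "poly_family F \<Longrightarrow> poly_family G \<Longrightarrow> poly_family (\<lambda>x. F x + G x)"
  by (simp add: poly_family_def real_polynomial_function.intros(3))

lemma poly_family_diff: "poly_family F \<Longrightarrow> poly_family G \<Longrightarrow> poly_family (\<lambda>x. F x - G x)"
  by (simp add: poly_family_def real_polynomial_function_diff)

lemma poly_family_mult: "poly_family F \<Longrightarrow> poly_family G \<Longrightarrow> poly_family (\<lambda>x. F x * G x)"
  unfolding poly_family_def coeff_mult_nth
  by (intro allI poly_fun_sum real_polynomial_function.intros(4)) auto

lemma poly_family_prod: "(\<And>i. i \<in> I \<Longrightarrow> poly_family (F i)) \<Longrightarrow> poly_family (\<lambda>x. \<Prod>i\<in>I. F i x)"
  by (induction I rule: infinite_finite_induct) (auto intro: poly_family_const poly_family_mult)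

lemma poly_family_sconst: "real_polynomial_function f \<Longrightarrow> poly_family (\<lambda>x. sconst (f x))"
  unfolding poly_family_def
proof (intro allI)
  fix n j assume "real_polynomial_function f"
  then show "real_polynomial_function (\<lambda>x. coeff (sconst (f x) $$ n) j)"
    by (cases n; cases j) (auto intro: real_polynomial_function.intros(2))
qed

lemma poly_family_qpow: "real_polynomial_function f \<Longrightarrow> poly_family (\<lambda>x. qpow a (f x))"
  by (auto simp: poly_family_def qpow_nth intro!: real_polynomial_function.intros(2,4) real_polynomial_function_power)

subsection \<open>Weight and parity of the coefficients\<close>

text \<open>
  \<open>graded w A\<close>: the monomials \<open>s\<^sup>j t\<^sup>n\<close> of \<open>A\<close> are \<open>t\<^sup>w\<close> times monomials in \<open>s t\<close> and \<open>t\<^sup>2\<close>.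
\<close>

definition graded :: "nat \<Rightarrow> sts \<Rightarrow> bool" where
  "graded w A \<longleftrightarrow> (\<forall>n j. coeff (A $$ n) j \<noteq> 0 \<longrightarrow> j + w \<le> n \<and> even (n + j + w))"

lemma graded_add: "graded w A \<Longrightarrow> graded w B \<Longrightarrow> graded w (A + B)"
  and graded_diff: "graded w A \<Longrightarrow> graded w B \<Longrightarrow> graded w (A - B)"
  by (auto simp: graded_def) (metis add_0 diff_0_right)+

lemma graded_mult:
  assumes A: "graded v A" and B: "graded w B" shows "graded (v + w) (A * B)"
  unfolding graded_def
proof (intro allI impI)
  fix n j assume "coeff ((A * B) $$ n) j \<noteq> 0"
  then obtain m i where mi: "m \<le> n" "i \<le> j" "coeff (A $$ m) i \<noteq> 0" "coeff (B $$ (n - m)) (j - i) \<noteq> 0"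
    unfolding coeff_mult_nth by (metis (no_types, lifting) atLeastAtMost_iff atMost_iff mult_eq_0_iff sum.neutral)
  from A mi(3) have "i + v \<le> m" "even (m + i + v)" unfolding graded_def by blast+
  moreover from B mi(4) have "j - i + w \<le> n - m" "even (n - m + (j - i) + w)" unfolding graded_def by blast+
  moreover obtain n' j' where "n = m + n'" "j = i + j'" using mi(1,2) le_Suc_ex by metis
  ultimately show "j + (v + w) \<le> n \<and> even (n + j + (v + w))" by simp presburger
qed

lemma graded_const: "graded 0 (sconst a)"
  by (auto simp: graded_def fps_const_def coeff_pCons split: if_splits nat.splits)

lemma graded_numeral: "graded 0 (numeral w)"
  using graded_const[of "numeral w"] by (simp add: sconst_hom)

lemma graded_1: "graded 0 1"
  using graded_const[of 1] by (simp add: sconst_hom)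

lemma graded_st: "graded 0 (svar * tvar)"
  by (auto simp: graded_def fps_X_def coeff_pCons split: if_splits nat.splits)

lemma graded_t: "graded 1 tvar"
  by (auto simp: graded_def fps_X_def)

lemma graded_t2: "graded 0 (tvar\<^sup>2)"
  by (auto simp: graded_def fps_X_power_nth)

lemma graded_power: "graded 0 A \<Longrightarrow> graded 0 (A ^ n)"
  by (induction n) (auto simp: graded_1 dest: graded_mult)

lemma graded_prod: "(\<And>i. i \<in> I \<Longrightarrow> graded 0 (F i)) \<Longrightarrow> graded 0 (\<Prod>i\<in>I. F i)"
  by (induction I rule: infinite_finite_induct) (auto simp: graded_1 intro: graded_mult[of 0 _ 0, simplified])

lemma graded_qpow: "graded 0 (qpow a y)"
proof -
  have q: "graded 0 (unit_quad ^ i)" for i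
    unfolding unit_quad_def
    using graded_mult[OF graded_numeral[of "num.Bit0 num.One"] graded_st]
    by (intro graded_power graded_diff graded_t2) (simp add: mult.assoc)
  have "graded 0 (unit_pow a)"
    unfolding graded_def
  proof (intro allI impI)
    fix n j assume "coeff (unit_pow a $$ n) j \<noteq> 0"
    then have "(\<Sum>i\<in>{0..n}. pochhammer a i / fact i * coeff ((unit_quad ^ i) $$ n) j) \<noteq> 0"
      by (simp add: unit_pow_def fps_compose_nth coeff_sum rising_def)
    then obtain i where "coeff ((unit_quad ^ i) $$ n) j \<noteq> 0"
      by (metis (no_types, lifting) mult_zero_right sum.neutral)
    with q show "j + 0 \<le> n \<and> even (n + j + 0)" unfolding graded_def by blast
  qed
  then show ?thesis by (auto simp: graded_def qpow_nth)
qed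

section \<open>The action on the generating functions\<close>

subsection \<open>Identities of rational functions\<close>

text \<open>
  The difference quotient, between \<open>y\<close> and \<open>w\<close>, of a function with an affine numerator and a
  quadratic pole.
\<close>

lemma swap_quotient_identity:
  fixes s t y w I W al be :: "'a::idom"
  assumes "(1 - 2 * s * t * y + t\<^sup>2 * y\<^sup>2) * I = 1" "(1 - 2 * s * t * w + t\<^sup>2 * w\<^sup>2) * W = 1"
  shows "(y - w) * (I * W * (be + 2 * s * t * al - t\<^sup>2 * al * y - t\<^sup>2 * (al + be * y) * w))
       = (al + be * y) * I - (al + be * w) * W"
proof -
  have "(y - w) * (I * W * (be + 2 * s * t * al - t\<^sup>2 * al * y - t\<^sup>2 * (al + be * y) * w))
     = (al + be * y) * I * ((1 - 2 * s * t * w + t\<^sup>2 * w\<^sup>2) * W)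
       - (al + be * w) * W * ((1 - 2 * s * t * y + t\<^sup>2 * y\<^sup>2) * I)"
    by algebra
  then show ?thesis by (simp add: assms)
qed

text \<open>
  Here \<open>y, z\<close> stand for the squares of the two distinguished coordinates, \<open>I, J\<close> for the inverses
  of their quadratics, \<open>S0, S1, S2\<close> for the power sums of all squares weighted by \<open>k\<close> times the
  inverse quadratics, and \<open>n\<close> for \<open>k N\<close>.
\<close>

locale rational_identities =
  fixes s t y z I J S0 S1 S2 k n :: "'a::idom"
  assumes I: "(1 - 2 * s * t * y + t\<^sup>2 * y\<^sup>2) * I = 1" and J: "(1 - 2 * s * t * z + t\<^sup>2 * z\<^sup>2) * J = 1"
    and n: "S0 - 2 * s * t * S1 + t\<^sup>2 * S2 = n"
begin

text \<open>
  The factors by which \<open>T\<^sub>1\<close>, \<open>t d/dt\<close> and \<open>d/ds\<close> multiply the common factor of \<open>F\<^sub>0\<close> and \<open>F\<^sub>1\<close>: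
  \<open>2 x\<^sub>1 D1_coeff\<close> for \<open>T\<^sub>1\<close> on a numerator \<open>al + be y\<close> whose difference quotient in \<open>(y, z)\<close> is \<open>B2\<close>,
  and \<open>tauM\<close>, \<open>dSM\<close> for the two derivations.  \<open>num0\<close>, \<open>num1\<close> are the numerators of \<open>F\<^sub>0\<close>, \<open>F\<^sub>1\<close>.
\<close>

definition "D1_coeff al be B2 = be + (al + be * y) * (k + 1) * (2 * s * t - 2 * t\<^sup>2 * y) * I
   + (be + 2 * s * t * al - t\<^sup>2 * al * y) * (S0 - k * (I + J))
   - t\<^sup>2 * (al + be * y) * (S1 - k * (y * I + z * J)) + k * B2"

definition "tauM = 2 * s * t * S1 - 2 * t\<^sup>2 * S2 + y * (2 * s * t - 2 * t\<^sup>2 * y) * I + z * (2 * s * t - 2 * t\<^sup>2 * z) * J"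
definition "dSM = 2 * t * S1 + 2 * t * y * I + 2 * t * z * J"
definition "num0 = 1 - s * t * (y + z) + t\<^sup>2 * y * z"
definition "num1 = t * (y - z)"
definition "tau_num0 = num0 * tauM + (2 * t\<^sup>2 * y * z - s * t * (y + z))"
definition "dS_num0 = num0 * dSM - t * (y + z)"
definition "tau_num1 = num1 * tauM + num1"
definition "dS_num1 = num1 * dSM"

lemmas cdefs = D1_coeff_def tauM_def dSM_def num0_def num1_def tau_num0_def tau_num1_def dS_num0_def dS_num1_def

text \<open>
  After substituting the relation for \<open>n\<close>, the difference of the two sides in this and the next
  identities lies in the ideal generated by the relations for \<open>I\<close> and \<open>J\<close>; \<open>u\<close> and \<open>v\<close> are the
  cofactors.
\<close>

lemma D1_num1: "2 * D1_coeff (- t * z) t (2 * t) = t * (tau_num0 + s * dS_num0 + 2 * (1 + n) * num0)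
   + s * t * (tau_num1 + s * dS_num1 + (3 + 2 * n) * num1) - t * dS_num1"
proof -
  define u where "u = -2 * t * k + 2 * t ^ 3 * y * z - 4 * s * t ^ 2 * z"
  have "2 * D1_coeff (- t * z) t (2 * t) - (t * (tau_num0 + s * dS_num0 + 2 * (1 + n) * num0)
   + s * t * (tau_num1 + s * dS_num1 + (3 + 2 * n) * num1) - t * dS_num1)
   = u * ((1 - 2 * s * t * y + t\<^sup>2 * y\<^sup>2) * I - 1) + u * ((1 - 2 * s * t * z + t\<^sup>2 * z\<^sup>2) * J - 1)"
    unfolding cdefs n[symmetric] u_def by algebra
  then show ?thesis by (simp add: I J)
qed

lemma D1_num0: "2 * D1_coeff (1 - s * t * z) (t\<^sup>2 * z - s * t) 0
  = s * t * (tau_num0 + s * dS_num0 + (2 + 2 * n) * num0) + s\<^sup>2 * t * (tau_num1 + s * dS_num1 + (3 + 2 * n) * num1)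
    - t * dS_num0 - t * (tau_num1 + s * dS_num1 + (2 + 2 * n - 2 * k) * num1)"
proof -
  define u where "u = -2 * t ^ 2 * z * k -2 * t ^ 2 * y +4 * s * t +2 * s * t * k +2 * s * t ^ 3 * y * z -4 * s ^ 2 * t ^ 2 * z"
  define v where "v = 2 * t ^ 2 * z +2 * t ^ 2 * y * k -2 * s * t * k +2 * s * t ^ 3 * y * z -4 * s ^ 2 * t ^ 2 * z"
  have "2 * D1_coeff (1 - s * t * z) (t\<^sup>2 * z - s * t) 0
    - (s * t * (tau_num0 + s * dS_num0 + (2 + 2 * n) * num0) + s\<^sup>2 * t * (tau_num1 + s * dS_num1 + (3 + 2 * n) * num1)
    - t * dS_num0 - t * (tau_num1 + s * dS_num1 + (2 + 2 * n - 2 * k) * num1))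
   = u * ((1 - 2 * s * t * y + t\<^sup>2 * y\<^sup>2) * I - 1) + v * ((1 - 2 * s * t * z + t\<^sup>2 * z\<^sup>2) * J - 1)"
    unfolding cdefs n[symmetric] u_def v_def by algebra
  then show ?thesis by (simp add: I J)
qed

text \<open>
  The factor for \<open>T\<^sub>1\<close> on \<open>x\<^sub>1\<close> times such a function: \<open>x\<^sub>1 T\<^sub>1\<close> contributes the first summand, and the
  commutator with \<open>x\<^sub>1\<close> the values at all exchanges, \<open>sg\<close> being the sign under the exchange with \<open>x\<^sub>2\<close>.
  The commutator
  also contains \<open>1 + 2 k\<^sub>1\<close> times the function itself, which is left out here.
\<close>

definition "R1_coeff al be B2 sg = 2 * y * D1_coeff al be B2
  + 2 * ((1 - 2 * s * t * y + t\<^sup>2 * y\<^sup>2) * (al * (S0 - k * (I + J)) + be * (S1 - k * (y * I + z * J)))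
     + sg * k * (al + be * y))"

lemma R1_num0: "R1_coeff (1 - s * t * z) (t\<^sup>2 * z - s * t) 0 1
  = tau_num0 + (2 * n - 2 * k) * num0 + (1 + 2 * k) * s * num1 - (1 - s\<^sup>2) * dS_num1"
proof -
  define u where "u = -2 * k -2 * t ^ 2 * y * z -4 * t ^ 2 * y * z * k +2 * s * t * z * k +2 * s * t * y +4 * s * t * y * k"
  define v where "v = -2 * k +2 * t ^ 2 * y * z -2 * s * t * z +2 * s * t * y * k"
  have "R1_coeff (1 - s * t * z) (t\<^sup>2 * z - s * t) 0 1
   - (tau_num0 + (2 * n - 2 * k) * num0 + (1 + 2 * k) * s * num1 - (1 - s\<^sup>2) * dS_num1)
   = u * ((1 - 2 * s * t * y + t\<^sup>2 * y\<^sup>2) * I - 1) + v * ((1 - 2 * s * t * z + t\<^sup>2 * z\<^sup>2) * J - 1)"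
    unfolding cdefs R1_coeff_def n[symmetric] u_def v_def by algebra
  then show ?thesis by (simp add: I J)
qed

lemma R1_num1: "R1_coeff (- t * z) t (2 * t) (-1) = dS_num0 + tau_num1 + (2 * n - 4 * k) * num1"
proof -
  define u where "u = 2 * t * z * k -2 * t * y -4 * t * y * k"
  define v where "v = -2 * t * z -2 * t * y * k"
  have "R1_coeff (- t * z) t (2 * t) (-1) - (dS_num0 + tau_num1 + (2 * n - 4 * k) * num1)
   = u * ((1 - 2 * s * t * y + t\<^sup>2 * y\<^sup>2) * I - 1) + v * ((1 - 2 * s * t * z + t\<^sup>2 * z\<^sup>2) * J - 1)"
    unfolding cdefs R1_coeff_def n[symmetric] u_def v_def by algebra
  then show ?thesis by (simp add: I J)
qed

end

subsection \<open>Even families\<close>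

definition squares :: "real^'n \<Rightarrow> 'n \<Rightarrow> real" where "squares x = (\<lambda>m. (x $ m)\<^sup>2)"

lemma squares_refl:
  "squares (refl_sign i x) = squares x"
  "squares (refl_swap i j x) = (squares x)(i := squares x j, j := squares x i)"
  "squares (refl_negswap i j x) = (squares x)(i := squares x j, j := squares x i)"
  for x :: "real^'n::finite"
  by (auto simp: squares_def fun_eq_iff refl_sign_def refl_swap_def refl_negswap_def)

lemma squares_shift:
  "squares (x + h *\<^sub>R axis i 1) = (squares x)(i := (x $ i + h)\<^sup>2)" for x :: "real^'n::finite"
  by (auto simp: squares_def fun_eq_iff axis_def)

text \<open>
  On a function of the squares the sign change is invisible and the two reflections exchanging
  \<open>x\<^sub>i\<close> and \<open>x\<^sub>j\<close> agree, so that their two quotients add up to \<open>2x\<^sub>i\<close> times a quotient in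
  \<open>x\<^sub>i\<^sup>2 - x\<^sub>j\<^sup>2\<close>.
\<close>

lemma dunkl_even:
  fixes f :: "real^'n::finite \<Rightarrow> real" and B :: "'n \<Rightarrow> real^'n \<Rightarrow> real"
  assumes f: "real_polynomial_function f"
    and inv: "\<And>x. f (refl_sign i x) = f x" "\<And>j x. f (refl_negswap i j x) = f (refl_swap i j x)"
    and der: "\<And>x. ((\<lambda>h. f (x + h *\<^sub>R axis i 1)) has_real_derivative 2 * x $ i * D x) (at 0)"
    and B: "\<And>j. j \<noteq> i \<Longrightarrow> real_polynomial_function (B j)"
    and quot: "\<And>j x. j \<noteq> i \<Longrightarrow> ((x $ i)\<^sup>2 - (x $ j)\<^sup>2) * B j x = f x - f (refl_swap i j x)"
  shows "dunkl k k1 i f x = 2 * x $ i * (D x + k * (\<Sum>j\<in>UNIV - {i}. B j x))"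
proof -
  have s: "dq_sign i f = (\<lambda>x. 0)"
    by (rule dq_eqI) (auto simp: poly_zero inv)
  have 1: "dq_swap i j f = (\<lambda>x. (x $ i + x $ j) * B j x)" if "j \<noteq> i" for j
    using that quot[OF that]
    by (intro dq_eqI)
      (auto intro!: real_polynomial_function.intros(3,4) poly_coord B simp: power2_eq_square algebra_simps)
  have 2: "dq_negswap i j f = (\<lambda>x. (x $ i - x $ j) * B j x)" if "j \<noteq> i" for j
    using that quot[OF that] unfolding inv(2)[of j, symmetric]
    by (intro dq_eqI)
      (auto intro!: real_polynomial_function_diff real_polynomial_function.intros(4) poly_coord B
        simp: power2_eq_square algebra_simps)
  have "(\<Sum>j\<in>UNIV - {i}. dq_swap i j f x + dq_negswap i j f x) = (\<Sum>j\<in>UNIV - {i}. 2 * x $ i * B j x)"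
    by (rule sum.cong) (simp_all add: 1 2 algebra_simps)
  also have "\<dots> = 2 * x $ i * (\<Sum>j\<in>UNIV - {i}. B j x)"
    by (rule sum_distrib_left[symmetric])
  finally show ?thesis
    unfolding dunkl_altdef s
    using partial_eqI[OF der, of x] by (simp add: algebra_simps)
qed

abbreviation family_coeff :: "(('n::finite \<Rightarrow> real) \<Rightarrow> sts) \<Rightarrow> nat \<Rightarrow> nat \<Rightarrow> real^'n \<Rightarrow> real" where
  "family_coeff G n j \<equiv> (\<lambda>x. coeff (G (squares x) $$ n) j)"

abbreviation (input) square_family :: "(('n::finite \<Rightarrow> real) \<Rightarrow> sts) \<Rightarrow> bool" where
  "square_family G \<equiv> poly_family (\<lambda>x. G (squares x))"

lemma coeff_sconst_mult: "coeff ((sconst a * A) $$ n) j = a * coeff (A $$ n) j"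
  by simp

lemma coeff_nth_sum: "coeff ((\<Sum>i\<in>I. F i) $$ n) j = (\<Sum>i\<in>I. coeff (F i $$ n) j)"
  by (simp add: fps_sum_nth coeff_sum)

lemma dunkl_square_family:
  fixes G :: "('n::finite \<Rightarrow> real) \<Rightarrow> sts" and B :: "'n \<Rightarrow> ('n \<Rightarrow> real) \<Rightarrow> sts"
  assumes G: "square_family G" and B: "\<And>j. j \<noteq> i \<Longrightarrow> square_family (B j)"
    and der: "\<And>x. has_coeff_deriv (\<lambda>h. G ((squares x)(i := (x $ i + h)\<^sup>2))) (sconst (2 * x $ i) * D (squares x)) 0"
    and quot: "\<And>j y. j \<noteq> i \<Longrightarrow> (sconst (y i) - sconst (y j)) * B j y = G y - G (y(i := y j, j := y i))"
  shows "dunkl k k1 i (family_coeff G n j) x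
    = 2 * x $ i * coeff ((D (squares x) + sconst k * (\<Sum>j\<in>UNIV - {i}. B j (squares x))) $$ n) j"
proof -
  have "dunkl k k1 i (family_coeff G n j) x = 2 * x $ i * (family_coeff D n j x
      + k * (\<Sum>m\<in>UNIV - {i}. family_coeff (B m) n j x))"
  proof (rule dunkl_even)
    show "real_polynomial_function (family_coeff G n j)"
      "\<And>m. m \<noteq> i \<Longrightarrow> real_polynomial_function (family_coeff (B m) n j)"
      using G B by (auto simp: poly_family_def)
    show "((\<lambda>h. family_coeff G n j (x + h *\<^sub>R axis i 1)) has_real_derivative 2 * x $ i * family_coeff D n j x) (at 0)" for x
      using der[of x] unfolding squares_shift has_coeff_deriv_def coeff_sconst_mult by blast
    show "((x $ i)\<^sup>2 - (x $ m)\<^sup>2) * family_coeff (B m) n j x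
      = family_coeff G n j x - family_coeff G n j (refl_swap i m x)" if "m \<noteq> i" for m x
    proof -
      have "((x $ i)\<^sup>2 - (x $ m)\<^sup>2) * family_coeff (B m) n j x
        = coeff (((sconst (squares x i) - sconst (squares x m)) * B m (squares x)) $$ n) j"
        unfolding left_diff_distrib fps_sub_nth coeff_diff coeff_sconst_mult by (simp only: squares_def)
      also have "\<dots> = family_coeff G n j x - family_coeff G n j (refl_swap i m x)"
        by (simp only: quot[OF that] squares_refl fps_sub_nth coeff_diff)
      finally show ?thesis .
    qed
  qed (simp_all add: squares_refl)
  then show ?thesis
    by (simp only: fps_add_nth coeff_add coeff_sconst_mult coeff_nth_sum)
qed

subsection \<open>The generating functions as formal series\<close>

definition weight_ser :: "real \<Rightarrow> ('n::finite \<Rightarrow> real) \<Rightarrow> sts" where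
  "weight_ser k y = (\<Prod>i\<in>UNIV. qpow k (y i))"

definition pole_ser :: "real \<Rightarrow> 'n::finite \<Rightarrow> 'n \<Rightarrow> ('n \<Rightarrow> real) \<Rightarrow> sts" where
  "pole_ser k i1 i2 y = qpow 1 (y i1) * qpow 1 (y i2) * weight_ser k y"

definition F0_ser :: "real \<Rightarrow> 'n::finite \<Rightarrow> 'n \<Rightarrow> ('n \<Rightarrow> real) \<Rightarrow> sts" where
  "F0_ser k i1 i2 y = (1 - svar * tvar * (sconst (y i1) + sconst (y i2))
     + tvar\<^sup>2 * sconst (y i1) * sconst (y i2)) * pole_ser k i1 i2 y"

definition F1_ser :: "real \<Rightarrow> 'n::finite \<Rightarrow> 'n \<Rightarrow> ('n \<Rightarrow> real) \<Rightarrow> sts" where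
  "F1_ser k i1 i2 y = tvar * (sconst (y i1) - sconst (y i2)) * pole_ser k i1 i2 y"

lemma weight_ser_swap:
  assumes "i \<noteq> j" shows "weight_ser k (y(i := y j, j := y i)) = weight_ser k y"
proof -
  let ?p = "\<lambda>m. if m = i then j else if m = j then i else m"
  have "(\<Prod>m\<in>UNIV. qpow k ((y(i := y j, j := y i)) m)) = (\<Prod>m\<in>UNIV. qpow k (y (?p m)))"
    using assms by (intro prod.cong) auto
  also have "\<dots> = (\<Prod>m\<in>UNIV. qpow k (y m))"
    using bij_swap_fun by (rule prod.reindex_bij_betw)
  finally show ?thesis by (simp add: weight_ser_def)
qed

lemma F_ser_sym:
  assumes "i1 \<noteq> i2"
  shows "F0_ser k i1 i2 (y(i1 := y i2, i2 := y i1)) = F0_ser k i1 i2 y"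
    and "F1_ser k i1 i2 (y(i1 := y i2, i2 := y i1)) = - F1_ser k i1 i2 y"
  using assms
  by (simp_all add: F0_ser_def F1_ser_def pole_ser_def weight_ser_swap algebra_simps del: fps_const_mult fps_const_sub)

lemma poly_family_squares: "poly_family (\<lambda>x. sconst (squares x i))" "poly_family (\<lambda>x. qpow a (squares x i))"
  by (auto simp: squares_def intro!: poly_family_sconst poly_family_qpow real_polynomial_function_power poly_coord)

lemmas poly_family_intros = poly_family_const poly_family_add poly_family_diff poly_family_mult
  poly_family_prod poly_family_squares

lemma square_family_weight: "square_family (weight_ser k)"
  unfolding weight_ser_def by (intro poly_family_intros)

lemma square_family_pole: "square_family (pole_ser k i1 i2)"
  unfolding pole_ser_def by (intro poly_family_intros square_family_weight)

lemma square_family_F: "square_family (F0_ser k i1 i2)" "square_family (F1_ser k i1 i2)"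
  unfolding F0_ser_def F1_ser_def by (intro poly_family_intros square_family_pole)+

lemma graded_pole: "graded 0 (pole_ser k i1 i2 y)"
  unfolding pole_ser_def weight_ser_def
  by (intro graded_mult[of 0 _ 0, simplified] graded_qpow graded_prod)

lemma graded_F0: "graded 0 (F0_ser k i1 i2 y)"
  unfolding F0_ser_def
  by (intro graded_mult[of 0 _ 0, simplified] graded_pole graded_add graded_diff graded_1 graded_st
      graded_t2 graded_const)

lemma graded_F1: "graded 1 (F1_ser k i1 i2 y)"
  using graded_mult[OF graded_mult[OF graded_t graded_diff[OF graded_const graded_const]] graded_pole]
  by (simp add: F1_ser_def)

text \<open>A derivation acts on the product \<open>weight_ser\<close> by its logarithmic derivative.\<close>

lemma derivation_prod:
  fixes F :: "'i \<Rightarrow> sts"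
  assumes d: "\<And>A B. d (A * B) = d A * B + A * d B" "d 1 = 0" and F: "\<And>i. i \<in> I \<Longrightarrow> d (F i) = g i * F i"
  shows "d (\<Prod>i\<in>I. F i) = (\<Sum>i\<in>I. g i) * (\<Prod>i\<in>I. F i)"
  using F by (induction I rule: infinite_finite_induct) (simp_all add: d algebra_simps)

definition pole_sum :: "real \<Rightarrow> nat \<Rightarrow> ('n::finite \<Rightarrow> real) \<Rightarrow> sts" where
  "pole_sum k r y = sconst k * (\<Sum>i\<in>UNIV. sconst (y i) ^ r * qpow 1 (y i))"

lemma pole_sum_rel:
  fixes y :: "'n::finite \<Rightarrow> real"
  shows "pole_sum k 0 y - 2 * svar * tvar * pole_sum k 1 y + tvar\<^sup>2 * pole_sum k 2 y
    = sconst (k * real CARD('n))"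
proof -
  have "pole_sum k 0 y - 2 * svar * tvar * pole_sum k 1 y + tvar\<^sup>2 * pole_sum k 2 y
     = sconst k * (\<Sum>i\<in>UNIV. quad (y i) * qpow 1 (y i))"
    by (simp add: pole_sum_def quad_def sum_distrib_left sum.distrib sum_subtractf algebra_simps
        del: fps_const_mult fps_const_power)
  then show ?thesis by (simp add: qpow_1 sconst_hom del: fps_const_mult)
qed

lemma tau_weight:
  "tau (weight_ser k y) = (2 * svar * tvar * pole_sum k 1 y - 2 * tvar\<^sup>2 * pole_sum k 2 y) * weight_ser k y"
proof -
  have "tau (weight_ser k y) = (\<Sum>i\<in>UNIV. sconst (y i) * (sconst k * (2 * svar * tvar - 2 * tvar\<^sup>2 * sconst (y i)) * qpow 1 (y i)))
     * weight_ser k y"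
    unfolding weight_ser_def
    by (rule derivation_prod[OF tau_mult tau_1]) (simp add: tau_qpow qpow_dy_eq mult_ac del: fps_const_mult)
  also have "(\<Sum>i\<in>UNIV. sconst (y i) * (sconst k * (2 * svar * tvar - 2 * tvar\<^sup>2 * sconst (y i)) * qpow 1 (y i)))
     = 2 * svar * tvar * pole_sum k 1 y - 2 * tvar\<^sup>2 * pole_sum k 2 y"
    by (simp add: pole_sum_def sum_distrib_left sum_subtractf algebra_simps power2_eq_square
        del: fps_const_mult fps_const_power)
  finally show ?thesis .
qed

lemma dS_weight: "dS (weight_ser k y) = (2 * tvar * pole_sum k 1 y) * weight_ser k y"
proof -
  have "dS (weight_ser k y) = (\<Sum>i\<in>UNIV. sconst k * (2 * tvar * sconst (y i)) * qpow 1 (y i)) * weight_ser k y"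
    unfolding weight_ser_def
    by (rule derivation_prod[OF dS_mult dS_1]) (simp add: dS_qpow mult_ac del: fps_const_mult)
  also have "(\<Sum>i\<in>UNIV. sconst k * (2 * tvar * sconst (y i)) * qpow 1 (y i)) = 2 * tvar * pole_sum k 1 y"
    by (simp add: pole_sum_def sum_distrib_left algebra_simps del: fps_const_mult fps_const_power)
  finally show ?thesis .
qed

lemma qpow_1_alt: "(1 - 2 * svar * tvar * sconst y + tvar\<^sup>2 * (sconst y)\<^sup>2) * qpow 1 y = 1"
  using qpow_1[of y] by (simp only: quad_def)

lemma squares_nth: "squares x i = (x $ i)\<^sup>2"
  by (simp add: squares_def)

lemma squares_upd: "(squares x)(i := (x $ i)\<^sup>2) = squares x"
  by (simp add: squares_def fun_eq_iff)

lemma has_coeff_deriv_cong: "has_coeff_deriv F A h \<Longrightarrow> A = B \<Longrightarrow> has_coeff_deriv F B h"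
  by simp

lemma weight_ser_upd:
  "weight_ser k (y(i := c)) = qpow k c * (\<Prod>m\<in>UNIV - {i}. qpow k (y m))"
proof -
  have "(\<Prod>m\<in>UNIV - {i}. qpow k ((y(i := c)) m)) = (\<Prod>m\<in>UNIV - {i}. qpow k (y m))"
    by (rule prod.cong) auto
  then show ?thesis
    unfolding weight_ser_def by (subst prod.remove[of _ i]) auto
qed

lemma weight_ser_deriv:
  fixes x :: "real^'n::finite"
  shows "has_coeff_deriv (\<lambda>h. weight_ser k ((squares x)(i := (x $ i + h)\<^sup>2)))
    (sconst (2 * x $ i) * (sconst k * (2 * svar * tvar - 2 * tvar\<^sup>2 * sconst (squares x i))
       * qpow 1 (squares x i) * weight_ser k (squares x))) 0"
proof -
  have d: "((\<lambda>h. (x $ i + h)\<^sup>2) has_real_derivative 2 * x $ i) (at 0)"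
    by (auto intro!: derivative_eq_intros)
  have w: "weight_ser k (squares x) = qpow k ((x $ i)\<^sup>2) * (\<Prod>m\<in>UNIV - {i}. qpow k (squares x m))"
    using weight_ser_upd[of k "squares x" i "squares x i"]
    unfolding fun_upd_triv squares_nth[of x i] squares_upd .
  show ?thesis
    unfolding weight_ser_upd
    by (rule has_coeff_deriv_cong[OF has_coeff_deriv_mult[OF has_coeff_deriv_qpow[OF d] has_coeff_deriv_const]])
      (simp add: w qpow_dy_eq squares_nth squares_upd mult_ac del: fps_const_mult)
qed

lemma cancel_pole:
  fixes y w q I W e A B P :: "'a::idom"
  assumes "q * I = 1" "(y - w) * (I * W * e) = A * I - B * W"
  shows "(y - w) * (W * e * P) = A * P - B * (q * W * P)"
proof -
  have "(y - w) * (W * e * P) = (q * I) * ((y - w) * (W * e * P))" by (simp add: assms(1))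
  also have "\<dots> = q * P * ((y - w) * (I * W * e))" by (simp only: mult_ac)
  also have "\<dots> = A * P * (q * I) - B * (q * W * P)"
    unfolding assms(2) by (simp add: algebra_simps)
  finally show ?thesis by (simp add: assms(1))
qed

context planar
begin

abbreviation "Y1 y \<equiv> sconst (y i1)"
abbreviation "Y2 y \<equiv> sconst (y i2)"
abbreviation "I1 y \<equiv> qpow 1 (y i1)"
abbreviation "I2 y \<equiv> qpow 1 (y i2)"
abbreviation "pole \<equiv> pole_ser k i1 i2"

lemma rational: "rational_identities svar tvar (Y1 y) (Y2 y) (I1 y) (I2 y)
   (pole_sum k 0 y) (pole_sum k 1 y) (pole_sum k 2 y) (sconst (k * real CARD('n)))"
  by unfold_locales (rule qpow_1_alt qpow_1_alt pole_sum_rel)+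

lemma pole_sum_off:
  "sconst k * (\<Sum>j\<in>UNIV - {i1} - {i2}. sconst (y j) ^ r * qpow 1 (y j))
     = pole_sum k r y - sconst k * (Y1 y ^ r * I1 y + Y2 y ^ r * I2 y)"
proof -
  have "(\<Sum>j\<in>UNIV. sconst (y j) ^ r * qpow 1 (y j)) = Y1 y ^ r * I1 y + (Y2 y ^ r * I2 y
      + (\<Sum>j\<in>UNIV - {i1} - {i2}. sconst (y j) ^ r * qpow 1 (y j)))"
    using i12 by (subst sum.remove[of _ i1], simp, simp, subst sum.remove[of _ i2]) auto
  then show ?thesis unfolding pole_sum_def by (simp only: distrib_left) simp
qed

lemma pole_deriv_i1:
  "has_coeff_deriv (\<lambda>h. pole ((squares x)(i1 := (x $ i1 + h)\<^sup>2)))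
    (sconst (2 * x $ i1) * ((sconst k + 1) * (2 * svar * tvar - 2 * tvar\<^sup>2 * Y1 (squares x))
       * I1 (squares x) * pole (squares x))) 0"
proof -
  have d: "((\<lambda>h. (x $ i1 + h)\<^sup>2) has_real_derivative 2 * x $ i1) (at 0)"
    by (auto intro!: derivative_eq_intros)
  show ?thesis
    unfolding pole_ser_def using i12
    by simp (rule has_coeff_deriv_cong[OF has_coeff_deriv_mult[OF has_coeff_deriv_mult[OF
          has_coeff_deriv_qpow[OF d] has_coeff_deriv_const] weight_ser_deriv]],
        simp add: qpow_dy_eq squares_nth squares_upd algebra_simps sconst_hom del: fps_const_mult)
qed

lemma pole_deriv_off:
  assumes "i \<noteq> i1" "i \<noteq> i2"
  shows "has_coeff_deriv (\<lambda>h. pole ((squares x)(i := (x $ i + h)\<^sup>2)))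
    (sconst (2 * x $ i) * (sconst k * (2 * svar * tvar - 2 * tvar\<^sup>2 * sconst (squares x i))
       * qpow 1 (squares x i) * pole (squares x))) 0"
  unfolding pole_ser_def using assms
  by simp (rule has_coeff_deriv_cong[OF has_coeff_deriv_mult[OF has_coeff_deriv_const weight_ser_deriv]],
      simp add: squares_nth squares_upd algebra_simps del: fps_const_mult)

lemma pole_swap:
  assumes "j \<noteq> i1" "j \<noteq> i2"
  shows "pole (y(i1 := y j, j := y i1)) = quad (y i1) * qpow 1 (y j) * pole y"
    and "pole (y(i2 := y j, j := y i2)) = quad (y i2) * qpow 1 (y j) * pole y"
proof -
  have "quad (y i1) * qpow 1 (y j) * pole y = (quad (y i1) * I1 y) * (qpow 1 (y j) * I2 y * weight_ser k y)"
    by (simp only: pole_ser_def mult_ac)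
  also have "\<dots> = pole (y(i1 := y j, j := y i1))"
    using assms i12 by (simp add: qpow_1 pole_ser_def weight_ser_swap)
  finally show "pole (y(i1 := y j, j := y i1)) = quad (y i1) * qpow 1 (y j) * pole y" by (rule sym)
  have "quad (y i2) * qpow 1 (y j) * pole y = (quad (y i2) * I2 y) * (I1 y * qpow 1 (y j) * weight_ser k y)"
    by (simp only: pole_ser_def mult_ac)
  also have "\<dots> = pole (y(i2 := y j, j := y i2))"
    using assms i12 by (simp add: qpow_1 pole_ser_def weight_ser_swap)
  finally show "pole (y(i2 := y j, j := y i2)) = quad (y i2) * qpow 1 (y j) * pole y" by (rule sym)
qed

text \<open>
  The difference quotient between a pole coordinate and a coordinate \<open>j\<close> that carries no pole, for a
  numerator \<open>al + be Y\<close> that is affine in the pole variable.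
\<close>

lemma pole_quotient:
  fixes al be P :: sts and a w :: real
  shows "(sconst a - sconst w) * (qpow 1 w * (be + 2 * svar * tvar * al - tvar\<^sup>2 * al * sconst a
       - tvar\<^sup>2 * (al + be * sconst a) * sconst w) * P)
     = (al + be * sconst a) * P - (al + be * sconst w) * (quad a * qpow 1 w * P)"
proof (rule cancel_pole[OF qpow_1])
  show "(sconst a - sconst w) * (qpow 1 a * qpow 1 w * (be + 2 * svar * tvar * al - tvar\<^sup>2 * al * sconst a
       - tvar\<^sup>2 * (al + be * sconst a) * sconst w))
     = (al + be * sconst a) * qpow 1 a - (al + be * sconst w) * qpow 1 w"
    by (rule swap_quotient_identity[OF qpow_1_alt qpow_1_alt])
qed

end

context planar
begin

abbreviation "D1c y \<equiv> rational_identities.D1_coeff svar tvar (Y1 y) (Y2 y) (I1 y) (I2 y)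
   (pole_sum k 0 y) (pole_sum k 1 y) (sconst k)"
abbreviation "R1c y \<equiv> rational_identities.R1_coeff svar tvar (Y1 y) (Y2 y) (I1 y) (I2 y)
   (pole_sum k 0 y) (pole_sum k 1 y) (sconst k)"

text \<open>
  \<open>T\<^sub>1\<close> on a function of the squares: the derivative and the difference quotients over all other
  coordinates are collected into the power sums \<open>pole_sum\<close>; only the quotient against the second pole
  coordinate has to be supplied, as \<open>B2\<close>.
\<close>

lemma dunkl_i1_affine:
  fixes al be B2 F :: "('n \<Rightarrow> real) \<Rightarrow> sts"
  assumes fam: "square_family al" "square_family be" "square_family B2"
    and indep: "\<And>y m c. m \<noteq> i2 \<Longrightarrow> al (y(m := c)) = al y" "\<And>y m c. m \<noteq> i2 \<Longrightarrow> be (y(m := c)) = be y"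
    and F: "\<And>y. F y = (al y + be y * Y1 y) * pole y"
    and B2: "\<And>y. (Y1 y - Y2 y) * (B2 y * pole y) = F y - F (y(i1 := y i2, i2 := y i1))"
  shows "dunkl k k1 i1 (family_coeff F n j) x
    = 2 * x $ i1 * coeff ((D1c (squares x) (al (squares x)) (be (squares x)) (B2 (squares x)) * pole (squares x)) $$ n) j"
proof -
  define D where "D y = (be y + (al y + be y * Y1 y) * ((sconst k + 1)
      * (2 * svar * tvar - 2 * tvar\<^sup>2 * Y1 y) * I1 y)) * pole y" for y
  define B where "B m y = (if m = i2 then B2 y * pole y else
     qpow 1 (y m) * (be y + 2 * svar * tvar * al y - tvar\<^sup>2 * al y * Y1 y
       - tvar\<^sup>2 * (al y + be y * Y1 y) * sconst (y m)) * pole y)" for m y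
  have famF: "square_family F"
    unfolding F by (intro poly_family_intros fam square_family_pole)
  have famB: "square_family (B m)" for m
    unfolding B_def by (cases "m = i2") (auto intro!: poly_family_intros fam square_family_pole)
  have der: "has_coeff_deriv (\<lambda>h. F ((squares x)(i1 := (x $ i1 + h)\<^sup>2))) (sconst (2 * x $ i1) * D (squares x)) 0" for x
  proof -
    have d: "((\<lambda>h. (x $ i1 + h)\<^sup>2) has_real_derivative 2 * x $ i1) (at 0)"
      by (auto intro!: derivative_eq_intros)
    have "F ((squares x)(i1 := (x $ i1 + h)\<^sup>2)) = (al (squares x) + be (squares x) * sconst ((x $ i1 + h)\<^sup>2))
        * pole ((squares x)(i1 := (x $ i1 + h)\<^sup>2))" for h
      unfolding F using i12 by (simp add: indep)
    then show ?thesis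
      by (simp only:) (rule has_coeff_deriv_cong[OF has_coeff_deriv_mult[OF has_coeff_deriv_add[OF
            has_coeff_deriv_const has_coeff_deriv_mult[OF has_coeff_deriv_const has_coeff_deriv_sconst[OF d]]]
            pole_deriv_i1]], simp add: D_def squares_upd squares_nth algebra_simps del: fps_const_mult)
  qed
  have quot: "(sconst (y i1) - sconst (y m)) * B m y = F y - F (y(i1 := y m, m := y i1))" if "m \<noteq> i1" for m y
  proof (cases "m = i2")
    case True
    then show ?thesis using B2[of y] by (simp add: B_def)
  next
    case False
    have "F (y(i1 := y m, m := y i1)) = (al y + be y * sconst (y m)) * (quad (y i1) * qpow 1 (y m) * pole y)"
      unfolding F pole_swap(1)[OF that False] using i12 that False by (simp add: indep)
    then show ?thesis
      using False by (simp only: B_def if_False pole_quotient F)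
  qed
  have sum: "sconst k * (\<Sum>m\<in>UNIV - {i1}. B m y) + D y = D1c y (al y) (be y) (B2 y) * pole y" for y
  proof -
    have "(\<Sum>m\<in>UNIV - {i1}. B m y) = B2 y * pole y + (\<Sum>m\<in>UNIV - {i1} - {i2}. B m y)"
      using i12 by (subst sum.remove[of _ i2]) (auto simp: B_def)
    also have "(\<Sum>m\<in>UNIV - {i1} - {i2}. B m y)
      = (be y + 2 * svar * tvar * al y - tvar\<^sup>2 * al y * Y1 y) * pole y
          * (\<Sum>m\<in>UNIV - {i1} - {i2}. sconst (y m) ^ 0 * qpow 1 (y m))
        - tvar\<^sup>2 * (al y + be y * Y1 y) * pole y * (\<Sum>m\<in>UNIV - {i1} - {i2}. sconst (y m) ^ 1 * qpow 1 (y m))"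
      unfolding sum_distrib_left sum_subtractf[symmetric]
      by (rule sum.cong) (auto simp: B_def algebra_simps simp del: fps_const_mult)
    finally have "sconst k * (\<Sum>m\<in>UNIV - {i1}. B m y) = sconst k * B2 y * pole y
      + (be y + 2 * svar * tvar * al y - tvar\<^sup>2 * al y * Y1 y) * pole y
          * (sconst k * (\<Sum>m\<in>UNIV - {i1} - {i2}. sconst (y m) ^ 0 * qpow 1 (y m)))
        - tvar\<^sup>2 * (al y + be y * Y1 y) * pole y
          * (sconst k * (\<Sum>m\<in>UNIV - {i1} - {i2}. sconst (y m) ^ 1 * qpow 1 (y m)))"
      by (simp only: distrib_left right_diff_distrib mult_ac add_ac) simp
    then show ?thesis
      unfolding pole_sum_off rational_identities.D1_coeff_def[OF rational] D_def
      by (simp only: power_0 power_one_right mult_1_left) (simp only: algebra_simps)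
  qed
  have "dunkl k k1 i1 (family_coeff F n j) x
    = 2 * x $ i1 * coeff ((D (squares x) + sconst k * (\<Sum>j\<in>UNIV - {i1}. B j (squares x))) $$ n) j"
    by (rule dunkl_square_family[OF famF famB der quot])
  then show ?thesis by (simp only: sum add.commute[of "D _"])
qed

lemma dunkl_i1_affine_odd:
  fixes al be B2 F :: "('n \<Rightarrow> real) \<Rightarrow> sts"
  assumes fam: "square_family al" "square_family be" "square_family B2"
    and indep: "\<And>y m c. m \<noteq> i2 \<Longrightarrow> al (y(m := c)) = al y" "\<And>y m c. m \<noteq> i2 \<Longrightarrow> be (y(m := c)) = be y"
    and F: "\<And>y. F y = (al y + be y * Y1 y) * pole y"
    and B2: "\<And>y. (Y1 y - Y2 y) * (B2 y * pole y) = F y - F (y(i1 := y i2, i2 := y i1))"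
    and sg: "\<And>y. F (y(i1 := y i2, i2 := y i1)) = sg * F y"
  shows "dunkl k k1 i1 (\<lambda>x. x $ i1 * family_coeff F n j x) x
    = coeff ((R1c (squares x) (al (squares x)) (be (squares x)) (B2 (squares x)) sg * pole (squares x)
        + sconst (1 + 2 * k1) * F (squares x)) $$ n) j"
proof -
  let ?y = "squares x"
  let ?f = "family_coeff F n j"
  have famF: "square_family F"
    unfolding F by (intro poly_family_intros fam square_family_pole)
  then have poly: "real_polynomial_function ?f" by (auto simp: poly_family_def)
  have sw: "F (y(i1 := y m, m := y i1)) = (al y + be y * sconst (y m)) * (quad (y i1) * qpow 1 (y m) * pole y)"
    if "m \<noteq> i1" "m \<noteq> i2" for m y
    unfolding F pole_swap(1)[OF that] using i12 that by (simp add: indep)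
  have S: "sconst k * (\<Sum>m\<in>UNIV - {i1}. F (y(i1 := y m, m := y i1)))
     = (quad (y i1) * (al y * (pole_sum k 0 y - sconst k * (I1 y + I2 y))
        + be y * (pole_sum k 1 y - sconst k * (Y1 y * I1 y + Y2 y * I2 y)))
        + sg * sconst k * (al y + be y * Y1 y)) * pole y" for y
  proof -
    have "(\<Sum>m\<in>UNIV - {i1}. F (y(i1 := y m, m := y i1)))
      = sg * F y + (\<Sum>m\<in>UNIV - {i1} - {i2}. F (y(i1 := y m, m := y i1)))"
      using i12 by (subst sum.remove[of _ i2]) (auto simp: sg)
    also have "(\<Sum>m\<in>UNIV - {i1} - {i2}. F (y(i1 := y m, m := y i1)))
      = quad (y i1) * al y * pole y * (\<Sum>m\<in>UNIV - {i1} - {i2}. sconst (y m) ^ 0 * qpow 1 (y m))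
       + quad (y i1) * be y * pole y * (\<Sum>m\<in>UNIV - {i1} - {i2}. sconst (y m) ^ 1 * qpow 1 (y m))"
      unfolding sum_distrib_left sum.distrib[symmetric]
      by (rule sum.cong) (auto simp: sw algebra_simps simp del: fps_const_mult)
    finally have "sconst k * (\<Sum>m\<in>UNIV - {i1}. F (y(i1 := y m, m := y i1))) = sg * sconst k * F y
       + quad (y i1) * al y * pole y * (sconst k * (\<Sum>m\<in>UNIV - {i1} - {i2}. sconst (y m) ^ 0 * qpow 1 (y m)))
       + quad (y i1) * be y * pole y * (sconst k * (\<Sum>m\<in>UNIV - {i1} - {i2}. sconst (y m) ^ 1 * qpow 1 (y m)))"
      by (simp only: distrib_left mult_ac add_ac)
    then show ?thesis
      unfolding pole_sum_off F
      by (simp only: power_0 power_one_right mult_1_left) (simp only: algebra_simps)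
  qed
  have "coord_comm k k1 i1 i1 ?f x = (1 + 2 * k1) * ?f x + 2 * (k * (\<Sum>m\<in>UNIV - {i1}. family_coeff F n j (refl_swap i1 m x)))"
    by (simp add: coord_comm_def squares_refl algebra_simps flip: sum_distrib_left)
  also have "k * (\<Sum>m\<in>UNIV - {i1}. family_coeff F n j (refl_swap i1 m x))
      = coeff ((sconst k * (\<Sum>m\<in>UNIV - {i1}. F (?y(i1 := ?y m, m := ?y i1)))) $$ n) j"
    by (simp only: coeff_sconst_mult coeff_nth_sum squares_refl)
  finally have cc: "coord_comm k k1 i1 i1 ?f x = coeff ((sconst (1 + 2 * k1) * F ?y + sconst 2 *
      (sconst k * (\<Sum>m\<in>UNIV - {i1}. F (?y(i1 := ?y m, m := ?y i1))))) $$ n) j"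
    by (simp only: fps_add_nth coeff_add coeff_sconst_mult)
  have "dunkl k k1 i1 (\<lambda>x. x $ i1 * ?f x) x = x $ i1 * dunkl k k1 i1 ?f x + coord_comm k k1 i1 i1 ?f x"
    by (simp only: dunkl_coord[OF poly])
  also have "x $ i1 * dunkl k k1 i1 ?f x = 2 * (?y i1 * coeff ((D1c ?y (al ?y) (be ?y) (B2 ?y) * pole ?y) $$ n) j)"
  proof -
    have T: "dunkl k k1 i1 ?f x = 2 * x $ i1 * coeff ((D1c ?y (al ?y) (be ?y) (B2 ?y) * pole ?y) $$ n) j"
      by (rule dunkl_i1_affine[OF fam indep F B2])
    show ?thesis
      unfolding T unfolding squares_nth[of x i1] power2_eq_square by (simp only: mult_ac)
  qed
  also have "\<dots> = coeff ((sconst 2 * (Y1 ?y * (D1c ?y (al ?y) (be ?y) (B2 ?y) * pole ?y))) $$ n) j"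
    by (simp only: coeff_sconst_mult)
  finally have "dunkl k k1 i1 (\<lambda>x. x $ i1 * ?f x) x =
     coeff ((sconst 2 * (Y1 ?y * (D1c ?y (al ?y) (be ?y) (B2 ?y) * pole ?y)) + (sconst (1 + 2 * k1) * F ?y + sconst 2 *
      (sconst k * (\<Sum>m\<in>UNIV - {i1}. F (?y(i1 := ?y m, m := ?y i1)))))) $$ n) j"
    unfolding cc by (simp only: fps_add_nth coeff_add)
  also have "sconst 2 * (Y1 ?y * (D1c ?y (al ?y) (be ?y) (B2 ?y) * pole ?y)) + (sconst (1 + 2 * k1) * F ?y + sconst 2 *
      (sconst k * (\<Sum>m\<in>UNIV - {i1}. F (?y(i1 := ?y m, m := ?y i1)))))
    = R1c ?y (al ?y) (be ?y) (B2 ?y) sg * pole ?y + sconst (1 + 2 * k1) * F ?y"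
    unfolding S rational_identities.R1_coeff_def[OF rational] sconst_hom(7) quad_def
    by (simp only: algebra_simps)
  finally show ?thesis .
qed

end

subsection \<open>Coefficientwise formulas\<close>

lemma coeff_tvar: "coeff ((tvar * A) $$ Suc n) j = coeff (A $$ n) j"
  by simp

lemma coeff_tau: "coeff (tau A $$ n) j = real n * coeff (A $$ n) j"
  by (simp add: of_nat_poly)

lemma coeff_dS: "coeff (dS A $$ n) j = real (Suc j) * coeff (A $$ n) (Suc j)"
  by (simp add: coeff_pderiv del: of_nat_Suc)

lemma coeff_svar_dS: "coeff ((svar * dS A) $$ n) j = real j * coeff (A $$ n) j"
  by (cases j) (simp_all add: coeff_pderiv del: of_nat_Suc)

lemma coeff_numeral: "coeff ((numeral w * (A :: sts)) $$ n) j = numeral w * coeff (A $$ n) j"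
  using coeff_sconst_mult[of "numeral w" A n j] by (simp only: sconst_hom)

lemma coeff_nth_add: "coeff ((A + B :: sts) $$ n) j = coeff (A $$ n) j + coeff (B $$ n) j"
  and coeff_nth_diff: "coeff ((A - B) $$ n) j = coeff (A $$ n) j - coeff (B $$ n) j"
  by simp_all

lemmas coeff_rules = coeff_tvar coeff_tau coeff_dS coeff_svar_dS coeff_numeral coeff_nth_add
  coeff_nth_diff coeff_sconst_mult

context planar
begin

abbreviation "F0 \<equiv> F0_ser k i1 i2"
abbreviation "F1 \<equiv> F1_ser k i1 i2"

lemma F0_num: "F0 y = rational_identities.num0 svar tvar (Y1 y) (Y2 y) * pole y"
  by (simp only: F0_ser_def rational_identities.num0_def[OF rational])

lemma F1_num: "F1 y = rational_identities.num1 tvar (Y1 y) (Y2 y) * pole y"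
  by (simp only: F1_ser_def rational_identities.num1_def[OF rational])

lemma tau_pole: "tau (pole y) = rational_identities.tauM svar tvar (Y1 y) (Y2 y) (I1 y) (I2 y)
    (pole_sum k 1 y) (pole_sum k 2 y) * pole y"
  unfolding pole_ser_def tau_mult tau_weight tau_qpow qpow_dy_eq sconst_hom(5)
    rational_identities.tauM_def[OF rational]
  by (simp only: algebra_simps mult_1_left)

lemma dS_pole: "dS (pole y) = rational_identities.dSM tvar (Y1 y) (Y2 y) (I1 y) (I2 y)
    (pole_sum k 1 y) * pole y"
  unfolding pole_ser_def dS_mult dS_weight dS_qpow sconst_hom(5)
    rational_identities.dSM_def[OF rational]
  by (simp only: algebra_simps mult_1_left)

lemma tau_t2: "tau (tvar\<^sup>2) = 2 * tvar\<^sup>2"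
  by (simp add: power2_eq_square tau_mult tau_X)

lemma dS_t2: "dS (tvar\<^sup>2) = 0"
  by (simp add: power2_eq_square dS_mult dS_X)

lemma tau_F:
  "tau (F0 y) = rational_identities.tau_num0 svar tvar (Y1 y) (Y2 y) (I1 y) (I2 y)
     (pole_sum k 1 y) (pole_sum k 2 y) * pole y"
  "tau (F1 y) = rational_identities.tau_num1 svar tvar (Y1 y) (Y2 y) (I1 y) (I2 y)
     (pole_sum k 1 y) (pole_sum k 2 y) * pole y"
  unfolding F0_ser_def F1_ser_def rational_identities.tau_num0_def[OF rational]
    rational_identities.tau_num1_def[OF rational]
    rational_identities.num0_def[OF rational] rational_identities.num1_def[OF rational]
    tau_mult tau_add tau_diff tau_pole tau_t2 tau_X tau_svar tau_const tau_1
  by (simp_all only: algebra_simps mult_zero_left mult_zero_right add_0_left add_0_right)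

lemma dS_F:
  "dS (F0 y) = rational_identities.dS_num0 svar tvar (Y1 y) (Y2 y) (I1 y) (I2 y)
     (pole_sum k 1 y) * pole y"
  "dS (F1 y) = rational_identities.dS_num1 tvar (Y1 y) (Y2 y) (I1 y) (I2 y)
     (pole_sum k 1 y) * pole y"
  unfolding F0_ser_def F1_ser_def rational_identities.dS_num0_def[OF rational]
    rational_identities.dS_num1_def[OF rational]
    rational_identities.num0_def[OF rational] rational_identities.num1_def[OF rational]
    dS_mult dS_add dS_diff dS_pole dS_t2 dS_X dS_svar dS_const dS_1
  by (simp_all add: algebra_simps del: fps_const_mult fps_const_add fps_const_sub)

lemma affine_F:
  "F0 y = ((1 - svar * tvar * Y2 y) + (tvar\<^sup>2 * Y2 y - svar * tvar) * Y1 y) * pole y"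
  "F1 y = ((- tvar * Y2 y) + tvar * Y1 y) * pole y"
  by (simp_all add: F0_ser_def F1_ser_def algebra_simps del: fps_const_mult fps_const_add fps_const_sub)

lemma affine_families:
  "square_family (\<lambda>y. 1 - svar * tvar * Y2 y)" "square_family (\<lambda>y. tvar\<^sup>2 * Y2 y - svar * tvar)"
  "square_family (\<lambda>y. - tvar * Y2 y)"
  by (intro poly_family_intros)+

lemma F_quot12:
  "(Y1 y - Y2 y) * (0 * pole y) = F0 y - F0 (y(i1 := y i2, i2 := y i1))"
  "(Y1 y - Y2 y) * ((2 * tvar) * pole y) = F1 y - F1 (y(i1 := y i2, i2 := y i1))"
  unfolding F_ser_sym[OF i12] by (simp_all add: F1_ser_def algebra_simps del: fps_const_mult fps_const_sub)

lemma dunkl_F0_series: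
  "dunkl k k1 i1 (family_coeff F0 n j) x = x $ i1 * coeff ((let A = F0 (squares x); B = F1 (squares x) in
      svar * (tvar * (tau A + svar * dS A + sconst (2 + 2 * (k * real CARD('n))) * A))
      + svar * (svar * (tvar * (tau B + svar * dS B + sconst (3 + 2 * (k * real CARD('n))) * B)))
      - tvar * dS A - tvar * (tau B + svar * dS B + sconst (2 + 2 * (k * real CARD('n)) - 2 * k) * B)) $$ n) j"
proof -
  let ?y = "squares x"
  have "dunkl k k1 i1 (family_coeff F0 n j) x = 2 * x $ i1 * coeff ((D1c ?y (1 - svar * tvar * Y2 ?y)
     (tvar\<^sup>2 * Y2 ?y - svar * tvar) 0 * pole ?y) $$ n) j"
    using i12 by (intro dunkl_i1_affine[of "\<lambda>y. 1 - svar * tvar * Y2 y" "\<lambda>y. tvar\<^sup>2 * Y2 y - svar * tvar" "\<lambda>y. 0"]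
        affine_families affine_F poly_family_const F_quot12) simp_all
  also have "\<dots> = x $ i1 * coeff (((2 * D1c ?y (1 - svar * tvar * Y2 ?y)
     (tvar\<^sup>2 * Y2 ?y - svar * tvar) 0) * pole ?y) $$ n) j"
    by (simp only: mult.assoc coeff_numeral)
  also have "(2 * D1c ?y (1 - svar * tvar * Y2 ?y) (tvar\<^sup>2 * Y2 ?y - svar * tvar) 0) * pole ?y = (let A = F0 ?y; B = F1 ?y in
      svar * (tvar * (tau A + svar * dS A + sconst (2 + 2 * (k * real CARD('n))) * A))
      + svar * (svar * (tvar * (tau B + svar * dS B + sconst (3 + 2 * (k * real CARD('n))) * B)))
      - tvar * dS A - tvar * (tau B + svar * dS B + sconst (2 + 2 * (k * real CARD('n)) - 2 * k) * B))"
    unfolding rational_identities.D1_num0[OF rational] Let_def tau_F dS_F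
    unfolding F0_num F1_num sconst_hom
    by (simp only: algebra_simps power2_eq_square mult_1_left mult_1_right)
  finally show ?thesis .
qed

lemma dunkl_F1_series:
  "dunkl k k1 i1 (family_coeff F1 n j) x = x $ i1 * coeff ((let A = F0 (squares x); B = F1 (squares x) in
      tvar * (tau A + svar * dS A + sconst (2 + 2 * (k * real CARD('n))) * A)
      + svar * (tvar * (tau B + svar * dS B + sconst (3 + 2 * (k * real CARD('n))) * B)) - tvar * dS B) $$ n) j"
proof -
  let ?y = "squares x"
  have "dunkl k k1 i1 (family_coeff F1 n j) x = 2 * x $ i1 * coeff ((D1c ?y (- tvar * Y2 ?y)
     tvar (2 * tvar) * pole ?y) $$ n) j"
    using i12 by (intro dunkl_i1_affine[of "\<lambda>y. - tvar * Y2 y" "\<lambda>y. tvar" "\<lambda>y. 2 * tvar"]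
        affine_families affine_F poly_family_const F_quot12) simp_all
  also have "\<dots> = x $ i1 * coeff (((2 * D1c ?y (- tvar * Y2 ?y) tvar (2 * tvar)) * pole ?y) $$ n) j"
    by (simp only: mult.assoc coeff_numeral)
  also have "(2 * D1c ?y (- tvar * Y2 ?y) tvar (2 * tvar)) * pole ?y = (let A = F0 ?y; B = F1 ?y in
      tvar * (tau A + svar * dS A + sconst (2 + 2 * (k * real CARD('n))) * A)
      + svar * (tvar * (tau B + svar * dS B + sconst (3 + 2 * (k * real CARD('n))) * B)) - tvar * dS B)"
    unfolding rational_identities.D1_num1[OF rational] Let_def tau_F dS_F
    unfolding F0_num F1_num sconst_hom
    by (simp only: algebra_simps power2_eq_square mult_1_left mult_1_right)
  finally show ?thesis .
qed

lemma dunkl_x1_F0_series: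
  "dunkl k k1 i1 (\<lambda>x. x $ i1 * family_coeff F0 n j x) x = coeff ((let A = F0 (squares x); B = F1 (squares x) in
      tau A + sconst (2 * (k * real CARD('n)) - 2 * k + 1 + 2 * k1) * A + sconst (1 + 2 * k) * (svar * B)
      - dS B + svar * (svar * dS B)) $$ n) j"
proof -
  let ?y = "squares x"
  have "dunkl k k1 i1 (\<lambda>x. x $ i1 * family_coeff F0 n j x) x = coeff ((R1c ?y (1 - svar * tvar * Y2 ?y)
     (tvar\<^sup>2 * Y2 ?y - svar * tvar) 0 1 * pole ?y + sconst (1 + 2 * k1) * F0 ?y) $$ n) j"
    using i12 by (intro dunkl_i1_affine_odd[of "\<lambda>y. 1 - svar * tvar * Y2 y" "\<lambda>y. tvar\<^sup>2 * Y2 y - svar * tvar" "\<lambda>y. 0"]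
        affine_families affine_F poly_family_const F_quot12 F_ser_sym(1)[OF i12, THEN trans]) simp_all
  also have "R1c ?y (1 - svar * tvar * Y2 ?y) (tvar\<^sup>2 * Y2 ?y - svar * tvar) 0 1 * pole ?y + sconst (1 + 2 * k1) * F0 ?y = (let A = F0 ?y; B = F1 ?y in
      tau A + sconst (2 * (k * real CARD('n)) - 2 * k + 1 + 2 * k1) * A + sconst (1 + 2 * k) * (svar * B)
      - dS B + svar * (svar * dS B))"
    unfolding rational_identities.R1_num0[OF rational] Let_def tau_F dS_F
    unfolding F0_num F1_num sconst_hom
    by (simp only: algebra_simps power2_eq_square mult_1_left mult_1_right)
  finally show ?thesis .
qed

lemma dunkl_x1_F1_series:
  "dunkl k k1 i1 (\<lambda>x. x $ i1 * family_coeff F1 n j x) x = coeff ((let A = F0 (squares x); B = F1 (squares x) in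
      dS A + tau B + sconst (2 * (k * real CARD('n)) - 4 * k + 1 + 2 * k1) * B) $$ n) j"
proof -
  let ?y = "squares x"
  have "dunkl k k1 i1 (\<lambda>x. x $ i1 * family_coeff F1 n j x) x = coeff ((R1c ?y (- tvar * Y2 ?y)
     tvar (2 * tvar) (-1) * pole ?y + sconst (1 + 2 * k1) * F1 ?y) $$ n) j"
    using i12 by (intro dunkl_i1_affine_odd[of "\<lambda>y. - tvar * Y2 y" "\<lambda>y. tvar" "\<lambda>y. 2 * tvar"]
        affine_families affine_F poly_family_const F_quot12 F_ser_sym(2)[OF i12, THEN trans]) simp_all
  also have "R1c ?y (- tvar * Y2 ?y) tvar (2 * tvar) (-1) * pole ?y + sconst (1 + 2 * k1) * F1 ?y = (let A = F0 ?y; B = F1 ?y in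
      dS A + tau B + sconst (2 * (k * real CARD('n)) - 4 * k + 1 + 2 * k1) * B)"
    unfolding rational_identities.R1_num1[OF rational] Let_def tau_F dS_F
    unfolding F0_num F1_num sconst_hom
    by (simp only: algebra_simps power2_eq_square mult_1_left mult_1_right)
  finally show ?thesis .
qed

lemma dunkl_a:
  "dunkl k k1 i1 (family_coeff F0 (Suc n) j) x = x $ i1 *
    ((real n + real j + 1 + 2 * (k * real CARD('n))) * (coeff (pCons 0 (F0 (squares x) $$ n)) j
        + coeff (pCons 0 (pCons 0 (F1 (squares x) $$ n))) j)
     - (real j + 1) * coeff (F0 (squares x) $$ n) (Suc j)
     - (real n + real j + 2 + 2 * (k * real CARD('n)) - 2 * k) * coeff (F1 (squares x) $$ n) j)"
proof -
  have 1: "coeff ((svar * A) $$ m) j = (case j of 0 \<Rightarrow> 0 | Suc i \<Rightarrow> coeff (A $$ m) i)" for A m j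
    by (cases j) simp_all
  show ?thesis
    unfolding dunkl_F0_series Let_def coeff_rules
    unfolding 1 coeff_rules
    unfolding 1 coeff_rules
    by (cases j; cases "j - 1") (simp_all add: algebra_simps split: nat.split)
qed

lemma dunkl_b:
  "dunkl k k1 i1 (family_coeff F1 (Suc n) j) x = x $ i1 *
    ((real n + real j + 2 + 2 * (k * real CARD('n))) * (coeff (F0 (squares x) $$ n) j + coeff (pCons 0 (F1 (squares x) $$ n)) j)
     - (real j + 1) * coeff (F1 (squares x) $$ n) (Suc j))"
proof -
  have 1: "coeff ((svar * A) $$ m) j = (case j of 0 \<Rightarrow> 0 | Suc i \<Rightarrow> coeff (A $$ m) i)" for A m j
    by (cases j) simp_all
  show ?thesis
    unfolding dunkl_F1_series Let_def coeff_rules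
    unfolding 1 coeff_rules
    by (cases j) (simp_all add: algebra_simps split: nat.split)
qed

lemma dunkl_x1_a:
  "dunkl k k1 i1 (\<lambda>x. x $ i1 * family_coeff F0 n j x) x =
     (real n + 2 * (k * real CARD('n)) - 2 * k + 1 + 2 * k1) * coeff (F0 (squares x) $$ n) j
     + (real j + 2 * k) * coeff (pCons 0 (F1 (squares x) $$ n)) j
     - (real j + 1) * coeff (F1 (squares x) $$ n) (Suc j)"
proof -
  have 1: "coeff ((svar * A) $$ m) j = (case j of 0 \<Rightarrow> 0 | Suc i \<Rightarrow> coeff (A $$ m) i)" for A m j
    by (cases j) simp_all
  show ?thesis
    unfolding dunkl_x1_F0_series Let_def coeff_rules
    unfolding 1 coeff_rules
    by (cases j) (simp_all add: algebra_simps split: nat.split)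
qed

lemma dunkl_x1_b:
  "dunkl k k1 i1 (\<lambda>x. x $ i1 * family_coeff F1 n j x) x =
     (real j + 1) * coeff (F0 (squares x) $$ n) (Suc j)
     + (real n + 2 * (k * real CARD('n)) - 4 * k + 1 + 2 * k1) * coeff (F1 (squares x) $$ n) j"
  unfolding dunkl_x1_F1_series Let_def coeff_rules by (simp add: algebra_simps)

subsection \<open>The operators without a pole coordinate\<close>

text \<open>
  For a coordinate \<open>i\<close> without a pole, \<open>T\<^sub>i\<close> sees the derivative of the weight and the exchanges with
  the two pole coordinates, all other exchanges leaving the function fixed.  Reading the numerator as
  affine in either pole variable makes both quotients explicit, and \<open>bal\<close> says that they compensate the
  derivative.
\<close>

lemma dunkl_off_affine:
  fixes al1 be1 al2 be2 F :: "('n \<Rightarrow> real) \<Rightarrow> sts"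
  assumes i: "i \<noteq> i1" "i \<noteq> i2"
    and fam: "square_family al1" "square_family be1" "square_family al2" "square_family be2"
    and indep1: "\<And>y m c. m \<noteq> i2 \<Longrightarrow> al1 (y(m := c)) = al1 y" "\<And>y m c. m \<noteq> i2 \<Longrightarrow> be1 (y(m := c)) = be1 y"
    and indep2: "\<And>y m c. m \<noteq> i1 \<Longrightarrow> al2 (y(m := c)) = al2 y" "\<And>y m c. m \<noteq> i1 \<Longrightarrow> be2 (y(m := c)) = be2 y"
    and F: "\<And>y. F y = (al1 y + be1 y * Y1 y) * pole y"
    and num: "\<And>y. al1 y + be1 y * Y1 y = al2 y + be2 y * Y2 y"
    and bal: "\<And>y. 2 * svar * tvar * (al1 y + be1 y * Y1 y)
      = (be1 y + 2 * svar * tvar * al1 y - tvar\<^sup>2 * al1 y * Y1 y)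
        + (be2 y + 2 * svar * tvar * al2 y - tvar\<^sup>2 * al2 y * Y2 y)"
  shows "dunkl k k1 i (family_coeff F n j) = (\<lambda>x. 0)"
proof
  fix x
  have F2: "F y = (al2 y + be2 y * Y2 y) * pole y" for y by (simp only: F num)
  define e1 where "e1 y = qpow 1 (y i) * (be1 y + 2 * svar * tvar * al1 y - tvar\<^sup>2 * al1 y * Y1 y
       - tvar\<^sup>2 * (al1 y + be1 y * Y1 y) * sconst (y i)) * pole y" for y
  define e2 where "e2 y = qpow 1 (y i) * (be2 y + 2 * svar * tvar * al2 y - tvar\<^sup>2 * al2 y * Y2 y
       - tvar\<^sup>2 * (al2 y + be2 y * Y2 y) * sconst (y i)) * pole y" for y
  define D where "D y = (al1 y + be1 y * Y1 y) * (sconst k * (2 * svar * tvar - 2 * tvar\<^sup>2 * sconst (y i))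
       * qpow 1 (y i) * pole y)" for y
  define B where "B m y = (if m = i1 then - e1 y else if m = i2 then - e2 y else 0)" for m y
  have famF: "square_family F"
    unfolding F by (intro poly_family_intros fam square_family_pole)
  have neg: "poly_family (\<lambda>x. - G (squares x))" if "square_family G" for G :: "('n \<Rightarrow> real) \<Rightarrow> sts"
    using poly_family_diff[OF poly_family_const[of 0] that] by simp
  have "square_family e1" "square_family e2"
    unfolding e1_def e2_def by (intro poly_family_intros fam square_family_pole)+
  then have famB: "square_family (B m)" for m
    unfolding B_def by (cases "m = i1"; cases "m = i2") (auto intro: neg poly_family_const)
  have der: "has_coeff_deriv (\<lambda>h. F ((squares x)(i := (x $ i + h)\<^sup>2))) (sconst (2 * x $ i) * D (squares x)) 0" for x
  proof -
    have "F ((squares x)(i := (x $ i + h)\<^sup>2)) = (al1 (squares x) + be1 (squares x) * Y1 (squares x))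
        * pole ((squares x)(i := (x $ i + h)\<^sup>2))" for h
      unfolding F using i by (simp add: indep1)
    then show ?thesis
      by (simp only:) (rule has_coeff_deriv_cong[OF has_coeff_deriv_mult[OF has_coeff_deriv_const pole_deriv_off[OF i]]],
        simp add: D_def mult_ac del: fps_const_mult)
  qed
  have quot: "(sconst (y i) - sconst (y m)) * B m y = F y - F (y(i := y m, m := y i))" if "m \<noteq> i" for m y
  proof -
    consider "m = i1" | "m = i2" "m \<noteq> i1" | "m \<noteq> i1" "m \<noteq> i2" by blast
    then show ?thesis
    proof cases
      case 1
      have tw: "y(i := y m, m := y i) = y(i1 := y i, i := y i1)"
        using 1 i by (auto simp: fun_eq_iff)
      have "F (y(i1 := y i, i := y i1)) = (al1 y + be1 y * sconst (y i)) * (quad (y i1) * qpow 1 (y i) * pole y)"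
        unfolding F pole_swap(1)[OF i] using i12 i by (simp add: indep1)
      then have "F y - F (y(i := y m, m := y i)) = (Y1 y - sconst (y i)) * e1 y"
        unfolding tw e1_def by (simp only: pole_quotient F)
      then show ?thesis using 1 by (simp add: B_def algebra_simps del: fps_const_sub)
    next
      case 2
      have tw: "y(i := y m, m := y i) = y(i2 := y i, i := y i2)"
        using 2 i by (auto simp: fun_eq_iff)
      have "F (y(i2 := y i, i := y i2)) = (al2 y + be2 y * sconst (y i)) * (quad (y i2) * qpow 1 (y i) * pole y)"
        unfolding F2 pole_swap(2)[OF i] using i12 i by (simp add: indep2)
      then have "F y - F (y(i := y m, m := y i)) = (Y2 y - sconst (y i)) * e2 y"
        unfolding tw e2_def by (simp only: pole_quotient F2)
      then show ?thesis using 2 by (simp add: B_def algebra_simps del: fps_const_sub)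
    next
      case 3
      have "F (y(i := y m, m := y i)) = F y"
        unfolding F pole_ser_def using 3 i that by (simp add: indep1 weight_ser_swap)
      then show ?thesis using 3 by (simp add: B_def)
    qed
  qed
  have "(\<Sum>m\<in>UNIV - {i}. B m y) = (\<Sum>m\<in>{i1, i2}. B m y)" for y
    using i by (intro sum.mono_neutral_right) (auto simp: B_def)
  then have sum: "(\<Sum>m\<in>UNIV - {i}. B m y) = - e1 y - e2 y" for y
    using i12 by (simp add: B_def)
  have zero: "D y + sconst k * (- e1 y - e2 y) = 0" for y
  proof -
    have "D y + sconst k * (- e1 y - e2 y) = sconst k * qpow 1 (y i) * pole y *
      (2 * svar * tvar * (al1 y + be1 y * Y1 y)
      - ((be1 y + 2 * svar * tvar * al1 y - tvar\<^sup>2 * al1 y * Y1 y)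
        + (be2 y + 2 * svar * tvar * al2 y - tvar\<^sup>2 * al2 y * Y2 y)))"
      unfolding D_def e1_def e2_def num[symmetric] by (simp add: algebra_simps del: fps_const_mult)
    then show ?thesis unfolding bal by simp
  qed
  have "dunkl k k1 i (family_coeff F n j) x
    = 2 * x $ i * coeff ((D (squares x) + sconst k * (\<Sum>m\<in>UNIV - {i}. B m (squares x))) $$ n) j"
    by (rule dunkl_square_family[OF famF famB der quot])
  then show "dunkl k k1 i (family_coeff F n j) x = 0" unfolding sum zero by simp
qed

lemma dunkl_off_F:
  assumes "i \<noteq> i1" "i \<noteq> i2"
  shows "dunkl k k1 i (family_coeff F0 n j) = (\<lambda>x. 0)" "dunkl k k1 i (family_coeff F1 n j) = (\<lambda>x. 0)"
proof -
  have fams: "square_family (\<lambda>y. 1 - svar * tvar * Y1 y)" "square_family (\<lambda>y. tvar\<^sup>2 * Y1 y - svar * tvar)"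
    "square_family (\<lambda>y. tvar * Y1 y)"
    by (intro poly_family_intros)+
  show "dunkl k k1 i (family_coeff F0 n j) = (\<lambda>x. 0)"
    by (rule dunkl_off_affine[OF assms affine_families(1,2) fams(1,2)])
      (simp_all add: affine_F(1) algebra_simps power2_eq_square del: fps_const_mult fps_const_add fps_const_sub)
  show "dunkl k k1 i (family_coeff F1 n j) = (\<lambda>x. 0)"
    by (rule dunkl_off_affine[OF assms affine_families(3) poly_family_const fams(3) poly_family_const, of tvar "- tvar"])
      (simp_all add: affine_F(2) algebra_simps power2_eq_square del: fps_const_mult fps_const_add fps_const_sub)
qed

end

section \<open>Expansion of the generating functions\<close>

definition rising_real :: "real \<Rightarrow> real fps" where
  "rising_real a = Abs_fps (\<lambda>r. pochhammer a r / fact r)"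

lemma fps_power_of_real:
  fixes W :: "real fps" and V :: "complex fps"
  assumes "\<And>n. fps_nth V n = of_real (fps_nth W n)"
  shows "fps_nth (V ^ i) n = of_real (fps_nth (W ^ i) n)"
  by (induction i arbitrary: n) (simp_all add: fps_mult_nth assms)

lemma eventually_sums_fps:
  fixes f :: "'a::{banach, real_normed_field} \<Rightarrow> 'a"
  assumes "f has_fps_expansion F"
  shows "\<forall>\<^sub>F z in nhds 0. (\<lambda>n. fps_nth F n * z ^ n) sums f z"
proof -
  have "\<forall>\<^sub>F z in nhds 0. z \<in> eball 0 (fps_conv_radius F)"
    using assms by (intro eventually_nhds_in_open) (auto simp: has_fps_expansion_def zero_ereal_def)
  moreover have "\<forall>\<^sub>F z in nhds 0. eval_fps F z = f z"
    using assms by (simp add: has_fps_expansion_def)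
  ultimately show ?thesis
  proof eventually_elim
    case (elim z)
    then show ?case using sums_eval_fps[of z F] by simp
  qed
qed

text \<open>
  A non-zero power series has no zeros in a punctured neighbourhood of the origin.
\<close>

lemma has_fps_expansion_unique:
  fixes f :: "'a::{banach, real_normed_field} \<Rightarrow> 'a"
  assumes "f has_fps_expansion F" "f has_fps_expansion G"
  shows "F = G"
proof (rule ccontr)
  assume "F \<noteq> G"
  define D where "D = F - G"
  then obtain m where m: "fps_nth D m \<noteq> 0" using \<open>F \<noteq> G\<close> by (auto simp: fps_eq_iff)
  have "(\<lambda>z. f z - f z) has_fps_expansion D"
    unfolding D_def by (intro has_fps_expansion_diff assms)
  then have "\<forall>\<^sub>F z in nhds 0. (\<lambda>n. fps_nth D n * z ^ n) sums 0"
    using eventually_sums_fps by fastforce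
  \<comment> \<open>The factor \<open>fps_X\<close> makes the constant coefficient vanish, as \<open>powser_0_nonzero\<close> requires.\<close>
  then have "\<forall>\<^sub>F z in nhds 0. (\<lambda>n. fps_nth (fps_X * D) n * z ^ n) sums 0"
  proof eventually_elim
    case (elim z)
    have "(\<lambda>n. fps_nth (fps_X * D) (Suc n) * z ^ Suc n) sums 0"
      using sums_mult[OF elim, of z] by (simp add: mult_ac)
    then show ?case using sums_Suc_iff[of "\<lambda>n. fps_nth (fps_X * D) n * z ^ n" 0] by simp
  qed
  then obtain r where r: "r > 0" "\<And>z. dist z 0 < r \<Longrightarrow> (\<lambda>n. fps_nth (fps_X * D) n * z ^ n) sums 0"
    unfolding eventually_nhds_metric by blast
  obtain s where s: "0 < s" "\<And>z::'a. z \<in> cball 0 s - {0} \<Longrightarrow> (0::'a) \<noteq> 0"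
  proof (rule powser_0_nonzero[of r 0 "\<lambda>n. fps_nth (fps_X * D) n" "\<lambda>z::'a. 0::'a" "Suc m"])
    show "\<And>x. norm (x - 0) < r \<Longrightarrow> (\<lambda>n. fps_nth (fps_X * D) n * (x - 0) ^ n) sums 0"
      using r(2) by (simp add: dist_norm)
  qed (use r(1) m in auto)
  have "of_real s \<in> cball (0::'a) s - {0}" using s(1) by simp
  with s(2) show False by blast
qed

lemma has_fps_expansion_of_real:
  fixes F :: "real fps"
  assumes g: "g has_fps_expansion Abs_fps (\<lambda>n. complex_of_real (fps_nth F n))"
    and fg: "\<forall>\<^sub>F t in nhds 0. g (complex_of_real t) = complex_of_real (f t)"
  shows "f has_fps_expansion F"
proof (rule has_fps_expansionI)
  let ?G = "Abs_fps (\<lambda>n. complex_of_real (fps_nth F n))"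
  have "\<forall>\<^sub>F z in nhds 0. (\<lambda>n. fps_nth ?G n * z ^ n) sums g z"
    by (rule eventually_sums_fps) (rule g)
  moreover have "filterlim complex_of_real (nhds 0) (nhds 0)"
  proof -
    have "(complex_of_real \<longlongrightarrow> complex_of_real 0) (nhds 0)"
      by (rule tendsto_of_real) (rule filterlim_ident)
    then show ?thesis by simp
  qed
  ultimately have "\<forall>\<^sub>F t in nhds 0. (\<lambda>n. fps_nth ?G n * complex_of_real t ^ n) sums g (complex_of_real t)"
    by (rule eventually_compose_filterlim)
  with fg show "\<forall>\<^sub>F t in nhds 0. (\<lambda>n. fps_nth F n * t ^ n) sums f t"
  proof eventually_elim
    case (elim t)
    then have "(\<lambda>n. complex_of_real (fps_nth F n * t ^ n)) sums complex_of_real (f t)" by simp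
    then show ?case by (simp only: sums_of_real_iff)
  qed
qed

text \<open>
  The binomial expansion of the complex power function, restricted to real arguments.
\<close>

lemma has_fps_expansion_quadratic_powr:
  fixes a b c :: real
  shows "(\<lambda>t. (1 - (b * t - c * t\<^sup>2)) powr (- a)) has_fps_expansion
    (rising_real a oo (fps_const b * fps_X - fps_const c * fps_X\<^sup>2))"
proof (rule has_fps_expansion_of_real)
  let ?W = "fps_const b * fps_X - fps_const c * fps_X\<^sup>2 :: real fps"
  let ?V = "- (fps_const (of_real b) * fps_X - fps_const (of_real c) * fps_X\<^sup>2) :: complex fps"
  let ?g = "\<lambda>z::complex. - (of_real b * z - of_real c * z\<^sup>2)"
  have "?g has_fps_expansion ?V"
    by (intro fps_expansion_intros)
  moreover have "(\<lambda>z::complex. (1 + z) powr (- of_real a)) has_fps_expansion fps_binomial (- of_real a)"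
    by (rule has_fps_expansion_binomial_complex)
  ultimately have "((\<lambda>z::complex. (1 + z) powr (- of_real a)) \<circ> ?g) has_fps_expansion
      (fps_binomial (- of_real a) oo ?V)"
    by (intro has_fps_expansion_compose) (auto simp: fps_X_power_nth)
  moreover have "fps_binomial (- of_real a) oo ?V
      = Abs_fps (\<lambda>n. complex_of_real (fps_nth (rising_real a oo ?W) n))"
  proof (rule fps_ext)
    fix n
    have 1: "fps_nth (?V ^ i) n = of_real ((-1) ^ i * fps_nth (?W ^ i) n)" for i
    proof -
      have "fps_nth (?V ^ i) n = of_real (fps_nth ((- ?W) ^ i) n)"
        by (rule fps_power_of_real) (simp add: fps_X_power_nth)
      also have "(- ?W) ^ i = fps_const ((-1) ^ i) * ?W ^ i"
        by (metis fps_const_neg fps_const_1_eq_1 fps_const_power mult_minus1 power_mult_distrib)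
      finally show ?thesis by simp
    qed
    have 2: "(- complex_of_real a gchoose i) = of_real ((-1) ^ i * (pochhammer a i / fact i))" for i
      by (simp add: gbinomial_pochhammer pochhammer_of_real)
    have sq: "(-1) ^ i * ((-1) ^ i * u) = u" for i and u :: real
      by (cases "even i") auto
    show "fps_nth (fps_binomial (- of_real a) oo ?V) n
      = fps_nth (Abs_fps (\<lambda>n. complex_of_real (fps_nth (rising_real a oo ?W) n))) n"
      unfolding fps_compose_nth fps_nth_Abs_fps fps_binomial_nth 1 2 of_real_mult[symmetric] of_real_sum[symmetric]
      by (intro arg_cong[of _ _ complex_of_real] sum.cong)
        (auto simp: rising_real_def mult_ac sq)
  qed
  ultimately show "((\<lambda>z::complex. (1 + z) powr (- of_real a)) \<circ> ?g) has_fps_expansion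
     Abs_fps (\<lambda>n. complex_of_real (fps_nth (rising_real a oo ?W) n))" by simp
  have "((\<lambda>t. 1 - (b * t - c * t\<^sup>2)) \<longlongrightarrow> 1 - (b * 0 - c * 0\<^sup>2)) (nhds 0)"
    by (intro tendsto_intros filterlim_ident)
  then have "\<forall>\<^sub>F t in nhds 0. 1 - (b * t - c * t\<^sup>2) > 0"
    by (rule order_tendstoD) simp
  then show "\<forall>\<^sub>F t in nhds 0. ((\<lambda>z::complex. (1 + z) powr (- of_real a)) \<circ> ?g) (complex_of_real t)
      = complex_of_real ((1 - (b * t - c * t\<^sup>2)) powr - a)"
  proof eventually_elim
    case (elim t)
    have "complex_of_real ((1 - (b * t - c * t\<^sup>2)) powr - a)
      = complex_of_real (1 - (b * t - c * t\<^sup>2)) powr (complex_of_real (- a))"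
      using elim by (intro powr_of_real[symmetric]) auto
    moreover have "1 + - (complex_of_real b * of_real t - of_real c * (of_real t)\<^sup>2)
      = complex_of_real (1 - (b * t - c * t\<^sup>2))" by simp
    ultimately show ?case by (simp only: o_def of_real_minus)
  qed
qed

definition at_s :: "real \<Rightarrow> sts \<Rightarrow> real fps" where
  "at_s s A = Abs_fps (\<lambda>n. poly (A $$ n) s)"

lemma at_s_nth: "at_s s A $$ n = poly (A $$ n) s"
  by (simp add: at_s_def)

lemma at_s_hom: "at_s s (A + B) = at_s s A + at_s s B" "at_s s (A - B) = at_s s A - at_s s B"
  "at_s s (A * B) = at_s s A * at_s s B" "at_s s 1 = 1" "at_s s (sconst a) = fps_const a"
  "at_s s tvar = fps_X" "at_s s svar = fps_const s"
  by (auto intro!: fps_ext simp: at_s_nth fps_mult_nth Polynomial.poly_sum fps_X_def)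

lemma at_s_power: "at_s s (A ^ n) = at_s s A ^ n"
  by (induction n) (simp_all add: at_s_hom)

lemma at_s_prod: "at_s s (\<Prod>i\<in>I. F i) = (\<Prod>i\<in>I. at_s s (F i))"
  by (induction I rule: infinite_finite_induct) (simp_all add: at_s_hom)

lemma at_s_numeral: "at_s s (numeral w) = numeral w"
  using at_s_hom(5)[of s "numeral w"] by (simp only: sconst_hom numeral_fps_const)

lemma at_s_compose: "at_s s (A oo B) = at_s s A oo at_s s B"
  by (rule fps_ext) (simp add: at_s_nth fps_compose_nth Polynomial.poly_sum flip: at_s_power)

lemma at_s_qpow:
  "at_s s (qpow a y) = rising_real a oo (fps_const (2 * s * y) * fps_X - fps_const (y\<^sup>2) * fps_X\<^sup>2)"
proof -
  have "qpow a y = rising a oo dilate y unit_quad"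
    unfolding qpow_def unit_pow_def dilate_def
    by (rule fps_compose_assoc[symmetric]) (simp_all add: unit_quad_0)
  also have "dilate y unit_quad = 2 * svar * (sconst y * tvar) - (sconst y * tvar)\<^sup>2"
    by (simp add: unit_quad_def dilate_hom dilate_numeral power2_eq_square)
  finally have "at_s s (qpow a y) = at_s s (rising a) oo (2 * fps_const s * (fps_const y * fps_X) - (fps_const y * fps_X)\<^sup>2)"
    by (simp only: at_s_compose at_s_hom at_s_power at_s_numeral)
  moreover have "at_s s (rising a) = rising_real a"
    by (rule fps_ext) (simp add: at_s_nth rising_def rising_real_def)
  moreover have "2 * fps_const s * (fps_const y * fps_X) - (fps_const y * fps_X)\<^sup>2
     = (fps_const (2 * s * y) * fps_X - fps_const (y\<^sup>2) * fps_X\<^sup>2 :: real fps)"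
    by (rule fps_ext) (auto simp: power_mult_distrib numeral_fps_const mult.assoc[symmetric])
  ultimately show ?thesis by simp
qed

lemma gen_quad_expansion:
  "(\<lambda>t. gen_quad s t u powr (- a)) has_fps_expansion at_s s (qpow a (u\<^sup>2))"
proof -
  have "gen_quad s t u = 1 - (2 * s * u\<^sup>2 * t - (u\<^sup>2)\<^sup>2 * t\<^sup>2)" for t
    by (simp add: gen_quad_def algebra_simps flip: power_mult)
  then show ?thesis
    unfolding at_s_qpow using has_fps_expansion_quadratic_powr[of "2 * s * u\<^sup>2" "(u\<^sup>2)\<^sup>2" a] by simp
qed

lemma gen_quad_inverse_expansion:
  "(\<lambda>t. 1 / gen_quad s t u) has_fps_expansion at_s s (qpow 1 (u\<^sup>2))"
proof -
  have "((\<lambda>t. gen_quad s t u) \<longlongrightarrow> gen_quad s 0 u) (nhds 0)"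
    unfolding gen_quad_def by (intro tendsto_intros filterlim_ident)
  then have "\<forall>\<^sub>F t in nhds 0. gen_quad s t u > 0"
    by (rule order_tendstoD) (simp add: gen_quad_def)
  then have "\<forall>\<^sub>F t in nhds 0. gen_quad s t u powr (- 1) = 1 / gen_quad s t u"
    by eventually_elim (simp add: powr_minus_divide)
  then show ?thesis
    using gen_quad_expansion[of s u 1] unfolding has_fps_expansion_def
    by (auto elim: eventually_elim2)
qed

lemma gen_F_expansion:
  "(\<lambda>t. gen_F0 k i1 i2 x s t) has_fps_expansion at_s s (F0_ser k i1 i2 (squares x))"
  "(\<lambda>t. gen_F1 k i1 i2 x s t) has_fps_expansion at_s s (F1_ser k i1 i2 (squares x))"
proof -
  let ?q = "\<lambda>i t. gen_quad s t (x $ i)"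
  have w: "(\<lambda>t. 1 / ?q i1 t * (1 / ?q i2 t) * (\<Prod>i\<in>UNIV. ?q i t powr (- k)))
     has_fps_expansion at_s s (pole_ser k i1 i2 (squares x))"
    unfolding pole_ser_def weight_ser_def at_s_hom at_s_prod squares_nth
    by (intro fps_expansion_intros gen_quad_inverse_expansion gen_quad_expansion)
  have n0: "(\<lambda>t. 1 - s * t * ((x $ i1)\<^sup>2 + (x $ i2)\<^sup>2) + t\<^sup>2 * (x $ i1)\<^sup>2 * (x $ i2)\<^sup>2) has_fps_expansion
     at_s s (1 - svar * tvar * (sconst (squares x i1) + sconst (squares x i2))
     + tvar\<^sup>2 * sconst (squares x i1) * sconst (squares x i2))"
    unfolding at_s_hom at_s_power squares_nth by (intro fps_expansion_intros)
  have n1: "(\<lambda>t. t * ((x $ i1)\<^sup>2 - (x $ i2)\<^sup>2)) has_fps_expansion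
     at_s s (tvar * (sconst (squares x i1) - sconst (squares x i2)))"
    unfolding at_s_hom at_s_power squares_nth by (intro fps_expansion_intros)
  show "(\<lambda>t. gen_F0 k i1 i2 x s t) has_fps_expansion at_s s (F0_ser k i1 i2 (squares x))"
    using has_fps_expansion_mult[OF n0 w]
    unfolding gen_F0_def F0_ser_def at_s_hom(3) by (simp add: mult.assoc)
  show "(\<lambda>t. gen_F1 k i1 i2 x s t) has_fps_expansion at_s s (F1_ser k i1 i2 (squares x))"
    using has_fps_expansion_mult[OF n1 w]
    unfolding gen_F1_def F1_ser_def at_s_hom(3) by (simp add: mult.assoc)
qed

text \<open>
  Uniqueness first in \<open>t\<close>, for each real \<open>s\<close>, and then in \<open>s\<close>, as an identity of polynomials.
\<close>

lemma gen_coeff_eq: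
  assumes deg: "\<And>n j. n < j \<Longrightarrow> coeff (A $$ n) j = 0"
    and exp: "\<And>s. (\<lambda>t. F s t) has_fps_expansion at_s s A"
  shows "gen_coeff F = (\<lambda>n j. coeff (A $$ n) j)"
  unfolding gen_coeff_def
proof (rule the_equality)
  have p: "poly (A $$ n) s = (\<Sum>j\<le>n. coeff (A $$ n) j * s ^ j)" for n s
  proof -
    have "degree (A $$ n) \<le> n" using deg degree_le by blast
    then show ?thesis
      unfolding poly_altdef by (intro sum.mono_neutral_left) (auto simp: coeff_eq_0)
  qed
  show "gen_expansion F (\<lambda>n j. coeff (A $$ n) j)"
    unfolding gen_expansion_def p[symmetric] at_s_nth[symmetric]
    using deg eventually_sums_fps[OF exp] by blast
  fix c assume c: "gen_expansion F c"
  show "c = (\<lambda>n j. coeff (A $$ n) j)"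
  proof (intro ext)
    fix n j
    have eq: "(\<Sum>j\<le>n. c n j * s ^ j) = (\<Sum>j\<le>n. coeff (A $$ n) j * s ^ j)" for s
    proof -
      have "(\<lambda>t. F s t) has_fps_expansion Abs_fps (\<lambda>n. \<Sum>j\<le>n. c n j * s ^ j)"
        using c by (intro has_fps_expansionI) (simp add: gen_expansion_def)
      from has_fps_expansion_unique[OF this exp] have
        "Abs_fps (\<lambda>n. \<Sum>j\<le>n. c n j * s ^ j) $$ n = at_s s A $$ n" by simp
      then show ?thesis by (simp add: at_s_nth p)
    qed
    show "c n j = coeff (A $$ n) j"
    proof (cases "j \<le> n")
      case True
      have "\<forall>s. (\<Sum>j\<le>n. c n j * s ^ j) = (\<Sum>j\<le>n. coeff (A $$ n) j * s ^ j)" using eq by blast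
      then show ?thesis using True polyfun_eq_coeffs by blast
    next
      case False
      then show ?thesis using c deg[of n j] by (simp add: gen_expansion_def)
    qed
  qed
qed

lemma graded_degree: "graded w A \<Longrightarrow> n < j + w \<Longrightarrow> coeff (A $$ n) j = 0"
  unfolding graded_def by (metis not_le)

lemma graded_parity: "graded w A \<Longrightarrow> odd (n + j + w) \<Longrightarrow> coeff (A $$ n) j = 0"
  unfolding graded_def by metis

lemma phi_eq:
  "phi k i1 i2 n j x = family_coeff (F0_ser k i1 i2) n j x + family_coeff (F1_ser k i1 i2) n j x"
proof -
  have "gen_coeff (\<lambda>s t. gen_F0 k i1 i2 x s t + gen_F1 k i1 i2 x s t)
     = (\<lambda>n j. coeff ((F0_ser k i1 i2 (squares x) + F1_ser k i1 i2 (squares x)) $$ n) j)"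
  proof (rule gen_coeff_eq)
    show "coeff ((F0_ser k i1 i2 (squares x) + F1_ser k i1 i2 (squares x)) $$ n) j = 0" if "n < j" for n j
      using that by (simp add: graded_degree[OF graded_F0] graded_degree[OF graded_F1])
  qed (unfold at_s_hom, intro fps_expansion_intros gen_F_expansion)
  then show ?thesis by (simp add: phi_def)
qed

lemma psi_eq:
  "psi k i1 i2 n j x = x $ i1 * (family_coeff (F0_ser k i1 i2) n j x
     + coeff (pCons 0 (F1_ser k i1 i2 (squares x) $$ n)) j - family_coeff (F1_ser k i1 i2) n j x)"
proof -
  let ?A = "F0_ser k i1 i2 (squares x)" and ?B = "F1_ser k i1 i2 (squares x)"
  have "gen_coeff (\<lambda>s t. x $ i1 * (gen_F0 k i1 i2 x s t + s * gen_F1 k i1 i2 x s t) - x $ i1 * gen_F1 k i1 i2 x s t)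
     = (\<lambda>n j. coeff ((sconst (x $ i1) * (?A + svar * ?B) - sconst (x $ i1) * ?B) $$ n) j)"
  proof (rule gen_coeff_eq)
    fix n j :: nat assume j: "n < j"
    have "coeff (?A $$ n) j = 0" "coeff (?B $$ n) j = 0"
      using j by (simp_all add: graded_degree[OF graded_F0] graded_degree[OF graded_F1])
    moreover have "coeff (?B $$ n) (j - 1) = 0"
      using j by (simp add: graded_degree[OF graded_F1])
    ultimately show "coeff ((sconst (x $ i1) * (?A + svar * ?B) - sconst (x $ i1) * ?B) $$ n) j = 0"
      using j by (cases j) simp_all
  qed (unfold at_s_hom, intro fps_expansion_intros gen_F_expansion)
  then show ?thesis by (simp add: psi_def right_diff_distrib)
qed

section \<open>Normal forms of the polynomials h\<close>

text \<open>
  The coefficients of \<open>h\<close>.  The term ratio of this sequence is rational in \<open>j\<close> (\<open>hyp_Suc\<close>), and shifting a parameter by one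
  multiplies it by a rational function of \<open>j\<close>; all telescoping below rests on these facts.
\<close>

definition hyp :: "real \<Rightarrow> real \<Rightarrow> real \<Rightarrow> nat \<Rightarrow> real" where
  "hyp b e f j = pochhammer b j * pochhammer (1/2) j / (pochhammer e j * pochhammer f j)"

lemma hyp_Suc: "hyp b e f (Suc j) = hyp b e f j * ((b + j) * (j + 1/2)) / ((e + j) * (f + j))"
  by (simp add: hyp_def pochhammer_Suc add_ac mult_ac)

lemma pochhammer_shift: "pochhammer a j * (a + real j) = a * pochhammer (a + 1) j"
  for a :: real
  using pochhammer_rec[of a j] pochhammer_Suc[of a j] by simp

lemma hyp_shift_num: "hyp (b - 1) e f j * (b - 1 + j) = hyp b e f j * (b - 1)"
  using pochhammer_shift[of "b - 1" j] by (simp add: hyp_def mult_ac)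

lemma hyp_shift_den:
  assumes "e > 1"
  shows "hyp b (e - 1) f j * (e - 1) = hyp b e f j * (e - 1 + j)"
proof -
  have "pochhammer (e - 1) j \<noteq> 0" "pochhammer e j \<noteq> 0"
    using assms pochhammer_pos[of "e - 1" j] pochhammer_pos[of e j] by auto
  then have "(e - 1) / pochhammer (e - 1) j = (e - 1 + j) / pochhammer e j"
    using pochhammer_shift[of "e - 1" j] by (simp add: frac_eq_eq mult.commute)
  moreover have "hyp b u f j * v = pochhammer b j * pochhammer (1/2) j / pochhammer f j * (v / pochhammer u j)"
    for u v by (simp add: hyp_def)
  ultimately show ?thesis by (simp only:)
qed

lemma hyp_commute: "hyp b e f j = hyp b f e j"
  by (simp add: hyp_def mult.commute)

text \<open>
  \<open>K\<close> abbreviates \<open>(N - 1) k\<close>, so that \<open>N k = K + k\<close>.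
\<close>

locale planar_chain = planar k k1 i1 i2 for k k1 :: real and i1 i2 :: "'n::finite" +
  fixes K :: real
  assumes K: "K = (real CARD('n) - 1) * k"
begin

lemma kN: "k * real CARD('n) = K + k" "real CARD('n) * k = K + k"
  "2 * (real CARD('n) - 1) * k = 2 * K"
  by (simp_all add: K algebra_simps)

lemma K_ge: "K \<ge> k"
proof -
  have "card {i1, i2} \<le> CARD('n)" by (rule card_mono) auto
  then have "real CARD('n) - 1 \<ge> 1" using i12 by simp
  then have "1 * k \<le> (real CARD('n) - 1) * k" using k_pos by (intro mult_right_mono) auto
  then show ?thesis by (simp add: K)
qed

lemma K_pos: "K > 0" using K_ge k_pos by simp

text \<open>
  The coefficients of \<open>F\<^sub>0\<close> and \<open>F\<^sub>1\<close>; each prime stands for a factor \<open>s\<close>.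
\<close>

abbreviation "a n j x \<equiv> coeff (F0 (squares x) $$ n) j"
abbreviation "b n j x \<equiv> coeff (F1 (squares x) $$ n) j"
abbreviation "b' n j x \<equiv> coeff (pCons 0 (F1 (squares x) $$ n)) j"

lemma vanish:
  "n < j \<Longrightarrow> a n j x = 0" "odd (n + j) \<Longrightarrow> a n j x = 0"
  "n \<le> j \<Longrightarrow> b n j x = 0" "even (n + j) \<Longrightarrow> b n j x = 0"
  by (simp_all add: graded_degree[OF graded_F0] graded_degree[OF graded_F1]
      graded_parity[OF graded_F0] graded_parity[OF graded_F1])

lemma ab_poly: "real_polynomial_function (a n j)" "real_polynomial_function (b n j)"
    "real_polynomial_function (b' n j)"
proof -
  show *: "real_polynomial_function (a n j)" "real_polynomial_function (b n j)" for n j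
    using square_family_F[of k i1 i2] by (auto simp: poly_family_def)
  then show "real_polynomial_function (b' n j)"
    by (cases j) (auto intro: poly_zero *)
qed

lemma h0_0_eq: "h0_0 k k1 i1 i2 n x =
  (\<Sum>j\<le>n. hyp (2 * K + k1 + 1/2 + 2 * n) (K + k1 + 1/2 + n) (K + k + n + 1) j * a (2 * n) (2 * j) x)"
  unfolding h0_0_def Let_def kN K[symmetric]
  by (simp add: hyp_def phi_eq vanish mult.assoc)

lemma h0_2_eq: "h0_2 k k1 i1 i2 n x =
  (\<Sum>j\<le>n. hyp (2 * K + k1 + 3/2 + 2 * n) (K + k1 + 3/2 + n) (K + k + n + 2) j * b (2 * n + 1) (2 * j) x)"
  unfolding h0_2_def Let_def kN K[symmetric]
  by (simp add: hyp_def phi_eq vanish mult.assoc)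

lemma h1_1_eq: "h1_1 k k1 i1 i2 n x = x $ i1 * x $ i2 *
  (\<Sum>j\<le>n. hyp (2 * K + k1 + 3/2 + 2 * n) (K + k1 + 3/2 + n) (K + k + n + 1) j * a (2 * n) (2 * j) x)"
  unfolding h1_1_def Let_def kN K[symmetric]
  by (simp add: hyp_def phi_eq vanish mult.assoc)

lemma h1_3_eq: "h1_3 k k1 i1 i2 n x = x $ i1 * x $ i2 *
  (\<Sum>j\<le>n. hyp (2 * K + k1 + 5/2 + 2 * n) (K + k1 + 5/2 + n) (K + k + n + 2) j * b (2 * n + 1) (2 * j) x)"
  unfolding h1_3_def Let_def kN K[symmetric]
  by (simp add: hyp_def phi_eq vanish mult.assoc)

text \<open>
  \<open>F\<^sub>0\<close> and \<open>s F\<^sub>1\<close> only contain monomials \<open>s\<^sup>j t\<^sup>n\<close> with \<open>n + j\<close> even, \<open>F\<^sub>1\<close> only those with \<open>n + j\<close> odd.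
\<close>

lemma psi_even:
  "psi k i1 i2 (2 * n) (2 * j) x = x $ i1 * (a (2 * n) (2 * j) x + b' (2 * n) (2 * j) x)"
  "psi k i1 i2 (2 * n) (2 * Suc j - 1) x = - x $ i1 * b' (2 * n) (2 * Suc j) x"
proof -
  show "psi k i1 i2 (2 * n) (2 * j) x = x $ i1 * (a (2 * n) (2 * j) x + b' (2 * n) (2 * j) x)"
    by (simp add: psi_eq vanish)
  have "2 * Suc j - 1 = Suc (2 * j)" "2 * Suc j = Suc (Suc (2 * j))" by simp_all
  then show "psi k i1 i2 (2 * n) (2 * Suc j - 1) x = - x $ i1 * b' (2 * n) (2 * Suc j) x"
    by (simp only: psi_eq coeff_pCons_Suc) (simp add: vanish)
qed

lemma psi_odd:
  "psi k i1 i2 (2 * n + 1) (2 * j) x = - x $ i1 * b (2 * n + 1) (2 * j) x"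
  "psi k i1 i2 (2 * n + 1) (2 * Suc j - 1) x
     = x $ i1 * (a (2 * n + 1) (2 * j + 1) x + b (2 * n + 1) (2 * j) x)"
proof -
  have "b' (2 * n + 1) (2 * j) x = 0" by (cases j) (simp_all add: vanish)
  then show "psi k i1 i2 (2 * n + 1) (2 * j) x = - x $ i1 * b (2 * n + 1) (2 * j) x"
    by (simp add: psi_eq vanish)
  have "2 * Suc j - 1 = Suc (2 * j)" by simp
  then show "psi k i1 i2 (2 * n + 1) (2 * Suc j - 1) x
     = x $ i1 * (a (2 * n + 1) (2 * j + 1) x + b (2 * n + 1) (2 * j) x)"
    by (simp only: psi_eq coeff_pCons_Suc) (simp add: vanish)
qed

text \<open>
  The coefficients of the two sums that define \<open>h0_1\<close> differ by a factor rational in \<open>j\<close>, so that the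
  sums merge into one over the coefficients of \<open>F\<^sub>0\<close> and \<open>s F\<^sub>1\<close>.  The same holds for \<open>h0_3\<close>.
\<close>

lemma h0_1_eq:
  fixes n :: nat and B e f :: real
  defines "B \<equiv> 2 * K + k1 + 3/2 + 2 * n" and "e \<equiv> K + k1 + 3/2 + n" and "f \<equiv> K + k + n + 1"
  shows "h0_1 k k1 i1 i2 n x = x $ i1 * (\<Sum>j\<le>n. hyp B e f j *
    (a (2 * n) (2 * j) x + (K + n) / (B - 1 + j) * b' (2 * n) (2 * j) x))"
proof -
  define g where "g j = hyp B e f j" for j
  define g' where "g' j = pochhammer B (j - 1) * pochhammer (1/2) j / (pochhammer e (j - 1) * pochhammer f j)" for j
  have g': "g' (Suc j) * (B + j) = g (Suc j) * (e + j)" for j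
  proof -
    have *: "p * h / (q * F) * Z = (p * Z) * h / ((q * E) * F) * E" if "E \<noteq> 0" for p h q F Z E :: real
      using that by simp
    have "e + j \<noteq> 0" using K_pos k1_pos by (simp add: e_def)
    from *[OF this] show ?thesis
      by (simp only: g_def g'_def hyp_def pochhammer_Suc[of B] pochhammer_Suc[of e] diff_Suc_1)
  qed
  have gg: "g (Suc j) - g' (Suc j) = g (Suc j) * ((K + n) / (B - 1 + real (Suc j)))" for j
  proof -
    have "B + j \<noteq> 0" "B + j - (e + j) = K + n" using K_pos k1_pos by (simp_all add: B_def e_def)
    with g'[of j] show ?thesis by (simp add: field_simps)
  qed
  have "h0_1 k k1 i1 i2 n x = (\<Sum>j\<le>n. g j * psi k i1 i2 (2 * n) (2 * j) x)
      + (\<Sum>j=1..n. g' j * psi k i1 i2 (2 * n) (2 * j - 1) x)"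
    unfolding h0_1_def Let_def kN K[symmetric]
    by (simp add: g_def g'_def hyp_def B_def e_def f_def mult.assoc K[symmetric])
  also have "(\<Sum>j=1..n. g' j * psi k i1 i2 (2 * n) (2 * j - 1) x)
     = (\<Sum>j=1..n. x $ i1 * (- g' j * b' (2 * n) (2 * j) x))"
  proof (rule sum.cong[OF refl])
    fix j assume "j \<in> {1..n}"
    then obtain i where "j = Suc i" by (cases j) auto
    then show "g' j * psi k i1 i2 (2 * n) (2 * j - 1) x = x $ i1 * (- g' j * b' (2 * n) (2 * j) x)"
      by (simp only: psi_even) simp
  qed
  also have "\<dots> = (\<Sum>j\<le>n. if j = 0 then 0 else x $ i1 * (- g' j * b' (2 * n) (2 * j) x))"
    by (intro sum.mono_neutral_cong_left) auto
  also have "(\<Sum>j\<le>n. g j * psi k i1 i2 (2 * n) (2 * j) x) + \<dots>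
     = (\<Sum>j\<le>n. x $ i1 * (g j * (a (2 * n) (2 * j) x + (K + n) / (B - 1 + j) * b' (2 * n) (2 * j) x)))"
    unfolding sum.distrib[symmetric]
  proof (rule sum.cong[OF refl])
    fix j
    show "g j * psi k i1 i2 (2 * n) (2 * j) x + (if j = 0 then 0 else x $ i1 * (- g' j * b' (2 * n) (2 * j) x))
      = x $ i1 * (g j * (a (2 * n) (2 * j) x + (K + n) / (B - 1 + j) * b' (2 * n) (2 * j) x))"
    proof (cases j)
      case 0
      then show ?thesis by (simp add: psi_eq vanish)
    next
      case (Suc i)
      have "g (Suc i) * psi k i1 i2 (2 * n) (2 * Suc i) x + x $ i1 * (- g' (Suc i) * b' (2 * n) (2 * Suc i) x)
        = x $ i1 * (g (Suc i) * a (2 * n) (2 * Suc i) x + (g (Suc i) - g' (Suc i)) * b' (2 * n) (2 * Suc i) x)"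
        unfolding psi_even by (simp only: algebra_simps)
      then show ?thesis
        unfolding Suc gg by (simp only: distrib_left mult.assoc) simp
    qed
  qed
  finally show ?thesis by (simp only: sum_distrib_left g_def)
qed

lemma h0_3_eq:
  fixes n :: nat and B e f :: real
  defines "B \<equiv> 2 * K + k1 + 5/2 + 2 * n" and "e \<equiv> K + k1 + 3/2 + n" and "f \<equiv> K + k + n + 2"
  shows "h0_3 k k1 i1 i2 n x = x $ i1 * (\<Sum>j\<le>n. hyp B e f j / (e + j) *
    ((j + 1/2) * a (2 * n + 1) (2 * j + 1) x - (e - 1/2) * b (2 * n + 1) (2 * j) x))"
proof -
  define g where "g j = hyp B e f j" for j
  define g' where "g' j = pochhammer B (j - 1) * pochhammer (1/2) j / (pochhammer e j * pochhammer f (j - 1))" for j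
  have ej: "e + j > 0" for j :: nat using K_pos k1_pos by (simp add: e_def add_pos_nonneg)
  have g': "g' (Suc j) = g j * ((j + 1/2) / (e + j))" for j
    by (simp add: g_def g'_def hyp_def pochhammer_Suc add_ac mult_ac)
  have "h0_3 k k1 i1 i2 n x = (\<Sum>j\<le>n. g j * psi k i1 i2 (2 * n + 1) (2 * j) x)
      + (\<Sum>j=1..n+1. g' j * psi k i1 i2 (2 * n + 1) (2 * j - 1) x)"
    unfolding h0_3_def Let_def kN K[symmetric]
    by (simp add: g_def g'_def hyp_def B_def e_def f_def mult.assoc K[symmetric] del: sum.cl_ivl_Suc)
  also have "(\<Sum>j=1..n+1. g' j * psi k i1 i2 (2 * n + 1) (2 * j - 1) x)
    = (\<Sum>j\<le>n. g' (Suc j) * psi k i1 i2 (2 * n + 1) (2 * Suc j - 1) x)"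
  proof -
    have "{1..n+1} = Suc ` {..n}" by (simp add: image_Suc_atMost)
    then show ?thesis by (simp only: sum.reindex[OF inj_on_subset[OF inj_Suc subset_UNIV]] o_def)
  qed
  also have "(\<Sum>j\<le>n. g j * psi k i1 i2 (2 * n + 1) (2 * j) x) + \<dots>
    = (\<Sum>j\<le>n. x $ i1 * (g j / (e + j) * ((j + 1/2) * a (2 * n + 1) (2 * j + 1) x - (e - 1/2) * b (2 * n + 1) (2 * j) x)))"
    unfolding sum.distrib[symmetric] psi_odd g'
  proof (rule sum.cong[OF refl])
    fix j :: nat
    have *: "g j * (- X * v) + g j * ((j + 1/2) / E) * (X * (u + v))
       = X * (g j / E * ((j + 1/2) * u - (E - j - 1/2) * v))" if "E > 0" for X u v E :: real
      using that by (simp add: field_simps)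
    show "g j * (- x $ i1 * b (2 * n + 1) (2 * j) x) + g j * ((j + 1/2) / (e + j)) *
        (x $ i1 * (a (2 * n + 1) (2 * j + 1) x + b (2 * n + 1) (2 * j) x))
      = x $ i1 * (g j / (e + j) * ((j + 1/2) * a (2 * n + 1) (2 * j + 1) x - (e - 1/2) * b (2 * n + 1) (2 * j) x))"
      using *[OF ej[of j], of "x $ i1" "b (2 * n + 1) (2 * j) x" "a (2 * n + 1) (2 * j + 1) x"] by simp
  qed
  finally show ?thesis by (simp only: sum_distrib_left g_def)
qed

end

section \<open>The ladder of Dunkl operators\<close>

text \<open>
  In each of the ladder relations the difference of the summands is a telescoping term.  The potential
  \<open>P\<close> carries the unwanted coefficient of \<open>F\<^sub>0\<close> or \<open>F\<^sub>1\<close>: a term of index \<open>2 j + 1\<close> or \<open>2 j + 2\<close> in \<open>s\<close>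
  left over in the summand \<open>j\<close> is cancelled by the one that occurs in the summand \<open>j + 1\<close>, the factors
  agreeing by \<open>hyp_Suc\<close>.  At the upper end \<open>P\<close> vanishes for reasons of degree.
\<close>

lemma sum_telescope_eq:
  fixes L R P :: "nat \<Rightarrow> real"
  assumes "\<And>j. L j = R j + (P j - P (Suc j))" "P 0 = 0" "P (Suc n) = 0"
  shows "(\<Sum>j\<le>n. L j) = (\<Sum>j\<le>n. R j)"
proof -
  have "(\<Sum>j\<le>m. L j) = (\<Sum>j\<le>m. R j) + (P 0 - P (Suc m))" for m
    by (induction m) (simp_all add: assms(1))
  then show ?thesis using assms(2,3) by simp
qed

context planar_chain
begin

lemma T_lincomb:
  assumes "\<And>j. real_polynomial_function (f j)"
  shows "T i (\<lambda>x. \<Sum>j\<le>n. c j * f j x) = (\<lambda>x. \<Sum>j\<le>(n::nat). c j * T i (f j) x)"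
  by (simp add: dunkl_sum dunkl_scale poly_cmult assms)

abbreviation "b'' n j x \<equiv> coeff (pCons 0 (pCons 0 (F1 (squares x) $$ n))) j"
abbreviation "a' n j x \<equiv> coeff (pCons 0 (F0 (squares x) $$ n)) j"

lemma T1_a: "T i1 (a (Suc n) j) x = x $ i1 * ((n + j + 1 + 2 * (K + k)) * (a' n j x + b'' n j x)
     - (j + 1) * a n (Suc j) x - (n + j + 2 + 2 * K) * b n j x)"
  unfolding dunkl_a kN by (simp add: algebra_simps)

lemma T1_b: "T i1 (b (Suc n) j) x = x $ i1 * ((n + j + 2 + 2 * (K + k)) * (a n j x + b' n j x)
     - (j + 1) * b n (Suc j) x)"
  unfolding dunkl_b kN by (simp add: algebra_simps)

lemma T1_x1_a: "T i1 (\<lambda>x. x $ i1 * a n j x) x = (n + 2 * K + 1 + 2 * k1) * a n j x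
     + (j + 2 * k) * b' n j x - (j + 1) * b n (Suc j) x"
  unfolding dunkl_x1_a kN by (simp add: algebra_simps)

lemma T1_x1_b: "T i1 (\<lambda>x. x $ i1 * b n j x) x = (j + 1) * a n (Suc j) x + (n + 2 * K - 2 * k + 1 + 2 * k1) * b n j x"
  unfolding dunkl_x1_b kN by (simp add: algebra_simps)

lemma T1_x1_b': "T i1 (\<lambda>x. x $ i1 * b' n j x) x = j * a n j x + (n + 2 * K - 2 * k + 1 + 2 * k1) * b' n j x"
proof (cases j)
  case 0
  then show ?thesis by (simp add: dunkl_const)
next
  case (Suc i)
  then show ?thesis using T1_x1_b[of n i x] by simp
qed

lemma swap_ab: "a n j (refl_swap i1 i2 x) = a n j x" "b n j (refl_swap i1 i2 x) = - b n j x"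
  "a' n j (refl_swap i1 i2 x) = a' n j x" "b' n j (refl_swap i1 i2 x) = - b' n j x"
  "b'' n j (refl_swap i1 i2 x) = - b'' n j x"
proof -
  have m: "pCons 0 (- p) = - pCons 0 p" for p :: "real poly" by simp
  show "a n j (refl_swap i1 i2 x) = a n j x" "b n j (refl_swap i1 i2 x) = - b n j x"
    "a' n j (refl_swap i1 i2 x) = a' n j x" "b' n j (refl_swap i1 i2 x) = - b' n j x"
    "b'' n j (refl_swap i1 i2 x) = - b'' n j x"
    unfolding squares_refl F_ser_sym[OF i12] fps_neg_nth m coeff_minus by simp_all
qed

lemma swap_coord: "refl_swap i1 i2 x $ i1 = x $ i2" "refl_swap i1 i2 x $ i2 = x $ i1"
  using i12 by (simp_all add: refl_swap_def)

text \<open>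
  The formulas for \<open>T\<^sub>2\<close> follow from those for \<open>T\<^sub>1\<close> by the exchange, under which \<open>F\<^sub>0\<close> is symmetric and
  \<open>F\<^sub>1\<close> antisymmetric.
\<close>

lemma T2_a: "T i2 (a (Suc n) j) x = x $ i2 * ((n + j + 1 + 2 * (K + k)) * (a' n j x - b'' n j x)
     - (j + 1) * a n (Suc j) x + (n + j + 2 + 2 * K) * b n j x)"
proof -
  have "T i2 (a (Suc n) j) = T i2 (\<lambda>x. a (Suc n) j (refl_swap i1 i2 x))"
    unfolding swap_ab ..
  then have "T i2 (a (Suc n) j) x = T i1 (a (Suc n) j) (refl_swap i1 i2 x)"
    by (simp only: dunkl_refl_swap(2)[OF ab_poly(1)])
  then show ?thesis
    unfolding T1_a swap_ab swap_coord by (simp only:) simp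
qed

lemma T2_b: "T i2 (b (Suc n) j) x = x $ i2 * (- (n + j + 2 + 2 * (K + k)) * (a n j x - b' n j x)
     - (j + 1) * b n (Suc j) x)"
proof -
  have "T i2 (b (Suc n) j) = T i2 (\<lambda>x. - b (Suc n) j (refl_swap i1 i2 x))"
    unfolding swap_ab by simp
  then have "T i2 (b (Suc n) j) x = - T i1 (b (Suc n) j) (refl_swap i1 i2 x)"
    by (simp only: dunkl_refl_swap(2)[OF ab_poly(2)] dunkl_minus[OF poly_reflect(2)[OF ab_poly(2)]])
  then show ?thesis
    unfolding T1_b swap_ab swap_coord by (simp only:) (simp add: algebra_simps)
qed

lemma dunkl_even_off:
  assumes ij: "i \<noteq> l" and f: "real_polynomial_function f"
    and even: "\<And>x. f (refl_negswap i l x) = f (refl_swap i l x)"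
  shows "T i (\<lambda>x. x $ l * f x) = (\<lambda>x. x $ l * T i f x)"
  unfolding dunkl_coord[OF f] coord_comm_off[OF ij] even by simp

lemma T2_x1_a: "T i2 (\<lambda>x. x $ i1 * a n j x) = (\<lambda>x. x $ i1 * T i2 (a n j) x)"
  and T2_x1_b: "T i2 (\<lambda>x. x $ i1 * b n j x) = (\<lambda>x. x $ i1 * T i2 (b n j) x)"
  using i12 by (intro dunkl_even_off ab_poly; simp add: squares_refl)+

lemma T2_x1_b': "T i2 (\<lambda>x. x $ i1 * b' (Suc n) j x) x = x $ i1 * x $ i2 *
    (- (n + j + 1 + 2 * (K + k)) * (a' n j x - b'' n j x) - j * b n j x)"
proof (cases j)
  case 0
  then show ?thesis by (simp add: dunkl_const)
next
  case (Suc i)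
  then show ?thesis
    using fun_cong[OF T2_x1_b[of "Suc n" i], of x] unfolding T2_b
    by (simp add: algebra_simps)
qed

text \<open>
  The lemmas \<open>chain_i_j\<close> relate the polynomials whose first index is congruent to \<open>i\<close> and \<open>j\<close> modulo 4,
  where 4 and 5 stand for 0 and 1 in the next block of four.
\<close>

lemma chain_2_1: "T i1 (h0_2 k k1 i1 i2 n) = (\<lambda>x. 2 * (K + k + n + 1) * h0_1 k k1 i1 i2 n x)"
proof
  fix x
  define B where "B = 2 * K + k1 + 3/2 + 2 * n"
  define e where "e = K + k1 + 3/2 + n"
  define f where "f = K + k + n + 1"
  define g where "g j = hyp B e f j" for j :: nat
  define c where "c j = hyp B e (f + 1) j" for j :: nat
  note pos = K_pos k_pos k1_pos
  have nz: "f + j > 0" "B - 1 + j > 0" "e + j > 0" "B + j > 0" for j :: nat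
    using pos by (simp_all add: B_def e_def f_def)
  have f1: "f + 1 > 1" using pos by (simp add: f_def)
  have cg: "c j * (f + j) = f * g j" for j :: nat
    using hyp_shift_den[OF f1, of B e j] by (simp add: c_def g_def hyp_commute[of B e] mult.commute)
  have gS: "g (Suc j) = g j * ((B + j) * (j + 1/2)) / ((e + j) * (f + j))" for j :: nat
    by (simp add: g_def hyp_Suc)
  define P where "P j = 2 * f * g j * ((e + j - 1) / (B - 1 + j)) * b' (2 * n) (2 * j) x" for j :: nat
  have "h0_2 k k1 i1 i2 n = (\<lambda>x. \<Sum>j\<le>n. c j * b (2 * n + 1) (2 * j) x)"
    unfolding c_def B_def e_def f_def by (rule ext) (simp add: h0_2_eq add.assoc)
  then have "T i1 (h0_2 k k1 i1 i2 n) x = (\<Sum>j\<le>n. c j * T i1 (b (2 * n + 1) (2 * j)) x)"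
    by (simp only: T_lincomb[OF ab_poly(2)])
  also have "\<dots> = x $ i1 * (\<Sum>j\<le>n. c j * (2 * (f + j) * (a (2 * n) (2 * j) x + b' (2 * n) (2 * j) x)
       - (2 * real j + 1) * b (2 * n) (Suc (2 * j)) x))"
    unfolding sum_distrib_left
    by (rule sum.cong) (simp_all only: Suc_eq_plus1[symmetric] T1_b, simp add: f_def algebra_simps)
  also have "(\<Sum>j\<le>n. c j * (2 * (f + j) * (a (2 * n) (2 * j) x + b' (2 * n) (2 * j) x)
       - (2 * real j + 1) * b (2 * n) (Suc (2 * j)) x))
    = (\<Sum>j\<le>n. 2 * f * (g j * (a (2 * n) (2 * j) x + (K + n) / (B - 1 + j) * b' (2 * n) (2 * j) x)))"
  proof (rule sum_telescope_eq[where P = P])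
    fix j :: nat
    have 1: "(e + j - 1) / (B - 1 + j) = 1 - (K + n) / (B - 1 + j)"
      using nz(2)[of j] by (simp add: B_def e_def field_simps)
    have 2: "2 * f * g (Suc j) * ((e + real (Suc j) - 1) / (B - 1 + real (Suc j))) = c j * (2 * real j + 1)"
    proof -
      have "2 * f * g (Suc j) * ((e + real (Suc j) - 1) / (B - 1 + real (Suc j)))
        = 2 * (f * g j) * ((B + j) * (j + 1/2)) / ((e + j) * (f + j)) * ((e + j) / (B + j))"
        by (simp add: gS add_ac)
      also have "\<dots> = 2 * c j * (j + 1/2)"
        unfolding cg[symmetric] using nz(1,3,4)[of j] by (simp add: less_imp_neq[symmetric])
      finally show ?thesis by simp
    qed
    have bb: "b' (2 * n) (2 * Suc j) x = b (2 * n) (Suc (2 * j)) x" by simp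
    have "c j * (2 * (f + j) * (u + p) - (2 * real j + 1) * q)
      = 2 * f * (g j * (u + (K + n) / (B - 1 + j) * p))
        + (2 * f * g j * ((e + j - 1) / (B - 1 + j)) * p - c j * (2 * real j + 1) * q)" for u p q :: real
    proof -
      have "c j * (2 * (f + j) * (u + p) - (2 * real j + 1) * q) = 2 * (c j * (f + j)) * (u + p) - c j * (2 * real j + 1) * q"
        by (simp only: algebra_simps)
      then show ?thesis unfolding cg 1 by (simp add: algebra_simps)
    qed
    then show "c j * (2 * (f + j) * (a (2 * n) (2 * j) x + b' (2 * n) (2 * j) x)
       - (2 * real j + 1) * b (2 * n) (Suc (2 * j)) x)
      = 2 * f * (g j * (a (2 * n) (2 * j) x + (K + n) / (B - 1 + j) * b' (2 * n) (2 * j) x)) + (P j - P (Suc j))"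
      unfolding P_def 2 bb by blast
  qed (simp_all add: P_def vanish)
  finally show "T i1 (h0_2 k k1 i1 i2 n) x = 2 * (K + k + n + 1) * h0_1 k k1 i1 i2 n x"
    unfolding h0_1_eq B_def[symmetric] e_def[symmetric] f_def[symmetric] g_def sum_distrib_left[symmetric]
    by (simp only: mult_ac)
qed

lemma T_lincomb2:
  assumes "\<And>j. real_polynomial_function (u j)" "\<And>j. real_polynomial_function (v j)"
  shows "T i (\<lambda>x. \<Sum>j\<le>n. c j * u j x + d j * v j x) = (\<lambda>x. \<Sum>j\<le>(n::nat). c j * T i (u j) x + d j * T i (v j) x)"
  by (simp add: dunkl_sum dunkl_scale dunkl_add poly_cmult assms real_polynomial_function.intros(3))

lemma x1_poly: "real_polynomial_function f \<Longrightarrow> real_polynomial_function (\<lambda>x. x $ i1 * f x)"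
  by (intro real_polynomial_function.intros(4) poly_coord)

lemma chain_4_3: "T i1 (h0_0 k k1 i1 i2 (Suc n)) = (\<lambda>x. 2 * (K + n + 1) * h0_3 k k1 i1 i2 n x)"
proof
  fix x
  define B where "B = 2 * K + k1 + 5/2 + 2 * n"
  define e where "e = K + k1 + 3/2 + n"
  define f where "f = K + k + n + 2"
  define g where "g j = hyp B e f j" for j
  note pos = K_pos k_pos k1_pos
  have nz: "f + j > 0" "e + j > 0" for j :: nat
    using pos by (simp_all add: B_def e_def f_def)
  have gS: "g (Suc j) * (f + j) = g j * ((B + j) * (j + 1/2)) / (e + j)" for j :: nat
    using nz(1)[of j] by (simp add: g_def hyp_Suc)
  let ?m = "Suc (2 * n)"
  define P where "P j = 2 * (g j * (f - 1 + j)) * (a' ?m (2 * j) x + b'' ?m (2 * j) x)" for j :: nat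
  define R where "R j = 2 * (K + n + 1) * (g j / (e + j) * ((j + 1/2) * a ?m (Suc (2 * j)) x - (e - 1/2) * b ?m (2 * j) x))" for j :: nat
  have "h0_0 k k1 i1 i2 (Suc n) = (\<lambda>x. \<Sum>j\<le>Suc n. g j * a (Suc ?m) (2 * j) x)"
  proof
    fix x
    have "2 * K + k1 + 1/2 + real (Suc ?m) = B" "K + k1 + 1/2 + real (Suc n) = e" "K + k + real (Suc n) + 1 = f"
      "2 * Suc n = Suc ?m" by (simp_all add: B_def e_def f_def)
    then show "h0_0 k k1 i1 i2 (Suc n) x = (\<Sum>j\<le>Suc n. g j * a (Suc ?m) (2 * j) x)"
      by (simp only: h0_0_eq g_def)
  qed
  then have "T i1 (h0_0 k k1 i1 i2 (Suc n)) x = (\<Sum>j\<le>Suc n. g j * T i1 (a (Suc ?m) (2 * j)) x)"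
    by (simp only: T_lincomb[OF ab_poly(1)])
  also have "\<dots> = x $ i1 * (\<Sum>j\<le>Suc n. g j * (2 * (f - 1 + j) * (a' ?m (2 * j) x + b'' ?m (2 * j) x)
       - (2 * real j + 1) * a ?m (Suc (2 * j)) x - (2 * n + 2 * real j + 3 + 2 * K) * b ?m (2 * j) x))"
    unfolding sum_distrib_left
    by (rule sum.cong) (simp_all only: T1_a, simp add: f_def algebra_simps)
  also have "(\<Sum>j\<le>Suc n. g j * (2 * (f - 1 + j) * (a' ?m (2 * j) x + b'' ?m (2 * j) x)
       - (2 * real j + 1) * a ?m (Suc (2 * j)) x - (2 * n + 2 * real j + 3 + 2 * K) * b ?m (2 * j) x))
    = (\<Sum>j\<le>Suc n. R j)"
  proof (rule sum_telescope_eq[where P = P])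
    fix j :: nat
    have *: "g * (2 * F * p - 2 * h * u - (2 * h + 2 * A) * v)
      = 2 * A * (g / E * (h * u - (E - h) * v)) + (2 * (g * F) * p - 2 * (g * ((E + A) * h) / E) * (u + v))"
      if "E > 0" for g F p h u v E A :: real
      using that by (simp add: field_simps)
    have P1: "P (Suc j) = 2 * (g j * ((B + j) * (j + 1/2)) / (e + j)) * (a ?m (Suc (2 * j)) x + b ?m (2 * j) x)"
      unfolding gS[symmetric] by (simp add: P_def)
    have c: "e + j + (K + n + 1) = B + j" "e + j - (j + 1/2) = e - 1/2" "2 * (j + 1/2) = 2 * real j + 1"
      "2 * real j + 1 + 2 * (K + n + 1) = 2 * n + 2 * real j + 3 + 2 * K"
      by (simp_all add: B_def e_def)
    show "g j * (2 * (f - 1 + j) * (a' ?m (2 * j) x + b'' ?m (2 * j) x)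
       - (2 * real j + 1) * a ?m (Suc (2 * j)) x - (2 * n + 2 * real j + 3 + 2 * K) * b ?m (2 * j) x)
      = R j + (P j - P (Suc j))"
      using *[OF nz(2)[of j], of "g j" "f - 1 + j" "a' ?m (2 * j) x + b'' ?m (2 * j) x" "j + 1/2"
          "a ?m (Suc (2 * j)) x" "K + n + 1" "b ?m (2 * j) x"]
      unfolding P1 R_def unfolding P_def c .
  qed (simp_all add: P_def vanish)
  also have "(\<Sum>j\<le>Suc n. R j) = (\<Sum>j\<le>n. R j)"
    by (simp add: R_def vanish)
  finally show "T i1 (h0_0 k k1 i1 i2 (Suc n)) x = 2 * (K + n + 1) * h0_3 k k1 i1 i2 n x"
    unfolding h0_3_eq B_def[symmetric] e_def[symmetric] f_def[symmetric] g_def R_def sum_distrib_left[symmetric]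
    by (simp only: mult_ac Suc_eq_plus1)
qed

lemma chain_1_0: "T i1 (h0_1 k k1 i1 i2 n) = (\<lambda>x. 2 * (K + k1 + 1/2 + n) * h0_0 k k1 i1 i2 n x)"
proof
  fix x
  define B where "B = 2 * K + k1 + 3/2 + 2 * n"
  define e where "e = K + k1 + 3/2 + n"
  define f where "f = K + k + n + 1"
  define g where "g j = hyp B e f j" for j
  note pos = K_pos k_pos k1_pos
  have nz: "f + j > 0" "B - 1 + j > 0" "e + j > 0" "B + j > 0" for j :: nat
    using pos by (simp_all add: B_def e_def f_def)
  have gS: "g (Suc j) * ((e + j) * (f + j) / (B + j)) = g j * (j + 1/2)" for j :: nat
    using nz(1,3,4)[of j] by (simp add: g_def hyp_Suc)
  have H: "(e - 1) * hyp (B - 1) (e - 1) f j = g j * (B - 1) * (e - 1 + j) / (B - 1 + j)" for j :: nat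
  proof -
    have "e > 1" using pos by (simp add: e_def)
    then have "hyp (B - 1) (e - 1) f j * (e - 1) = hyp (B - 1) e f j * (e - 1 + j)"
      by (rule hyp_shift_den)
    also have "hyp (B - 1) e f j = g j * (B - 1) / (B - 1 + j)"
      using hyp_shift_num[of B e f j] nz(2)[of j] by (simp add: g_def field_simps)
    finally show ?thesis by (simp add: mult_ac)
  qed
  define P where "P j = 2 * (g j * ((e - 1 + j) * (f - 1 + j) / (B - 1 + j))) * b' (2 * n) (2 * j) x" for j :: nat
  define G where "G j = g j * ((K + n) / (B - 1 + j))" for j :: nat
  have "h0_1 k k1 i1 i2 n = (\<lambda>x. \<Sum>j\<le>n. g j * (x $ i1 * a (2 * n) (2 * j) x) + G j * (x $ i1 * b' (2 * n) (2 * j) x))"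
    unfolding h0_1_eq B_def[symmetric] e_def[symmetric] f_def[symmetric] G_def g_def sum_distrib_left
    by (simp only: algebra_simps)
  then have "T i1 (h0_1 k k1 i1 i2 n) x = (\<Sum>j\<le>n. g j * T i1 (\<lambda>x. x $ i1 * a (2 * n) (2 * j) x) x
     + G j * T i1 (\<lambda>x. x $ i1 * b' (2 * n) (2 * j) x) x)"
    by (simp only: T_lincomb2[OF x1_poly[OF ab_poly(1)] x1_poly[OF ab_poly(3)]])
  also have "\<dots> = (\<Sum>j\<le>n. 2 * ((e - 1) * hyp (B - 1) (e - 1) f j) * a (2 * n) (2 * j) x)"
  proof (rule sum_telescope_eq[where P = P])
    fix j :: nat
    have *: "g * (2 * E * u + (2 * J + 2 * k) * p - 2 * h * q) + g * (A / (E + A + J)) * (2 * J * u + (2 * E - 2 * k) * p)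
      = 2 * (g * (E + A) * (E + J) / (E + A + J)) * u
        + (2 * (g * ((E + J) * (A + k + J) / (E + A + J))) * p - 2 * (g * h) * q)"
      if "E + A + J > 0" for g E u J k p h q A :: real
    proof -
      define D where "D = E + A + J"
      have D: "D \<noteq> 0" using that by (simp add: D_def)
      have 1: "g * (2 * E) + g * (A / D) * (2 * J) = 2 * (g * (E + A) * (E + J) / D)"
        using D by (simp add: field_simps) (simp add: D_def algebra_simps)
      have 2: "g * (2 * J + 2 * k) + g * (A / D) * (2 * E - 2 * k) = 2 * (g * ((E + J) * (A + k + J) / D))"
        using D by (simp add: field_simps) (simp add: D_def algebra_simps)
      have "g * (2 * E * u + (2 * J + 2 * k) * p - 2 * h * q) + g * (A / D) * (2 * J * u + (2 * E - 2 * k) * p)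
        = (g * (2 * E) + g * (A / D) * (2 * J)) * u + ((g * (2 * J + 2 * k) + g * (A / D) * (2 * E - 2 * k)) * p - 2 * (g * h) * q)"
        by (simp only: algebra_simps)
      then show ?thesis unfolding 1 2 unfolding D_def .
    qed
    have c: "e - 1 + (K + n) + j = B - 1 + j" "e - 1 + (K + n) = B - 1" "K + n + k + j = f - 1 + j"
      by (simp_all add: B_def e_def f_def)
    have P1: "P (Suc j) = 2 * (g j * (j + 1/2)) * b (2 * n) (Suc (2 * j)) x"
      unfolding gS[symmetric] P_def by (simp add: add_ac)
    have t: "T i1 (\<lambda>x. x $ i1 * a (2 * n) (2 * j) x) x = 2 * (e - 1) * a (2 * n) (2 * j) x
        + (2 * real j + 2 * k) * b' (2 * n) (2 * j) x - 2 * (j + 1/2) * b (2 * n) (Suc (2 * j)) x"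
      "T i1 (\<lambda>x. x $ i1 * b' (2 * n) (2 * j) x) x = 2 * real j * a (2 * n) (2 * j) x
        + (2 * (e - 1) - 2 * k) * b' (2 * n) (2 * j) x"
      unfolding T1_x1_a T1_x1_b' by (simp_all add: e_def algebra_simps)
    have "e - 1 + (K + n) + j > 0" using nz(2)[of j] c by simp
    from *[OF this, of "g j" "a (2 * n) (2 * j) x" k "b' (2 * n) (2 * j) x" "j + 1/2" "b (2 * n) (Suc (2 * j)) x"]
    show "g j * T i1 (\<lambda>x. x $ i1 * a (2 * n) (2 * j) x) x + G j * T i1 (\<lambda>x. x $ i1 * b' (2 * n) (2 * j) x) x
      = 2 * ((e - 1) * hyp (B - 1) (e - 1) f j) * a (2 * n) (2 * j) x + (P j - P (Suc j))"
      unfolding t H P1 unfolding P_def G_def c .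
  qed (simp_all add: P_def vanish)
  finally show "T i1 (h0_1 k k1 i1 i2 n) x = 2 * (K + k1 + 1/2 + n) * h0_0 k k1 i1 i2 n x"
  proof -
    have "2 * K + k1 + 1/2 + real (2 * n) = B - 1" "K + k1 + 1/2 + real n = e - 1" "K + k + real n + 1 = f"
      by (simp_all add: B_def e_def f_def)
    moreover assume "T i1 (h0_1 k k1 i1 i2 n) x = (\<Sum>j\<le>n. 2 * ((e - 1) * hyp (B - 1) (e - 1) f j) * a (2 * n) (2 * j) x)"
    ultimately show ?thesis by (simp only: h0_0_eq sum_distrib_left mult.assoc)
  qed
qed

lemma split_affine: "X * (q * (h * u - w * v)) = q * h * (X * u) + - (q * w) * (X * v)"
  for X q h u w v :: real
  by (simp add: algebra_simps)

lemma combine_1: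
  fixes c d w J u v q m z :: real
  assumes "c * (2 * w) = d * (2 * J + 1)"
  shows "c * (2 * w * u + m * v - 2 * (J + 1) * q) + - d * ((2 * J + 1) * u + z * v)
    = (c * m + - d * z) * v - 2 * (J + 1) * c * q"
proof -
  have "c * (2 * w * u + m * v - 2 * (J + 1) * q) + - d * ((2 * J + 1) * u + z * v)
    = (c * (2 * w) - d * (2 * J + 1)) * u + (c * m + - d * z) * v - 2 * (J + 1) * c * q"
    by (simp add: algebra_simps)
  then show ?thesis unfolding assms by simp
qed

lemma combine_2:
  fixes c d F J u v q p M N :: real
  shows "c * (2 * F * (u - p) - 2 * (J + 1) * v + M * q) + - d * (- 2 * F * (u - p) - N * q)
    = (c + d) * (2 * F * (u - p)) - 2 * (c * (J + 1)) * v + (c * M + d * N) * q"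
  by (simp add: algebra_simps)

lemma chain_3_2: "T i1 (h0_3 k k1 i1 i2 n) = (\<lambda>x. - 2 * (K - k + k1 + 1/2 + n) * h0_2 k k1 i1 i2 n x)"
proof
  fix x
  define B where "B = 2 * K + k1 + 5/2 + 2 * n"
  define e where "e = K + k1 + 3/2 + n"
  define f where "f = K + k + n + 2"
  define g where "g j = hyp B e f j" for j
  note pos = K_pos k_pos k1_pos
  have nz: "f + j > 0" "B - 1 + j > 0" "e + j > 0" "B + j > 0" for j :: nat
    using pos by (simp_all add: B_def e_def f_def)
  have gS: "g (Suc j) * ((f + j) / (B + j)) = g j * (j + 1/2) / (e + j)" for j :: nat
    using nz(1,3,4)[of j] by (simp add: g_def hyp_Suc)
  have H: "hyp (B - 1) e f j = g j * (B - 1) / (B - 1 + j)" for j :: nat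
    using hyp_shift_num[of B e f j] nz(2)[of j] by (simp add: g_def field_simps)
  let ?m = "Suc (2 * n)"
  define P where "P j = 2 * real j * (g j * ((f - 1 + j) / (B - 1 + j))) * b ?m (2 * j) x" for j :: nat
  define c where "c j = g j / (e + j) * (j + 1/2)" for j :: nat
  define d where "d j = - (g j / (e + j) * (e - 1/2))" for j :: nat
  have "h0_3 k k1 i1 i2 n = (\<lambda>x. \<Sum>j\<le>n. c j * (x $ i1 * a ?m (Suc (2 * j)) x) + d j * (x $ i1 * b ?m (2 * j) x))"
    unfolding h0_3_eq B_def[symmetric] e_def[symmetric] f_def[symmetric] c_def d_def g_def sum_distrib_left Suc_eq_plus1
    by (intro ext sum.cong refl split_affine)
  then have "T i1 (h0_3 k k1 i1 i2 n) x = (\<Sum>j\<le>n. c j * T i1 (\<lambda>x. x $ i1 * a ?m (Suc (2 * j)) x) x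
     + d j * T i1 (\<lambda>x. x $ i1 * b ?m (2 * j) x) x)"
    by (simp only: T_lincomb2[OF x1_poly[OF ab_poly(1)] x1_poly[OF ab_poly(2)]])
  also have "\<dots> = (\<Sum>j\<le>n. - 2 * (e - 1 - k) * (hyp (B - 1) e f j * b ?m (2 * j) x))"
  proof (rule sum_telescope_eq[where P = P])
    fix j :: nat
    have *: "g / E * (J + 1/2) * (2 * (E - J - 1/2) * u + (2 * J + 1 + 2 * k) * v - 2 * (J + 1) * q)
       + - (g / E * (E - J - 1/2)) * ((2 * J + 1) * u + (2 * (E - J - 1/2) - 2 * k) * v)
      = - 2 * (E - J - 1 - k) * (g * (E - J + A) / (E + A) * v)
        + (2 * J * (g * ((A + k + 1 + J) / (E + A))) * v - 2 * (J + 1) * (g * (J + 1/2) / E) * q)"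
      if "E > 0" "E + A > 0" for g E u J k v q A :: real
    proof -
      define D where "D = E + A"
      have D: "D \<noteq> 0" "E \<noteq> 0" using that by (simp_all add: D_def)
      have 1: "g / E * (J + 1/2) * (2 * J + 1 + 2 * k) + - (g / E * (E - J - 1/2)) * (2 * (E - J - 1/2) - 2 * k)
        = 2 * g * (2 * J + 1 - E + k)"
        using D by (simp add: field_simps)
      have 2: "2 * g * (2 * J + 1 - E + k) = - 2 * (E - J - 1 - k) * (g * (E - J + A) / D) + 2 * J * (g * ((A + k + 1 + J) / D))"
        using D by (simp add: field_simps) (simp add: D_def algebra_simps)
      have "(J + 1/2) * (2 * (E - J - 1/2)) = (E - J - 1/2) * (2 * J + 1)"
        by (simp add: algebra_simps)
      then have 3: "g / E * (J + 1/2) * (2 * (E - J - 1/2)) = g / E * (E - J - 1/2) * (2 * J + 1)"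
        by (simp only: mult.assoc)
      have 4: "g / E * (J + 1/2) = g * (J + 1/2) / E" by simp
      show ?thesis
        unfolding combine_1[OF 3] 1 2 unfolding D_def 4 by (simp only: distrib_right mult.assoc add_diff_eq)
    qed
    have cc: "e + j - j - 1/2 = e - 1/2" "e + j - j - 1 - k = e - 1 - k" "e + j - j + (K + n) = B - 1"
      "e + j + (K + n) = B - 1 + j" "K + n + k + 1 + j = f - 1 + j" "e + j - real j = e" "e + (K + n) = B - 1"
      by (simp_all add: B_def e_def f_def)
    have P1: "P (Suc j) = 2 * (real j + 1) * (g j * (j + 1/2) / (e + j)) * b ?m (Suc (Suc (2 * j))) x"
      unfolding gS[symmetric] P_def by (simp add: add_ac)
    have t: "T i1 (\<lambda>x. x $ i1 * a ?m (Suc (2 * j)) x) x = 2 * (e - 1/2) * a ?m (Suc (2 * j)) x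
        + (2 * real j + 1 + 2 * k) * b ?m (2 * j) x - 2 * (real j + 1) * b ?m (Suc (Suc (2 * j))) x"
      "T i1 (\<lambda>x. x $ i1 * b ?m (2 * j) x) x = (2 * real j + 1) * a ?m (Suc (2 * j)) x
        + (2 * (e - 1/2) - 2 * k) * b ?m (2 * j) x"
      unfolding T1_x1_a T1_x1_b by (simp_all add: e_def algebra_simps)
    have "e + j + (K + n) > 0" using nz(2)[of j] cc by simp
    from *[OF nz(3)[of j] this, of "g j" j "a ?m (Suc (2 * j)) x" k "b ?m (2 * j) x" "b ?m (Suc (Suc (2 * j))) x"]
    show "c j * T i1 (\<lambda>x. x $ i1 * a ?m (Suc (2 * j)) x) x + d j * T i1 (\<lambda>x. x $ i1 * b ?m (2 * j) x) x
      = - 2 * (e - 1 - k) * (hyp (B - 1) e f j * b ?m (2 * j) x) + (P j - P (Suc j))"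
      unfolding t H P1 unfolding P_def c_def d_def cc by (simp add: mult_ac)
  qed (simp_all add: P_def vanish)
  finally have "T i1 (h0_3 k k1 i1 i2 n) x = (\<Sum>j\<le>n. - 2 * (e - 1 - k) * (hyp (B - 1) e f j * b ?m (2 * j) x))" .
  moreover have "2 * K + k1 + 3/2 + real (2 * n) = B - 1" "K + k1 + 3/2 + real n = e" "K + k + real n + 2 = f"
    "K - k + k1 + 1/2 + real n = e - 1 - k"
    by (simp_all add: B_def e_def f_def)
  ultimately show "T i1 (h0_3 k k1 i1 i2 n) x = - 2 * (K - k + k1 + 1/2 + n) * h0_2 k k1 i1 i2 n x"
    by (simp only: h0_2_eq sum_distrib_left Suc_eq_plus1)
qed

lemma chain_3_1: "T i2 (h0_3 k k1 i1 i2 n) = (\<lambda>x. 2 * (K + k + n + 1) * h1_1 k k1 i1 i2 n x)"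
proof
  fix x
  define B where "B = 2 * K + k1 + 5/2 + 2 * n"
  define e where "e = K + k1 + 3/2 + n"
  define f where "f = K + k + n + 2"
  define g where "g j = hyp B e f j" for j
  note pos = K_pos k_pos k1_pos
  have nz: "f + j > 0" "B - 1 + j > 0" "e + j > 0" "B + j > 0" for j :: nat
    using pos by (simp_all add: B_def e_def f_def)
  have gS: "g (Suc j) * (f + j) = g j * ((B + j) * (j + 1/2)) / (e + j)" for j :: nat
    using nz(1)[of j] by (simp add: g_def hyp_Suc)
  have H: "(f - 1) * hyp (B - 1) e (f - 1) j = g j * (B - 1) / (B - 1 + j) * (f - 1 + j)" for j :: nat
  proof -
    have "f > 1" using pos by (simp add: f_def)
    from hyp_shift_den[OF this, of "B - 1" e j]
    have "hyp (B - 1) e (f - 1) j * (f - 1) = hyp (B - 1) e f j * (f - 1 + j)"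
      by (simp only: hyp_commute[of "B - 1" e])
    also have "hyp (B - 1) e f j = g j * (B - 1) / (B - 1 + j)"
      using hyp_shift_num[of B e f j] nz(2)[of j] by (simp add: g_def field_simps)
    finally show ?thesis by (simp add: mult_ac)
  qed
  let ?m = "Suc (2 * n)"
  define P where "P j = 2 * (real j / (B - 1 + j)) * (g j * (f - 1 + j)) * a (2 * n) (2 * j) x
      - 2 * (g j * (f - 1 + j)) * b' (2 * n) (2 * j) x" for j :: nat
  define c where "c j = g j / (e + j) * (j + 1/2)" for j :: nat
  define d where "d j = - (g j / (e + j) * (e - 1/2))" for j :: nat
  have "h0_3 k k1 i1 i2 n = (\<lambda>x. \<Sum>j\<le>n. c j * (x $ i1 * a ?m (Suc (2 * j)) x) + d j * (x $ i1 * b ?m (2 * j) x))"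
    unfolding h0_3_eq B_def[symmetric] e_def[symmetric] f_def[symmetric] c_def d_def g_def sum_distrib_left Suc_eq_plus1
    by (intro ext sum.cong refl split_affine)
  then have "T i2 (h0_3 k k1 i1 i2 n) x = (\<Sum>j\<le>n. c j * T i2 (\<lambda>x. x $ i1 * a ?m (Suc (2 * j)) x) x
     + d j * T i2 (\<lambda>x. x $ i1 * b ?m (2 * j) x) x)"
    by (simp only: T_lincomb2[OF x1_poly[OF ab_poly(1)] x1_poly[OF ab_poly(2)]])
  also have "\<dots> = x $ i1 * x $ i2 * (\<Sum>j\<le>n. c j * (2 * (f - 1 + j) * (a (2 * n) (2 * j) x - b' (2 * n) (2 * j) x)
        - 2 * (real j + 1) * a (2 * n) (Suc (Suc (2 * j))) x + (2 * n + 2 * real j + 3 + 2 * K) * b (2 * n) (Suc (2 * j)) x)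
     + d j * (- 2 * (f - 1 + j) * (a (2 * n) (2 * j) x - b' (2 * n) (2 * j) x) - (2 * real j + 1) * b (2 * n) (Suc (2 * j)) x))"
    unfolding sum_distrib_left
    by (rule sum.cong) (simp_all only: T2_x1_a T2_x1_b T2_a T2_b coeff_pCons_Suc, simp add: f_def algebra_simps)
  also have "(\<Sum>j\<le>n. c j * (2 * (f - 1 + j) * (a (2 * n) (2 * j) x - b' (2 * n) (2 * j) x)
        - 2 * (real j + 1) * a (2 * n) (Suc (Suc (2 * j))) x + (2 * n + 2 * real j + 3 + 2 * K) * b (2 * n) (Suc (2 * j)) x)
     + d j * (- 2 * (f - 1 + j) * (a (2 * n) (2 * j) x - b' (2 * n) (2 * j) x) - (2 * real j + 1) * b (2 * n) (Suc (2 * j)) x))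
    = (\<Sum>j\<le>n. 2 * ((f - 1) * hyp (B - 1) e (f - 1) j) * a (2 * n) (2 * j) x)"
  proof (rule sum_telescope_eq[where P = P])
    fix j :: nat
    have *: "g / E * (J + 1/2) * (2 * F * (u - p) - 2 * (J + 1) * v + (2 * J + 1 + 2 * A) * q)
        + - (g / E * (E - J - 1/2)) * (- 2 * F * (u - p) - (2 * J + 1) * q)
      = 2 * (g * (D - J) / D * F) * u
        + ((2 * (J / D) * (g * F) * u - 2 * (g * F) * p)
         - (2 * ((J + 1) / (E + A)) * (g * ((E + A) * (J + 1/2)) / E) * v - 2 * (g * ((E + A) * (J + 1/2)) / E) * q))"
      if "E > 0" "E + A > 0" "D > 0" for g E u J F v q p A D :: real
    proof -
      have 1: "g / E * (J + 1/2) + g / E * (E - J - 1/2) = g" "g * (D - J) / D + J / D * g = g"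
        "(J + 1) / (E + A) * (g * ((E + A) * (J + 1/2)) / E) = g / E * (J + 1/2) * (J + 1)"
        "g / E * (J + 1/2) * (2 * J + 1 + 2 * A) + g / E * (E - J - 1/2) * (2 * J + 1) = 2 * (g * ((E + A) * (J + 1/2)) / E)"
      proof -
        have S: "(J + 1) / S * (g * (S * h) / E) = g / E * h * (J + 1)" if "S \<noteq> 0" for S h
          using that by simp
        have "E + A \<noteq> 0" using that by simp
        then show "(J + 1) / (E + A) * (g * ((E + A) * (J + 1/2)) / E) = g / E * (J + 1/2) * (J + 1)"
          by (rule S)
      qed (use that in \<open>simp_all add: field_simps\<close>)
      have "g / E * (J + 1/2) * (2 * F * (u - p) - 2 * (J + 1) * v + (2 * J + 1 + 2 * A) * q)
        + - (g / E * (E - J - 1/2)) * (- 2 * F * (u - p) - (2 * J + 1) * q)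
        = g * (2 * F * (u - p)) - 2 * ((J + 1) / (E + A) * (g * ((E + A) * (J + 1/2)) / E)) * v
          + 2 * (g * ((E + A) * (J + 1/2)) / E) * q"
        unfolding combine_2 by (simp only: 1)
      also have "g * (2 * F * (u - p)) = 2 * (g * (D - J) / D + J / D * g) * F * u - 2 * (g * F) * p"
        unfolding 1 by (simp add: algebra_simps)
      finally show ?thesis by (simp add: algebra_simps)
    qed
    have cc: "e + j - j - 1/2 = e - 1/2" "B - 1 + j - j = B - 1" "e + j + (K + n + 1) = B + j"
      "2 * real j + 1 + 2 * (K + n + 1) = 2 * n + 2 * real j + 3 + 2 * K"
      by (simp_all add: B_def e_def f_def)
    have P1: "P (Suc j) = 2 * ((real j + 1) / (B + j)) * (g j * ((B + j) * (j + 1/2)) / (e + j)) * a (2 * n) (Suc (Suc (2 * j))) x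
        - 2 * (g j * ((B + j) * (j + 1/2)) / (e + j)) * b (2 * n) (Suc (2 * j)) x"
      unfolding gS[symmetric] P_def by (simp add: add_ac)
    have "e + j + (K + n + 1) > 0" using nz(4)[of j] cc by simp
    from *[OF nz(3)[of j] this nz(2)[of j], of "g j" j "f - 1 + j" "a (2 * n) (2 * j) x" "b' (2 * n) (2 * j) x"
        "a (2 * n) (Suc (Suc (2 * j))) x" "b (2 * n) (Suc (2 * j)) x"]
    show "c j * (2 * (f - 1 + j) * (a (2 * n) (2 * j) x - b' (2 * n) (2 * j) x)
        - 2 * (real j + 1) * a (2 * n) (Suc (Suc (2 * j))) x + (2 * n + 2 * real j + 3 + 2 * K) * b (2 * n) (Suc (2 * j)) x)
     + d j * (- 2 * (f - 1 + j) * (a (2 * n) (2 * j) x - b' (2 * n) (2 * j) x) - (2 * real j + 1) * b (2 * n) (Suc (2 * j)) x)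
      = 2 * ((f - 1) * hyp (B - 1) e (f - 1) j) * a (2 * n) (2 * j) x + (P j - P (Suc j))"
      unfolding H P1 unfolding P_def c_def d_def cc .
  qed (simp_all add: P_def vanish)
  finally have "T i2 (h0_3 k k1 i1 i2 n) x = x $ i1 * x $ i2 *
      (\<Sum>j\<le>n. 2 * (f - 1) * (hyp (B - 1) e (f - 1) j * a (2 * n) (2 * j) x))"
    by (simp only: mult.assoc)
  moreover have "2 * K + k1 + 3/2 + real (2 * n) = B - 1" "K + k1 + 3/2 + real n = e" "K + k + real n + 1 = f - 1"
    by (simp_all add: B_def e_def f_def)
  ultimately show "T i2 (h0_3 k k1 i1 i2 n) x = 2 * (K + k + n + 1) * h1_1 k k1 i1 i2 n x"
    by (simp only: h1_1_eq sum_distrib_left[symmetric]) (simp only: mult_ac)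
qed

lemma chain_5_3: "T i2 (h0_1 k k1 i1 i2 (Suc n)) = (\<lambda>x. 2 * (K + n + 1) * h1_3 k k1 i1 i2 n x)"
proof
  fix x
  define B where "B = 2 * K + k1 + 7/2 + 2 * n"
  define e where "e = K + k1 + 5/2 + n"
  define f where "f = K + k + n + 2"
  define g where "g j = hyp B e f j" for j
  note pos = K_pos k_pos k1_pos
  have nz: "f + j > 0" "B - 1 + j > 0" "e + j > 0" "B + j > 0" for j :: nat
    using pos by (simp_all add: B_def e_def f_def)
  have gS: "g (Suc j) * ((e + j) * (f + j) / (B + j)) = g j * (j + 1/2)" for j :: nat
    using nz(1,3,4)[of j] by (simp add: g_def hyp_Suc)
  have H: "hyp (B - 1) e f j = g j * (B - 1) / (B - 1 + j)" for j :: nat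
    using hyp_shift_num[of B e f j] nz(2)[of j] by (simp add: g_def field_simps)
  let ?m = "Suc (2 * n)"
  define G where "G j = g j * ((K + n + 1) / (B - 1 + j))" for j :: nat
  define P where "P j = 2 * (g j * ((e - 1 + j) * (f - 1 + j) / (B - 1 + j))) * (a' ?m (2 * j) x - b'' ?m (2 * j) x)" for j :: nat
  define R where "R j = 2 * (K + n + 1) * (hyp (B - 1) e f j * b ?m (2 * j) x)" for j :: nat
  have "h0_1 k k1 i1 i2 (Suc n) = (\<lambda>x. \<Sum>j\<le>Suc n. g j * (x $ i1 * a (Suc ?m) (2 * j) x) + G j * (x $ i1 * b' (Suc ?m) (2 * j) x))"
  proof
    fix x
    have "2 * K + k1 + 3/2 + real (Suc ?m) = B" "K + k1 + 3/2 + real (Suc n) = e" "K + k + real (Suc n) + 1 = f"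
      "2 * Suc n = Suc ?m" "K + real (Suc n) = K + n + 1" by (simp_all add: B_def e_def f_def)
    then have "h0_1 k k1 i1 i2 (Suc n) x = x $ i1 * (\<Sum>j\<le>Suc n. g j *
      (a (Suc ?m) (2 * j) x + (K + n + 1) / (B - 1 + j) * b' (Suc ?m) (2 * j) x))"
      by (simp only: h0_1_eq g_def)
    then show "h0_1 k k1 i1 i2 (Suc n) x = (\<Sum>j\<le>Suc n. g j * (x $ i1 * a (Suc ?m) (2 * j) x) + G j * (x $ i1 * b' (Suc ?m) (2 * j) x))"
      unfolding G_def sum_distrib_left by (simp only: algebra_simps)
  qed
  then have "T i2 (h0_1 k k1 i1 i2 (Suc n)) x = (\<Sum>j\<le>Suc n. g j * T i2 (\<lambda>x. x $ i1 * a (Suc ?m) (2 * j) x) x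
     + G j * T i2 (\<lambda>x. x $ i1 * b' (Suc ?m) (2 * j) x) x)"
    by (simp only: T_lincomb2[OF x1_poly[OF ab_poly(1)] x1_poly[OF ab_poly(3)]])
  also have "\<dots> = x $ i1 * x $ i2 * (\<Sum>j\<le>Suc n. g j * (2 * (f - 1 + j) * (a' ?m (2 * j) x - b'' ?m (2 * j) x)
        - 2 * (j + 1/2) * a ?m (Suc (2 * j)) x + (2 * (K + n + 1) + 2 * (j + 1/2)) * b ?m (2 * j) x)
     + G j * (- 2 * (f - 1 + j) * (a' ?m (2 * j) x - b'' ?m (2 * j) x) - 2 * real j * b ?m (2 * j) x))"
    unfolding sum_distrib_left
    by (rule sum.cong) (simp_all only: T2_x1_a T2_x1_b' T2_a, simp add: f_def algebra_simps)
  also have "(\<Sum>j\<le>Suc n. g j * (2 * (f - 1 + j) * (a' ?m (2 * j) x - b'' ?m (2 * j) x)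
        - 2 * (j + 1/2) * a ?m (Suc (2 * j)) x + (2 * (K + n + 1) + 2 * (j + 1/2)) * b ?m (2 * j) x)
     + G j * (- 2 * (f - 1 + j) * (a' ?m (2 * j) x - b'' ?m (2 * j) x) - 2 * real j * b ?m (2 * j) x))
    = (\<Sum>j\<le>Suc n. R j)"
  proof (rule sum_telescope_eq[where P = P])
    fix j :: nat
    have *: "g * (2 * F * p - 2 * h * u + (2 * A + 2 * h) * v) + g * (A / D) * (- 2 * F * p - 2 * J * v)
      = 2 * A * (g * (D - J) / D * v) + (2 * (g * ((D - A) * F / D)) * p - 2 * (g * h) * (u - v))"
      if "D > 0" for g F p h u A v J D :: real
      using that by (simp add: field_simps)
    have cc: "B - 1 + j - (K + n + 1) = e - 1 + j" "B - 1 + j - j = B - 1"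
      by (simp_all add: B_def e_def f_def)
    have P1: "P (Suc j) = 2 * (g j * (j + 1/2)) * (a ?m (Suc (2 * j)) x - b ?m (2 * j) x)"
      unfolding gS[symmetric] P_def by (simp add: add_ac)
    from *[OF nz(2)[of j], of "g j" "f - 1 + j" "a' ?m (2 * j) x - b'' ?m (2 * j) x" "j + 1/2"
        "a ?m (Suc (2 * j)) x" "K + n + 1" "b ?m (2 * j) x" j]
    show "g j * (2 * (f - 1 + j) * (a' ?m (2 * j) x - b'' ?m (2 * j) x)
        - 2 * (j + 1/2) * a ?m (Suc (2 * j)) x + (2 * (K + n + 1) + 2 * (j + 1/2)) * b ?m (2 * j) x)
     + G j * (- 2 * (f - 1 + j) * (a' ?m (2 * j) x - b'' ?m (2 * j) x) - 2 * real j * b ?m (2 * j) x)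
      = R j + (P j - P (Suc j))"
      unfolding R_def H P1 unfolding P_def G_def cc .
  qed (simp_all add: P_def vanish)
  also have "(\<Sum>j\<le>Suc n. R j) = (\<Sum>j\<le>n. R j)"
    by (simp add: R_def vanish)
  finally have "T i2 (h0_1 k k1 i1 i2 (Suc n)) x = x $ i1 * x $ i2 * (\<Sum>j\<le>n. R j)" .
  moreover have "2 * K + k1 + 5/2 + real (2 * n) = B - 1" "K + k1 + 5/2 + real n = e" "K + k + real n + 2 = f"
    by (simp_all add: B_def e_def f_def)
  ultimately show "T i2 (h0_1 k k1 i1 i2 (Suc n)) x = 2 * (K + n + 1) * h1_3 k k1 i1 i2 n x"
    by (simp only: h1_3_eq R_def sum_distrib_left[symmetric] Suc_eq_plus1) (simp only: mult_ac)
qed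

end

section \<open>The basis\<close>

context planar_chain
begin

abbreviation "h0 n \<equiv> h_planar k k1 i1 i2 n 0"
abbreviation "h1 n \<equiv> h_planar k k1 i1 i2 n 1"

lemma h_mod4:
  "h0 (4 * m) = h0_0 k k1 i1 i2 m" "h0 (4 * m + 1) = h0_1 k k1 i1 i2 m"
  "h0 (4 * m + 2) = h0_2 k k1 i1 i2 m" "h0 (4 * m + 3) = h0_3 k k1 i1 i2 m"
  "h1 (4 * m) = (\<lambda>x. h0_1 k k1 i1 i2 m (refl_swap i1 i2 x))" "h1 (4 * m + 1) = h1_1 k k1 i1 i2 m"
  "h1 (4 * m + 2) = (\<lambda>x. h0_3 k k1 i1 i2 m (refl_swap i1 i2 x))" "h1 (4 * m + 3) = h1_3 k k1 i1 i2 m"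
proof -
  have "(4 * m + 1) div 4 = m" "(4 * m + 1) mod 4 = 1" "(4 * m + 2) div 4 = m" "(4 * m + 2) mod 4 = 2"
    "(4 * m + 3) div 4 = m" "(4 * m + 3) mod 4 = 3" by presburger+
  then show "h0 (4 * m) = h0_0 k k1 i1 i2 m" "h0 (4 * m + 1) = h0_1 k k1 i1 i2 m"
    "h0 (4 * m + 2) = h0_2 k k1 i1 i2 m" "h0 (4 * m + 3) = h0_3 k k1 i1 i2 m"
    "h1 (4 * m) = (\<lambda>x. h0_1 k k1 i1 i2 m (refl_swap i1 i2 x))" "h1 (4 * m + 1) = h1_1 k k1 i1 i2 m"
    "h1 (4 * m + 2) = (\<lambda>x. h0_3 k k1 i1 i2 m (refl_swap i1 i2 x))" "h1 (4 * m + 3) = h1_3 k k1 i1 i2 m"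
    unfolding h_planar_def Let_def by simp_all
qed

lemma mod4_cases:
  fixes n :: nat
  obtains m where "n = 4 * m" | m where "n = 4 * m + 1" | m where "n = 4 * m + 2" | m where "n = 4 * m + 3"
proof -
  have "n = 4 * (n div 4) \<or> n = 4 * (n div 4) + 1 \<or> n = 4 * (n div 4) + 2 \<or> n = 4 * (n div 4) + 3"
    by presburger
  then show ?thesis using that by blast
qed

lemma ladder_step: "\<exists>c. c \<noteq> 0 \<and> T i1 (h0 (Suc n)) = (\<lambda>x. c * h0 n x)"
proof (cases n rule: mod4_cases)
  case (1 m)
  have "Suc n = 4 * m + 1" using 1 by simp
  then show ?thesis unfolding 1 using h_mod4[of m] chain_1_0[of m] K_pos k1_pos
    by (intro exI[of _ "2 * (K + k1 + 1/2 + m)"]) simp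
next
  case (2 m)
  have "Suc n = 4 * m + 2" using 2 by simp
  then show ?thesis unfolding 2 using h_mod4[of m] chain_2_1[of m] K_pos k_pos
    by (intro exI[of _ "2 * (K + k + m + 1)"]) simp
next
  case (3 m)
  have "Suc n = 4 * m + 3" using 3 by simp
  then show ?thesis unfolding \<open>Suc n = 4 * m + 3\<close> unfolding 3 h_mod4 using chain_3_2[of m] K_ge k1_pos
    by (intro exI[of _ "- 2 * (K - k + k1 + 1/2 + m)"]) simp
next
  case (4 m)
  have "Suc n = 4 * Suc m" using 4 by simp
  then show ?thesis unfolding 4 using h_mod4[of m] h_mod4(1)[of "Suc m"] chain_4_3[of m] K_pos
    by (intro exI[of _ "2 * (K + m + 1)"]) simp
qed

lemma odd_step:
  assumes "odd n" shows "\<exists>c. c \<noteq> 0 \<and> T i2 (h0 (n + 2)) = (\<lambda>x. c * h1 n x)"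
proof (cases n rule: mod4_cases)
  case (2 m)
  have "n + 2 = 4 * m + 3" using 2 by simp
  then show ?thesis unfolding \<open>n + 2 = 4 * m + 3\<close> unfolding 2 h_mod4 using chain_3_1[of m] K_pos k_pos
    by (intro exI[of _ "2 * (K + k + m + 1)"]) simp
next
  case (4 m)
  have "n + 2 = 4 * Suc m + 1" using 4 by simp
  then show ?thesis unfolding 4 using h_mod4[of m] h_mod4(2)[of "Suc m"] chain_5_3[of m] K_pos
    by (intro exI[of _ "2 * (K + m + 1)"]) simp
qed (use assms in simp_all)

lemma even_swap: assumes "even n" shows "h1 n = (\<lambda>x. h0 (Suc n) (refl_swap i1 i2 x))"
proof (cases n rule: mod4_cases)
  case (1 m)
  have "Suc n = 4 * m + 1" using 1 by simp
  then show ?thesis unfolding 1 by (simp only: h_mod4)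
next
  case (3 m)
  have "Suc n = 4 * m + 3" using 3 by simp
  then show ?thesis unfolding 3 by (simp only: h_mod4)
qed (use assms in simp_all)

lemma even_normal_form:
  "h0_0 k k1 i1 i2 m = (\<lambda>x. \<Sum>j\<le>m. hyp (2 * K + k1 + 1/2 + 2 * m) (K + k1 + 1/2 + m) (K + k + m + 1) j * a (2 * m) (2 * j) x)"
  "h0_2 k k1 i1 i2 m = (\<lambda>x. \<Sum>j\<le>m. hyp (2 * K + k1 + 3/2 + 2 * m) (K + k1 + 3/2 + m) (K + k + m + 2) j * b (2 * m + 1) (2 * j) x)"
  by (rule ext, rule h0_0_eq h0_2_eq)+

lemma even_poly: "real_polynomial_function (h0_0 k k1 i1 i2 m)" "real_polynomial_function (h0_2 k k1 i1 i2 m)"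
  unfolding even_normal_form by (intro poly_fun_sum poly_cmult ab_poly)+

lemma even_off:
  assumes "i \<notin> {i1, i2}"
  shows "T i (h0_0 k k1 i1 i2 m) = (\<lambda>x. 0)" "T i (h0_2 k k1 i1 i2 m) = (\<lambda>x. 0)"
  using assms unfolding even_normal_form by (simp_all add: T_lincomb ab_poly dunkl_off_F)

lemma even_sym: "h0_0 k k1 i1 i2 m (refl_swap i1 i2 x) = h0_0 k k1 i1 i2 m x"
  "h0_2 k k1 i1 i2 m (refl_swap i1 i2 x) = - h0_2 k k1 i1 i2 m x"
  unfolding even_normal_form swap_ab by (simp_all add: sum_negf)

text \<open>
  On a function that the exchange \<open>\<sigma>\<^sub>1\<^sub>2\<close> multiplies by a sign, \<open>T\<^sub>2\<^sup>2\<close> is determined by \<open>T\<^sub>1\<^sup>2\<close>.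
\<close>

lemma T2_T2_swap:
  assumes f: "real_polynomial_function f" and s: "\<And>x. f (refl_swap i1 i2 x) = s * f x" "s * s = 1"
  shows "T i2 (T i2 f) = (\<lambda>x. s * T i1 (T i1 f) (refl_swap i1 i2 x))"
proof -
  have "f = (\<lambda>x. s * f (refl_swap i1 i2 x))"
    unfolding s(1) using s(2) by (simp add: mult.assoc[symmetric])
  then have "T i2 f = T i2 (\<lambda>x. s * f (refl_swap i1 i2 x))" by simp
  also have "\<dots> = (\<lambda>x. s * T i1 f (refl_swap i1 i2 x))"
    by (simp only: dunkl_scale[OF poly_reflect(2)[OF f]] dunkl_refl_swap(2)[OF f])
  finally show ?thesis
    by (simp only: dunkl_scale[OF poly_reflect(2)[OF dunkl_poly[OF f]]] dunkl_refl_swap(2)[OF dunkl_poly[OF f]])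
qed

lemma h0_0_const: "h0_0 k k1 i1 i2 0 = (\<lambda>x. 1)"
proof
  fix x :: "real ^ 'n"
  have q: "qpow c y $$ 0 = 1" for c y
    by (simp add: qpow_nth unit_pow_def rising_def one_pCons)
  have "(\<Prod>i\<in>A. qpow k (squares x i)) $$ 0 = 1" for A
    by (induction A rule: infinite_finite_induct) (simp_all add: fps_mult_nth_0 q)
  then have "weight_ser k (squares x) $$ 0 = 1"
    unfolding weight_ser_def by blast
  then have "F0 (squares x) $$ 0 = 1"
    by (simp add: F0_ser_def pole_ser_def q fps_mult_nth_0)
  then show "h0_0 k k1 i1 i2 0 x = 1" by (simp add: h0_0_eq hyp_def)
qed

text \<open>
  Two steps of the ladder give \<open>T\<^sub>1\<^sup>2 h\<close> as a multiple of a polynomial of the opposite symmetry under the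
  exchange, hence \<open>T\<^sub>2\<^sup>2 h = - T\<^sub>1\<^sup>2 h\<close> by \<open>T2_T2_swap\<close>.
\<close>

lemma PH_even: "h0_0 k k1 i1 i2 m \<in> PH" "h0_2 k k1 i1 i2 m \<in> PH"
proof -
  have "T i2 (T i2 (h0_0 k k1 i1 i2 m)) = (\<lambda>x. - T i1 (T i1 (h0_0 k k1 i1 i2 m)) x)"
  proof (cases m)
    case 0
    then show ?thesis by (simp add: h0_0_const dunkl_const)
  next
    case (Suc n)
    have h3: "real_polynomial_function (h0_3 k k1 i1 i2 n)"
    proof -
      have *: "h0_3 k k1 i1 i2 n = (\<lambda>x. (1 / (2 * (K + n + 1))) * T i1 (h0_0 k k1 i1 i2 (Suc n)) x)"
        unfolding chain_4_3 using K_pos by (simp add: fun_eq_iff)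
      show ?thesis unfolding * by (intro poly_cmult dunkl_poly even_poly)
    qed
    have "T i1 (T i1 (h0_0 k k1 i1 i2 m)) = (\<lambda>x. 2 * (K + n + 1) * (- 2 * (K - k + k1 + 1/2 + n) * h0_2 k k1 i1 i2 n x))"
      unfolding Suc chain_4_3 dunkl_scale[OF h3] chain_3_2 ..
    then show ?thesis
      using T2_T2_swap[OF even_poly(1)[of m], where s = 1] by (simp add: even_sym)
  qed
  then show "h0_0 k k1 i1 i2 m \<in> PH"
    unfolding PH_alt using even_poly even_off by blast
  have h1: "real_polynomial_function (h0_1 k k1 i1 i2 m)"
  proof -
    have *: "h0_1 k k1 i1 i2 m = (\<lambda>x. (1 / (2 * (K + k + m + 1))) * T i1 (h0_2 k k1 i1 i2 m) x)"
      unfolding chain_2_1 using K_pos k_pos by (simp add: fun_eq_iff)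
    show ?thesis unfolding * by (intro poly_cmult dunkl_poly even_poly)
  qed
  have "T i1 (T i1 (h0_2 k k1 i1 i2 m)) = (\<lambda>x. 2 * (K + k + m + 1) * (2 * (K + k1 + 1/2 + m) * h0_0 k k1 i1 i2 m x))"
    unfolding chain_2_1 dunkl_scale[OF h1] chain_1_0 ..
  then have "T i2 (T i2 (h0_2 k k1 i1 i2 m)) = (\<lambda>x. - T i1 (T i1 (h0_2 k k1 i1 i2 m)) x)"
    using T2_T2_swap[OF even_poly(2)[of m], where s = "-1"] by (simp add: even_sym)
  then show "h0_2 k k1 i1 i2 m \<in> PH"
    unfolding PH_alt using even_poly even_off by blast
qed

lemma PH_h0_even: "even n \<Longrightarrow> h0 n \<in> PH"
  by (cases n rule: mod4_cases) (simp_all only: h_mod4 PH_even, simp_all)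

lemma PH_cancel:
  assumes "(\<lambda>x. c * f x) \<in> PH" "c \<noteq> 0" shows "f \<in> PH"
  using PH_scale[OF assms(1), of "1 / c"] assms(2) by simp

lemma PH_h0: "h0 n \<in> PH"
proof (cases "even n")
  case False
  obtain c where c: "c \<noteq> 0" "T i1 (h0 (Suc n)) = (\<lambda>x. c * h0 n x)" using ladder_step by blast
  have "T i1 (h0 (Suc n)) \<in> PH" using False by (intro PH_dunkl PH_h0_even) simp
  then show ?thesis using PH_cancel c by metis
qed (rule PH_h0_even)

lemma PH_swap: assumes "f \<in> PH" shows "(\<lambda>x. f (refl_swap i1 i2 x)) \<in> PH"
proof -
  have f: "real_polynomial_function f" using assms by (rule PH_poly)
  note sw = dunkl_refl_swap[OF f] dunkl_refl_swap[OF dunkl_poly[OF f]]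
  have "T i2 (T i2 f) = (\<lambda>x. - T i1 (T i1 f) x)" "\<forall>i. i \<notin> {i1, i2} \<longrightarrow> T i f = (\<lambda>x. 0)"
    using assms by (simp_all add: PH_alt)
  then show ?thesis
    unfolding PH_alt using f by (auto simp: sw poly_reflect)
qed

lemma PH_h1: "h1 n \<in> PH"
proof (cases "even n")
  case True
  then show ?thesis unfolding even_swap[OF True] by (intro PH_swap PH_h0)
next
  case False
  then obtain c where "c \<noteq> 0" "T i2 (h0 (n + 2)) = (\<lambda>x. c * h1 n x)" using odd_step by blast
  then show ?thesis using PH_cancel PH_dunkl[OF PH_h0] by metis
qed

lemma ladder: "\<exists>c. c \<noteq> 0 \<and> (T i1 ^^ n) (h0 (d + n)) = (\<lambda>x. c * h0 d x)"
proof (induction n)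
  case 0
  show ?case by (rule exI[of _ 1]) simp
next
  case (Suc n)
  then obtain c where c: "c \<noteq> 0" "(T i1 ^^ n) (h0 (d + n)) = (\<lambda>x. c * h0 d x)" by blast
  obtain c' where c': "c' \<noteq> 0" "T i1 (h0 (Suc (d + n))) = (\<lambda>x. c' * h0 (d + n) x)"
    using ladder_step by blast
  have "(T i1 ^^ Suc n) (h0 (d + Suc n)) = (T i1 ^^ n) (T i1 (h0 (Suc (d + n))))"
    by (simp only: funpow_Suc_right o_apply add_Suc_right)
  also have "\<dots> = (\<lambda>x. c' * c * h0 d x)"
    unfolding c' funpow_dunkl_scale[OF PH_poly[OF PH_h0]] c by (simp add: mult.assoc)
  finally show ?case using c c' by (intro exI[of _ "c' * c"]) simp
qed

lemma h0_zero: "h0 0 = (\<lambda>x. 1)"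
  using h_mod4(1)[of 0] h0_0_const by simp

lemma top_const: "\<exists>c. c \<noteq> 0 \<and> (T i1 ^^ n) (h0 n) = (\<lambda>x. c)"
  using ladder[of n 0] by (auto simp: h0_zero)

lemma T2_h0_1: "T i2 (h0 1) = (\<lambda>x. 0)"
proof -
  have "h0 1 = h0_1 k k1 i1 i2 0" using h_mod4(2)[of 0] by simp
  also have "\<dots> = (\<lambda>x. x $ i1 * h0_0 k k1 i1 i2 0 x)"
    by (rule ext) (simp add: h0_1_eq h0_0_eq hyp_def)
  also have "\<dots> = (\<lambda>x. x $ i1 * 1)" by (simp add: h0_0_const)
  finally have "h0 1 = (\<lambda>x. x $ i1 * 1)" .
  moreover have "T i2 (\<lambda>x. x $ i1 * 1) = (\<lambda>x. x $ i1 * T i2 (\<lambda>x. 1) x)"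
    using i12 by (intro dunkl_even_off real_polynomial_function.intros(2)) auto
  ultimately show ?thesis by (simp add: dunkl_const)
qed

lemma T2_top: "T i2 ((T i1 ^^ n) (h0 (Suc n))) = (\<lambda>x. 0)"
proof -
  obtain c where "(T i1 ^^ n) (h0 (1 + n)) = (\<lambda>x. c * h0 1 x)" using ladder by blast
  then show ?thesis by (simp add: dunkl_scale[OF PH_poly[OF PH_h0]] T2_h0_1[simplified])
qed

lemma T1_above: "(T i1 ^^ Suc n) (h0 n) = (\<lambda>x. 0)"
proof -
  obtain c where "(T i1 ^^ n) (h0 n) = (\<lambda>x. c)" using top_const by blast
  then show ?thesis by (simp add: dunkl_const)
qed

lemma filt_h0: "h0 n \<in> dunkl_filt k k1 (Suc n)"
proof (rule PH_filt[OF PH_h0 T1_above])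
  obtain c where c: "(T i1 ^^ n) (h0 n) = (\<lambda>x. c)" using top_const by blast
  show "(T i1 ^^ n) (T i2 (h0 n)) = (\<lambda>x. 0)"
    unfolding funpow_dunkl_commute[OF PH_poly[OF PH_h0]] c by (rule dunkl_const)
qed

lemma funpow_T2_swap:
  assumes "real_polynomial_function f"
  shows "(T i1 ^^ n) (\<lambda>x. f (refl_swap i1 i2 x)) = (\<lambda>x. (T i2 ^^ n) f (refl_swap i1 i2 x))"
  by (induction n) (simp_all add: dunkl_refl_swap(1)[OF funpow_dunkl_poly[OF assms]])

lemma funpow_T2_even:
  assumes f: "f \<in> PH" shows "(T i2 ^^ (2 * n)) f = (\<lambda>x. (-1) ^ n * (T i1 ^^ (2 * n)) f x)"
proof (induction n)
  case (Suc n)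
  have p: "real_polynomial_function f" using f by (rule PH_poly)
  have "(T i1 ^^ m) f \<in> PH" for m by (induction m) (auto intro: PH_dunkl f)
  then have 2: "T i2 (T i2 ((T i1 ^^ m) f)) = (\<lambda>x. - T i1 (T i1 ((T i1 ^^ m) f)) x)" for m
    by (simp add: PH_alt)
  have "(T i2 ^^ (2 * Suc n)) f = T i2 (T i2 ((T i2 ^^ (2 * n)) f))" by simp
  also have "\<dots> = (\<lambda>x. (-1) ^ n * T i2 (T i2 ((T i1 ^^ (2 * n)) f)) x)"
    unfolding Suc by (simp add: dunkl_scale funpow_dunkl_poly dunkl_poly p)
  finally show ?case unfolding 2 by simp
qed simp

text \<open>
  For even \<open>n\<close> the exchange turns powers of \<open>T\<^sub>1\<close> on \<open>h1 n\<close> into powers of \<open>T\<^sub>2\<close> on \<open>h0 (Suc n)\<close>, which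
  are powers of \<open>T\<^sub>1\<close> up to sign; for odd \<open>n\<close> the extra operator in \<open>h1 n \<sim> T\<^sub>2 (h0 (n + 2))\<close> makes \<open>T\<^sub>2\<^sup>2\<close>
  appear.
\<close>

lemma h1_facts:
  "\<exists>d. d \<noteq> 0 \<and> (T i1 ^^ n) (T i2 (h1 n)) = (\<lambda>x. d)" "(T i1 ^^ Suc n) (h1 n) = (\<lambda>x. 0)"
proof -
  have p: "real_polynomial_function (h0 m)" for m by (rule PH_poly[OF PH_h0])
  have "(\<exists>d. d \<noteq> 0 \<and> (T i1 ^^ n) (T i2 (h1 n)) = (\<lambda>x. d)) \<and> (T i1 ^^ Suc n) (h1 n) = (\<lambda>x. 0)"
  proof (cases "even n")
    case True
    then obtain m where m: "n = 2 * m" by blast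
    obtain c where c: "c \<noteq> 0" "(T i1 ^^ Suc n) (h0 (Suc n)) = (\<lambda>x. c)" using top_const by blast
    have "T i2 (h1 n) = (\<lambda>x. T i1 (h0 (Suc n)) (refl_swap i1 i2 x))"
      unfolding even_swap[OF True] by (rule dunkl_refl_swap(2)[OF p])
    then have "(T i1 ^^ n) (T i2 (h1 n)) = (\<lambda>x. (T i2 ^^ n) (T i1 (h0 (Suc n))) (refl_swap i1 i2 x))"
      by (simp only: funpow_T2_swap[OF dunkl_poly[OF p]])
    also have "(T i2 ^^ n) (T i1 (h0 (Suc n))) = (\<lambda>x. (-1) ^ m * (T i1 ^^ n) (T i1 (h0 (Suc n))) x)"
      unfolding m by (rule funpow_T2_even) (rule PH_dunkl[OF PH_h0])
    also have "(T i1 ^^ n) (T i1 (h0 (Suc n))) = (\<lambda>x. c)"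
      using c(2) by (simp only: funpow_Suc_right o_apply)
    finally have 1: "(T i1 ^^ n) (T i2 (h1 n)) = (\<lambda>x. (-1) ^ m * c)" .
    have "(T i1 ^^ Suc n) (h1 n) = (\<lambda>x. (T i2 ^^ Suc n) (h0 (Suc n)) (refl_swap i1 i2 x))"
      unfolding even_swap[OF True] by (rule funpow_T2_swap[OF p])
    also have "(T i2 ^^ Suc n) (h0 (Suc n)) = T i2 ((T i2 ^^ n) (h0 (Suc n)))" by simp
    also have "(T i2 ^^ n) (h0 (Suc n)) = (\<lambda>x. (-1) ^ m * (T i1 ^^ n) (h0 (Suc n)) x)"
      unfolding m by (rule funpow_T2_even) (rule PH_h0)
    also have "T i2 \<dots> = (\<lambda>x. (-1) ^ m * T i2 ((T i1 ^^ n) (h0 (Suc n))) x)"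
      by (rule dunkl_scale[OF funpow_dunkl_poly[OF p]])
    finally have 2: "(T i1 ^^ Suc n) (h1 n) = (\<lambda>x. 0)" by (simp only: T2_top mult_zero_right)
    show ?thesis using 1 2 c(1) by (intro conjI exI[of _ "(-1) ^ m * c"]) simp_all
  next
    case False
    then obtain e where e: "e \<noteq> 0" "T i2 (h0 (n + 2)) = (\<lambda>x. e * h1 n x)" using odd_step by blast
    then have h1: "h1 n = (\<lambda>x. 1 / e * T i2 (h0 (n + 2)) x)" by simp
    obtain c where c: "c \<noteq> 0" "(T i1 ^^ (n + 2)) (h0 (n + 2)) = (\<lambda>x. c)" using top_const by blast
    have "T i2 (h1 n) = (\<lambda>x. 1 / e * T i2 (T i2 (h0 (n + 2))) x)"
      unfolding h1 by (rule dunkl_scale[OF dunkl_poly[OF p]])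
    also have "T i2 (T i2 (h0 (n + 2))) = (\<lambda>x. - T i1 (T i1 (h0 (n + 2))) x)"
      using PH_h0[of "n + 2"] by (simp add: PH_alt)
    finally have "T i2 (h1 n) = (\<lambda>x. - 1 / e * T i1 (T i1 (h0 (n + 2))) x)" by simp
    then have "(T i1 ^^ n) (T i2 (h1 n)) = (\<lambda>x. - 1 / e * (T i1 ^^ n) (T i1 (T i1 (h0 (n + 2)))) x)"
      by (simp only: funpow_dunkl_scale[OF dunkl_poly[OF dunkl_poly[OF p]]])
    also have "(T i1 ^^ n) (T i1 (T i1 (h0 (n + 2)))) = (\<lambda>x. c)"
      using c(2) by (simp only: add_2_eq_Suc' funpow_Suc_right o_apply)
    finally have 1: "(T i1 ^^ n) (T i2 (h1 n)) = (\<lambda>x. - 1 / e * c)" .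
    have "(T i1 ^^ Suc n) (h1 n) = (\<lambda>x. 1 / e * (T i1 ^^ Suc n) (T i2 (h0 (n + 2))) x)"
      unfolding h1 by (rule funpow_dunkl_scale[OF dunkl_poly[OF p]])
    also have "(T i1 ^^ Suc n) (T i2 (h0 (n + 2))) = T i2 ((T i1 ^^ Suc n) (h0 (Suc (Suc n))))"
      by (simp only: funpow_dunkl_commute[OF p] add_2_eq_Suc')
    finally have 2: "(T i1 ^^ Suc n) (h1 n) = (\<lambda>x. 0)" by (simp only: T2_top mult_zero_right)
    show ?thesis using 1 2 c(1) e(1) by (intro conjI exI[of _ "- 1 / e * c"]) simp_all
  qed
  then show "\<exists>d. d \<noteq> 0 \<and> (T i1 ^^ n) (T i2 (h1 n)) = (\<lambda>x. d)" "(T i1 ^^ Suc n) (h1 n) = (\<lambda>x. 0)"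
    by blast+
qed

lemma filt_h1: "h1 n \<in> dunkl_filt k k1 (Suc (Suc n))"
proof (rule PH_filt[OF PH_h1])
  show "(T i1 ^^ Suc (Suc n)) (h1 n) = (\<lambda>x. 0)"
    using h1_facts(2)[of n] by (simp add: dunkl_const)
  obtain d where "(T i1 ^^ n) (T i2 (h1 n)) = (\<lambda>x. d)" using h1_facts(1) by blast
  then show "(T i1 ^^ Suc n) (T i2 (h1 n)) = (\<lambda>x. 0)" by (simp add: dunkl_const)
qed

theorem planar_basis:
  defines "v \<equiv> \<lambda>r. if even r then h0 (r div 2) else h1 (r div 2)"
  shows "inj v" "fun_space.independent (range v)" "fun_space.span (range v) = PH"
proof -
  obtain c where c: "\<And>n. c n \<noteq> 0" "\<And>n. (T i1 ^^ n) (h0 n) = (\<lambda>x. c n)"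
    using top_const by metis
  obtain d where d: "\<And>n. d n \<noteq> 0" "\<And>n. (T i1 ^^ n) (T i2 (h1 n)) = (\<lambda>x. d n)"
    using h1_facts(1) by metis
  note B = basis_criterion[of h0 h1 c d, OF PH_h0 PH_h1 c(2,1) filt_h0 d(2,1) filt_h1 h1_facts(2)]
  show "inj v" "fun_space.independent (range v)" "fun_space.span (range v) = PH"
    unfolding v_def by (rule B)+
qed

end

theorem mainTheorem1:
  fixes k k1 :: real and i1 i2 :: "'n::finite"
  assumes "i1 \<noteq> i2" and "k > 0" and "k1 > 0"
  shows "inj_on (\<lambda>(n, e). h_planar k k1 i1 i2 n e) (UNIV \<times> {0, 1}) \<and>
         fun_space.independent ((\<lambda>(n, e). h_planar k k1 i1 i2 n e) ` (UNIV \<times> {0, 1})) \<and>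
         fun_space.span ((\<lambda>(n, e). h_planar k k1 i1 i2 n e) ` (UNIV \<times> {0, 1})) =
           planar_harmonics k k1 i1 i2"
proof -
  interpret planar_chain k k1 i1 i2 "(real CARD('n) - 1) * k"
    using assms by unfold_locales auto
  define h where "h = (\<lambda>(n, e). h_planar k k1 i1 i2 n e)"
  define v where "v r = (if even r then h_planar k k1 i1 i2 (r div 2) 0 else h_planar k k1 i1 i2 (r div 2) 1)" for r
  define idx where "idx = (\<lambda>(n, e). 2 * n + e :: nat)"
  have hv: "h p = v (idx p)" if "p \<in> UNIV \<times> {0, 1}" for p
    using that by (auto simp: h_def v_def idx_def)
  have v: "inj v" "fun_space.independent (range v)" "fun_space.span (range v) = planar_harmonics k k1 i1 i2"
    using planar_basis unfolding v_def by blast+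
  have idx_inj: "inj_on idx (UNIV \<times> {0, 1})"
    by (auto simp: inj_on_def idx_def) presburger+
  have idx_range: "idx ` (UNIV \<times> {0, 1}) = UNIV"
  proof (intro equalityI subset_UNIV subsetI)
    fix r :: nat
    have "(r div 2, r mod 2) \<in> UNIV \<times> {0, 1}" by auto
    then show "r \<in> idx ` (UNIV \<times> {0, 1})" by (rule rev_image_eqI) (simp add: idx_def)
  qed
  have "h ` (UNIV \<times> {0, 1}) = (\<lambda>p. v (idx p)) ` (UNIV \<times> {0, 1})"
    by (rule image_cong[OF refl hv])
  also have "\<dots> = v ` (idx ` (UNIV \<times> {0, 1}))"
    by (simp only: image_image)
  finally have img: "h ` (UNIV \<times> {0, 1}) = range v"
    by (simp only: idx_range)
  have "inj_on h (UNIV \<times> {0, 1})"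
  proof (rule inj_onI)
    fix p q assume pq: "p \<in> UNIV \<times> {0, 1}" "q \<in> UNIV \<times> {0, 1}" "h p = h q"
    then have "idx p = idx q" using injD[OF v(1)] by (simp add: hv)
    then show "p = q" using pq idx_inj by (auto dest: inj_onD)
  qed
  then have "inj_on h (UNIV \<times> {0, 1}) \<and> fun_space.independent (h ` (UNIV \<times> {0, 1})) \<and>
    fun_space.span (h ` (UNIV \<times> {0, 1})) = planar_harmonics k k1 i1 i2"
    unfolding img using v(2,3) by blast
  then show ?thesis unfolding h_def .
qed

end
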